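(* Let $A$ be a finite-dimensional algebra over a field $F$, and suppose that $F$ is a splitting field for $A$. Then the following statements are equivalent. (i) $A$ is Morita equivalent to $F$. (ii) $k(A) = 1$.
   Context: Algebras are associative and unital. $K(A)$ denotes the commutator subspace of $A$, i.e. the $F$-subspace of $A$ spanned by all $xy - yx$ with $x, y \in A$, and $k(A) := \operatorname{codim} K(A) = \dim_F A/K(A)$. $F$ is a splitting field for $A$ if $\operatorname{End}_A(S) = F$ for every simple right $A$-module $S$. Morita equivalence of $F$-algebras means $F$-linear equivalence of their module categories. *)

theory Defs
  imports "HOL-Algebra.QuotRing" "Jordan_Normal_Form.Missing_VectorSpace"
begin

section \<open>Algebras over a field\<close>

text \<open>The locale \<^locale>\<open>algebra\<close> of the library is restricted to commutative algebras. As in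
  HOL-Algebra, the zero ring is not excluded.\<close>

locale unital_algebra =
  vectorspace F A + A_ring?: ring A for F (structure) and A (structure) +
  assumes smult_mult_left:
      "\<lbrakk>c \<in> carrier F; x \<in> carrier A; y \<in> carrier A\<rbrakk>
        \<Longrightarrow> (c \<odot>\<^bsub>A\<^esub> x) \<otimes>\<^bsub>A\<^esub> y = c \<odot>\<^bsub>A\<^esub> (x \<otimes>\<^bsub>A\<^esub> y)"
    and smult_mult_right:
      "\<lbrakk>c \<in> carrier F; x \<in> carrier A; y \<in> carrier A\<rbrakk>
        \<Longrightarrow> x \<otimes>\<^bsub>A\<^esub> (c \<odot>\<^bsub>A\<^esub> y) = c \<odot>\<^bsub>A\<^esub> (x \<otimes>\<^bsub>A\<^esub> y)"

definition self_algebra :: "('f, 'm) ring_scheme \<Rightarrow> ('f, 'f) module" where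
  "self_algebra F =
    \<lparr>carrier = carrier F, mult = mult F, one = one F, zero = zero F, add = add F, smult = mult F\<rparr>"

definition commutator_subspace ::
    "('f, 'm) ring_scheme \<Rightarrow> ('f, 'a, 'n) module_scheme \<Rightarrow> 'a set" where
  "commutator_subspace F A =
    module.span F A {x \<otimes>\<^bsub>A\<^esub> y \<ominus>\<^bsub>A\<^esub> y \<otimes>\<^bsub>A\<^esub> x | x y. x \<in> carrier A \<and> y \<in> carrier A}"

text \<open>The quotient of a vector space (or module) by a subspace. The fields \<^const>\<open>mult\<close> and
  \<^const>\<open>one\<close> of the record carry no meaning here.\<close>

definition quotient_space :: "('f, 'a, 'n) module_scheme \<Rightarrow> 'a set \<Rightarrow> ('f, 'a set) module" where
  "quotient_space V W =
    \<lparr>carrier = a_rcosets\<^bsub>V\<^esub> W, mult = (\<lambda>X Y. W), one = W, zero = W, add = set_add V,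
     smult = (\<lambda>c X. \<Union>x\<in>X. W +>\<^bsub>V\<^esub> (c \<odot>\<^bsub>V\<^esub> x))\<rparr>"

definition commutator_codim ::
    "('f, 'm) ring_scheme \<Rightarrow> ('f, 'a, 'n) module_scheme \<Rightarrow> nat" where
  "commutator_codim F A = vectorspace.dim F (quotient_space A (commutator_subspace F A))"


section \<open>Right modules\<close>

text \<open>The locale \<^locale>\<open>module\<close> requires a commutative ring of scalars, so right modules over an
  arbitrary ring are introduced here, on the same record type. The scalar is written first in
  \<^const>\<open>smult\<close>: the product \<open>m r\<close> of the right module \<open>M\<close> is \<open>r \<odot>\<^bsub>M\<^esub> m\<close>, so that
  associativity \<open>m (r s) = (m r) s\<close> reverses the order of \<open>r\<close> and \<open>s\<close>. The fields
  \<^const>\<open>mult\<close> and \<^const>\<open>one\<close> of \<open>M\<close> carry no meaning.\<close>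

locale right_module =
  R?: ring R + M?: abelian_group M
  for R :: "('a, 'm) ring_scheme" (structure) and M :: "('a, 'u, 'n) module_scheme" (structure) +
  assumes act_closed:
      "\<lbrakk>r \<in> carrier R; m \<in> carrier M\<rbrakk> \<Longrightarrow> r \<odot>\<^bsub>M\<^esub> m \<in> carrier M"
    and act_scalar_distr:
      "\<lbrakk>r \<in> carrier R; s \<in> carrier R; m \<in> carrier M\<rbrakk>
        \<Longrightarrow> (r \<oplus>\<^bsub>R\<^esub> s) \<odot>\<^bsub>M\<^esub> m = r \<odot>\<^bsub>M\<^esub> m \<oplus>\<^bsub>M\<^esub> s \<odot>\<^bsub>M\<^esub> m"
    and act_add_distr:
      "\<lbrakk>r \<in> carrier R; m \<in> carrier M; n \<in> carrier M\<rbrakk>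
        \<Longrightarrow> r \<odot>\<^bsub>M\<^esub> (m \<oplus>\<^bsub>M\<^esub> n) = r \<odot>\<^bsub>M\<^esub> m \<oplus>\<^bsub>M\<^esub> r \<odot>\<^bsub>M\<^esub> n"
    and act_assoc:
      "\<lbrakk>r \<in> carrier R; s \<in> carrier R; m \<in> carrier M\<rbrakk>
        \<Longrightarrow> (r \<otimes>\<^bsub>R\<^esub> s) \<odot>\<^bsub>M\<^esub> m = s \<odot>\<^bsub>M\<^esub> (r \<odot>\<^bsub>M\<^esub> m)"
    and act_one: "m \<in> carrier M \<Longrightarrow> \<one>\<^bsub>R\<^esub> \<odot>\<^bsub>M\<^esub> m = m"

definition right_submodule ::
    "('a, 'm) ring_scheme \<Rightarrow> 'u set \<Rightarrow> ('a, 'u, 'n) module_scheme \<Rightarrow> bool" where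
  "right_submodule R N M \<longleftrightarrow>
    N \<subseteq> carrier M \<and> \<zero>\<^bsub>M\<^esub> \<in> N \<and> (\<forall>m\<in>N. \<forall>n\<in>N. m \<oplus>\<^bsub>M\<^esub> n \<in> N) \<and>
    (\<forall>r\<in>carrier R. \<forall>m\<in>N. r \<odot>\<^bsub>M\<^esub> m \<in> N)"

definition simple_right_module ::
    "('a, 'm) ring_scheme \<Rightarrow> ('a, 'u, 'n) module_scheme \<Rightarrow> bool" where
  "simple_right_module R S \<longleftrightarrow>
    right_module R S \<and> carrier S \<noteq> {\<zero>\<^bsub>S\<^esub>} \<and>
    (\<forall>N. right_submodule R N S \<longrightarrow> N = {\<zero>\<^bsub>S\<^esub>} \<or> N = carrier S)"

text \<open>Homomorphisms are taken extensional, so that equality of functions is equality of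
  homomorphisms. The definition of \<^const>\<open>module_hom\<close> makes sense over any ring.\<close>

definition right_hom ::
    "('a, 'm) ring_scheme \<Rightarrow> ('a, 'u, 'n) module_scheme \<Rightarrow> ('a, 'v, 'k) module_scheme
      \<Rightarrow> ('u \<Rightarrow> 'v) set" where
  "right_hom R M N = module_hom R M N \<inter> extensional (carrier M)"

text \<open>Over an \<open>F\<close>-algebra \<open>A\<close>, a scalar \<open>c\<close> acts on right \<open>A\<close>-modules through the element
  \<open>c 1\<^sub>A\<close> of \<open>A\<close>. This induces the \<open>F\<close>-space structure on the sets of homomorphisms.\<close>

definition hom_add ::
    "('a, 'u, 'n) module_scheme \<Rightarrow> ('b, 'v, 'k) module_scheme
      \<Rightarrow> ('u \<Rightarrow> 'v) \<Rightarrow> ('u \<Rightarrow> 'v) \<Rightarrow> ('u \<Rightarrow> 'v)" where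
  "hom_add M N f g = (\<lambda>x\<in>carrier M. f x \<oplus>\<^bsub>N\<^esub> g x)"

definition hom_scale ::
    "('f, 'a, 'm) module_scheme \<Rightarrow> ('a, 'u, 'n) module_scheme \<Rightarrow> ('a, 'v, 'k) module_scheme
      \<Rightarrow> 'f \<Rightarrow> ('u \<Rightarrow> 'v) \<Rightarrow> ('u \<Rightarrow> 'v)" where
  "hom_scale A M N c f = (\<lambda>x\<in>carrier M. (c \<odot>\<^bsub>A\<^esub> \<one>\<^bsub>A\<^esub>) \<odot>\<^bsub>N\<^esub> f x)"

definition hom_id :: "('a, 'u, 'n) module_scheme \<Rightarrow> 'u \<Rightarrow> 'u" where
  "hom_id M = (\<lambda>x\<in>carrier M. x)"


section \<open>Universes\<close>

text \<open>HOL has no class of all sets. "All right modules" are therefore read as all right modules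
  whose underlying set lies in a universe, represented by a type \<open>'u\<close>; the argument
  \<open>TYPE('u)\<close> of the notions below selects it. A universe is adequate for a set if it
  is infinite and contains a copy of that set. Then up to isomorphism it contains all finitely
  generated right modules over a ring with that underlying set, in particular all simple ones.\<close>

definition adequate_universe :: "'u itself \<Rightarrow> 'a set \<Rightarrow> bool" where
  "adequate_universe U X \<longleftrightarrow> infinite (UNIV :: 'u set) \<and> (\<exists>g :: 'a \<Rightarrow> 'u. inj_on g X)"

text \<open>\<open>End\<^sub>A(S) = F\<close> means that the canonical map from \<open>F\<close>, sending \<open>c\<close> to multiplication
  by \<open>c\<close>, is a bijection.\<close>

definition splitting_field ::
    "'u itself \<Rightarrow> ('f, 'm) ring_scheme \<Rightarrow> ('f, 'a, 'n) module_scheme \<Rightarrow> bool" where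
  "splitting_field U F A \<longleftrightarrow>
    (\<forall>S :: ('a, 'u) module. simple_right_module A S \<longrightarrow>
      bij_betw (\<lambda>c. hom_scale A S S c (hom_id S)) (carrier F) (right_hom A S S))"


section \<open>Morita equivalence\<close>

text \<open>A functor is given by its action \<open>T\<close> on objects and its action \<open>t M N\<close> on
  \<open>Hom(M, N)\<close>.\<close>

locale linear_functor =
  fixes F :: "('f, 'm) ring_scheme"
    and A :: "('f, 'a, 'n) module_scheme"
    and B :: "('f, 'b, 'k) module_scheme"
    and T :: "('a, 'u) module \<Rightarrow> ('b, 'u) module"
    and t :: "('a, 'u) module \<Rightarrow> ('a, 'u) module \<Rightarrow> ('u \<Rightarrow> 'u) \<Rightarrow> ('u \<Rightarrow> 'u)"
  assumes on_objects: "right_module A M \<Longrightarrow> right_module B (T M)"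
    and on_homs:
      "\<lbrakk>right_module A M; right_module A N; f \<in> right_hom A M N\<rbrakk>
        \<Longrightarrow> t M N f \<in> right_hom B (T M) (T N)"
    and preserves_id: "right_module A M \<Longrightarrow> t M M (hom_id M) = hom_id (T M)"
    and preserves_comp:
      "\<lbrakk>right_module A M; right_module A N; right_module A P;
        f \<in> right_hom A M N; g \<in> right_hom A N P\<rbrakk>
        \<Longrightarrow> t M P (compose (carrier M) g f) = compose (carrier (T M)) (t N P g) (t M N f)"
    and preserves_add:
      "\<lbrakk>right_module A M; right_module A N; f \<in> right_hom A M N; g \<in> right_hom A M N\<rbrakk>
        \<Longrightarrow> t M N (hom_add M N f g) = hom_add (T M) (T N) (t M N f) (t M N g)"
    and preserves_scale:
      "\<lbrakk>right_module A M; right_module A N; c \<in> carrier F; f \<in> right_hom A M N\<rbrakk>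
        \<Longrightarrow> t M N (hom_scale A M N c f) = hom_scale B (T M) (T N) c (t M N f)"

definition right_iso ::
    "('a, 'm) ring_scheme \<Rightarrow> ('a, 'u, 'n) module_scheme \<Rightarrow> ('a, 'v, 'k) module_scheme
      \<Rightarrow> ('u \<Rightarrow> 'v) \<Rightarrow> bool" where
  "right_iso R M N f \<longleftrightarrow>
    f \<in> right_hom R M N \<and>
    (\<exists>g\<in>right_hom R N M.
      compose (carrier M) g f = hom_id M \<and> compose (carrier N) f g = hom_id N)"

text \<open>A natural isomorphism \<open>\<eta>\<close> from the functor \<open>(T, t)\<close> to the functor \<open>(S, s)\<close>, both from
  right \<open>A\<close>-modules to right \<open>B\<close>-modules.\<close>

definition natural_iso ::
    "('a, 'm) ring_scheme \<Rightarrow> ('b, 'n) ring_scheme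
      \<Rightarrow> (('a, 'u) module \<Rightarrow> ('b, 'u) module)
      \<Rightarrow> (('a, 'u) module \<Rightarrow> ('a, 'u) module \<Rightarrow> ('u \<Rightarrow> 'u) \<Rightarrow> ('u \<Rightarrow> 'u))
      \<Rightarrow> (('a, 'u) module \<Rightarrow> ('b, 'u) module)
      \<Rightarrow> (('a, 'u) module \<Rightarrow> ('a, 'u) module \<Rightarrow> ('u \<Rightarrow> 'u) \<Rightarrow> ('u \<Rightarrow> 'u))
      \<Rightarrow> (('a, 'u) module \<Rightarrow> 'u \<Rightarrow> 'u) \<Rightarrow> bool" where
  "natural_iso A B T t S s \<eta> \<longleftrightarrow>
    (\<forall>M. right_module A M \<longrightarrow> right_iso B (T M) (S M) (\<eta> M)) \<and>
    (\<forall>M N f. right_module A M \<and> right_module A N \<and> f \<in> right_hom A M N \<longrightarrow>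
      compose (carrier (T M)) (\<eta> N) (t M N f) = compose (carrier (T M)) (s M N f) (\<eta> M))"

definition morita_equivalent ::
    "'u itself \<Rightarrow> ('f, 'm) ring_scheme \<Rightarrow> ('f, 'a, 'n) module_scheme
      \<Rightarrow> ('f, 'b, 'k) module_scheme \<Rightarrow> bool" where
  "morita_equivalent U F A B \<longleftrightarrow>
    (\<exists>(T :: ('a, 'u) module \<Rightarrow> ('b, 'u) module) t
      (S :: ('b, 'u) module \<Rightarrow> ('a, 'u) module) s \<eta> \<epsilon>.
      linear_functor F A B T t \<and> linear_functor F B A S s \<and>
      natural_iso A A (\<lambda>M. M) (\<lambda>M N f. f) (\<lambda>M. S (T M)) (\<lambda>M N f. s (T M) (T N) (t M N f)) \<eta> \<and>
      natural_iso B B (\<lambda>M. T (S M)) (\<lambda>M N f. t (S M) (S N) (s M N f)) (\<lambda>M. M) (\<lambda>M N f. f) \<epsilon>)"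

end

theory Submission
  imports Defs
begin

text \<open>Both conditions are equivalent to the existence of an idempotent \<open>e \<noteq> 0\<close> of \<open>A\<close> with
  \<open>e A e = F e\<close> and \<open>A e A = A\<close>, that is, \<open>1 = \<Sum> x\<^sub>i y\<^sub>i\<close> with \<open>x\<^sub>i \<in> A e\<close> and \<open>y\<^sub>i \<in> e A\<close>.

  Given such an \<open>e\<close>, the functors \<open>M \<mapsto> M e\<close> and \<open>V \<mapsto> Hom\<^sub>F(A e, V)\<close> are mutually inverse
  equivalences, and \<open>a \<mapsto> \<Sum> y\<^sub>i a x\<^sub>i \<in> F e\<close> is a trace with kernel \<open>K(A)\<close>. Conversely, the module
  \<open>P\<close> that corresponds to \<open>F\<close> under an equivalence has only scalar endomorphisms, maps
  nontrivially to every nonzero module, and every nonzero map onto it splits; splitting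
  \<open>A \<rightarrow> P\<close> yields \<open>e\<close>, and \<open>A e A = A\<close> since \<open>P = e A\<close> has no nonzero map to \<open>A / A e A\<close>.

  Now let \<open>k(A) = 1\<close>. For a primitive idempotent \<open>e\<close>, the ring \<open>e A e\<close> is local with nil radical
  \<open>N\<close>, and the splitting hypothesis for the simple module on top of \<open>e A\<close> gives a character
  \<open>\<pi>\<close> of \<open>e A e\<close> with kernel \<open>N\<close>. The trace of this simple module is a functional
  \<open>a \<mapsto> \<Sum> \<pi>(y\<^sub>i a x\<^sub>i)\<close> that vanishes on \<open>K(A)\<close> but not at \<open>e\<close>; so no primitive idempotent lies in
  \<open>K(A)\<close>, which is the kernel of the trace. The annihilator \<open>I\<close> of the simple module lies in this
  kernel, hence contains no nonzero idempotent, hence is nil. Therefore \<open>\<Sum> x\<^sub>i y\<^sub>i\<close>, which is \<open>1\<close>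
  modulo \<open>I\<close>, is a unit, and \<open>A e A = A\<close>. After normalising \<open>\<Sum> x\<^sub>i y\<^sub>i = 1\<close>, the map
  \<open>a \<mapsto> \<Sum> y\<^sub>i a x\<^sub>i\<close> sends \<open>K(A)\<close> into \<open>K(e A e) \<subseteq> N\<^sup>2\<close> and is the identity on \<open>e A e\<close> modulo
  \<open>N\<^sup>2\<close>. As \<open>N \<subseteq> I \<subseteq> K(A)\<close>, it follows that \<open>N = N\<^sup>2\<close>, so \<open>N = 0\<close>.\<close>

text \<open>The trace of the simple module is tested at a primitive idempotent and not at
  \<open>1\<close>: in positive characteristic the trace at \<open>1\<close> is a multiple of
  \<open>1\<close> by the dimension and may vanish, whereas \<open>e\<close> acts as a projection of
  rank one, because the residue field of \<open>e A e\<close> is \<open>F\<close>. Neither the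
  Jacobson radical of \<open>A\<close> nor a Wedderburn decomposition appears; their place is taken
  by the Fitting idempotent: for every \<open>a\<close> some power satisfies
  \<open>a^m = g a^m\<close> with an idempotent \<open>g\<close> in \<open>a A\<close>. A right
  ideal without nonzero idempotents is therefore nil, which is how \<open>1 - \<Sum> x_i y_i\<close>
  becomes nilpotent. The inclusion of \<open>K(e A e)\<close> in \<open>N^2\<close> rests on
  \<open>e A e = F e + N\<close>: only the parts in \<open>N\<close> contribute to a commutator.
  Module categories live in a fixed type, so every module that is constructed (a quotient of a right
  ideal, \<open>Hom_F(A e, V)\<close>, the regular modules) has to be coded in that type; finiteness
  of the system \<open>x_i\<close>, \<open>y_i\<close> is what lets \<open>Hom_F(A e, V)\<close>
  fit.\<close>

section \<open>Corners of primitive idempotents\<close>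

context ring
begin

definition idempotent :: "'a \<Rightarrow> bool" where
  "idempotent e \<longleftrightarrow> e \<in> carrier R \<and> e \<otimes> e = e"

text \<open>For an idempotent \<open>e\<close> this is the ring \<open>e R e\<close> with unit
  \<open>e\<close>; in fixed point form, membership is a pair of rewrite rules.\<close>

definition corner :: "'a \<Rightarrow> 'a set" where
  "corner e = {b \<in> carrier R. e \<otimes> b = b \<and> b \<otimes> e = b}"

definition primitive_idempotent :: "'a \<Rightarrow> bool" where
  "primitive_idempotent e \<longleftrightarrow>
    idempotent e \<and> e \<noteq> \<zero> \<and> (\<forall>g\<in>corner e. idempotent g \<longrightarrow> g = \<zero> \<or> g = e)"

text \<open>The definition mentions right inverses. For primitive \<open>e\<close> in a strongly
  pi-regular ring, one-sided inverses in the corner turn out to be two-sided, and this set is the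
  radical of the local ring \<open>e R e\<close>.\<close>

definition corner_nonunits :: "'a \<Rightarrow> 'a set" where
  "corner_nonunits e = {b \<in> corner e. \<not> (\<exists>c\<in>corner e. b \<otimes> c = e)}"

lemma idempotent_carrier: "idempotent e \<Longrightarrow> e \<in> carrier R"
  by (simp add: idempotent_def)

lemma primitive_idempotentD:
  assumes "primitive_idempotent e"
  shows "idempotent e" "e \<in> carrier R" "e \<otimes> e = e" "e \<noteq> \<zero>"
  using assms by (auto simp: primitive_idempotent_def idempotent_def)

lemma cornerD:
  assumes "b \<in> corner e"
  shows "b \<in> carrier R" "e \<otimes> b = b" "b \<otimes> e = b"
  using assms by (auto simp: corner_def)

lemma corner_self: "idempotent e \<Longrightarrow> e \<in> corner e"
  by (simp add: corner_def idempotent_def)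

lemma corner_mult: "e \<in> carrier R \<Longrightarrow> b \<in> corner e \<Longrightarrow> c \<in> corner e \<Longrightarrow> b \<otimes> c \<in> corner e"
  by (simp add: corner_def m_assoc) (simp flip: m_assoc)

lemma corner_add: "e \<in> carrier R \<Longrightarrow> b \<in> corner e \<Longrightarrow> c \<in> corner e \<Longrightarrow> b \<oplus> c \<in> corner e"
  by (simp add: corner_def l_distr r_distr)

lemma corner_minus: "e \<in> carrier R \<Longrightarrow> b \<in> corner e \<Longrightarrow> c \<in> corner e \<Longrightarrow> b \<ominus> c \<in> corner e"
  by (simp add: corner_def minus_eq l_distr r_distr l_minus r_minus)

lemma corner_sandwich:
  assumes "idempotent e" and "a \<in> carrier R"
  shows "e \<otimes> a \<otimes> e \<in> corner e"
proof -
  have e: "e \<in> carrier R" "e \<otimes> e = e" using assms by (auto simp: idempotent_def)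
  have "e \<otimes> (e \<otimes> a \<otimes> e) = (e \<otimes> e) \<otimes> a \<otimes> e" using e(1) assms(2) by (simp add: m_assoc)
  moreover have "(e \<otimes> a \<otimes> e) \<otimes> e = e \<otimes> a \<otimes> (e \<otimes> e)" using e(1) assms(2) by (simp add: m_assoc)
  ultimately show ?thesis using e assms(2) by (simp add: corner_def)
qed

text \<open>The witness is the geometric sum \<open>1 + z + ... + z^(m-1)\<close>, grown by one
  power per step; the same \<open>w\<close> serves on both sides.\<close>

lemma one_minus_power:
  assumes z: "z \<in> carrier R"
  shows "\<exists>w\<in>carrier R. (\<one> \<ominus> z) \<otimes> w = \<one> \<ominus> z [^] (m::nat) \<and> w \<otimes> (\<one> \<ominus> z) = \<one> \<ominus> z [^] m"
proof (induction m)
  case 0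
  show ?case using z by (intro bexI[of _ \<zero>]) (auto simp: minus_eq r_neg)
next
  case (Suc m)
  then obtain w where w: "w \<in> carrier R" "(\<one> \<ominus> z) \<otimes> w = \<one> \<ominus> z [^] m"
    "w \<otimes> (\<one> \<ominus> z) = \<one> \<ominus> z [^] m" by blast
  define p where "p = z [^] m"
  have p: "p \<in> carrier R" using z by (simp add: p_def)
  have zp: "z [^] Suc m = p \<otimes> z" "z [^] Suc m = z \<otimes> p"
    using z nat_pow_Suc2 by (simp_all add: p_def)
  have "(\<one> \<ominus> z) \<otimes> (w \<oplus> p) = (\<one> \<ominus> z) \<otimes> w \<oplus> (\<one> \<ominus> z) \<otimes> p" using w(1) p z by (simp add: r_distr)
  also have "\<dots> = \<one> \<ominus> z \<otimes> p" unfolding w(2) using p z unfolding p_def[symmetric] by algebra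
  finally have 1: "(\<one> \<ominus> z) \<otimes> (w \<oplus> p) = \<one> \<ominus> z [^] Suc m" by (simp only: zp(2))
  have "(w \<oplus> p) \<otimes> (\<one> \<ominus> z) = w \<otimes> (\<one> \<ominus> z) \<oplus> p \<otimes> (\<one> \<ominus> z)" using w(1) p z by (simp add: l_distr)
  also have "\<dots> = \<one> \<ominus> p \<otimes> z" unfolding w(3) using p z unfolding p_def[symmetric]
    by (simp add: minus_eq r_distr r_minus) algebra
  finally have 2: "(w \<oplus> p) \<otimes> (\<one> \<ominus> z) = \<one> \<ominus> z [^] Suc m" by (simp only: zp(1))
  show ?case using 1 2 w(1) p by (intro bexI[of _ "w \<oplus> p"]) auto
qed

lemma one_minus_nilpotent_unit:
  assumes "z \<in> carrier R" and "z [^] (m::nat) = \<zero>"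
  shows "\<exists>w\<in>carrier R. (\<one> \<ominus> z) \<otimes> w = \<one> \<and> w \<otimes> (\<one> \<ominus> z) = \<one>"
  using one_minus_power[OF assms(1), of m] assms(2) by (simp add: minus_eq)

text \<open>An inverse \<open>w\<close> of \<open>1 - n\<close> in the whole ring is cut down to
  \<open>e w e\<close>; this works because \<open>(e - n) e = e (1 - n)\<close>.\<close>

lemma idempotent_minus_nilpotent_unit:
  assumes e: "idempotent e" and n: "n \<in> corner e" "n [^] (m::nat) = \<zero>"
  shows "\<exists>c\<in>corner e. (e \<ominus> n) \<otimes> c = e"
proof -
  obtain w where w: "w \<in> carrier R" "(\<one> \<ominus> n) \<otimes> w = \<one>"
    using one_minus_nilpotent_unit[of n m] n cornerD by blast
  have c: "e \<in> carrier R" "e \<otimes> e = e" "n \<in> carrier R" "n \<otimes> e = n" "e \<otimes> n = n"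
    using e n cornerD by (auto simp: idempotent_def)
  have "(e \<ominus> n) \<otimes> e = e \<otimes> (\<one> \<ominus> n)"
    using c by (simp add: minus_eq l_distr l_minus r_distr r_minus)
  then have "(e \<ominus> n) \<otimes> (e \<otimes> w \<otimes> e) = e \<otimes> (\<one> \<ominus> n) \<otimes> w \<otimes> e"
    using c(1,3) w by (simp flip: m_assoc)
  also have "e \<otimes> (\<one> \<ominus> n) \<otimes> w \<otimes> e = e \<otimes> ((\<one> \<ominus> n) \<otimes> w) \<otimes> e" using c w(1) by (simp add: m_assoc)
  also have "\<dots> = e" using w(2) c by simp
  finally show ?thesis using corner_sandwich[OF e w(1)] by blast
qed

text \<open>A one-sided inverse cancels one factor of \<open>b\<close> at a time, so a vanishing
  power descends to \<open>b = 0\<close>, and then \<open>e = 0\<close>.\<close>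

lemma corner_right_unit_not_nilpotent:
  assumes e: "idempotent e" "e \<noteq> \<zero>" and b: "b \<in> corner e" "c \<in> carrier R"
    and bc: "b \<otimes> c = e \<or> c \<otimes> b = e"
  shows "b [^] (m::nat) \<noteq> \<zero>"
proof
  note bD = cornerD[OF b(1)]
  have step: "b [^] Suc k = \<zero>" if "b [^] Suc (Suc k) = \<zero>" for k :: nat
    using bc
  proof
    assume h: "b \<otimes> c = e"
    have "b [^] Suc k = b [^] k \<otimes> (b \<otimes> e)" using bD by simp
    also have "\<dots> = b [^] Suc (Suc k) \<otimes> c" using bD b(2) by (simp add: m_assoc flip: h)
    finally show ?thesis using that b(2) by simp
  next
    assume h: "c \<otimes> b = e"
    have "b [^] Suc k = (e \<otimes> b) \<otimes> b [^] k" using bD nat_pow_Suc2 by simp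
    also have "\<dots> = c \<otimes> (b \<otimes> (b \<otimes> b [^] k))" using bD(1) b(2) by (simp add: m_assoc flip: h)
    also have "\<dots> = c \<otimes> b [^] Suc (Suc k)" by (simp only: nat_pow_Suc2[OF bD(1)])
    finally show ?thesis using that b(2) by simp
  qed
  have "b [^] Suc k = \<zero> \<Longrightarrow> b = \<zero>" for k :: nat
    by (induction k) (use step bD in \<open>auto\<close>)
  moreover assume "b [^] m = \<zero>"
  \<comment> \<open>The descent is stated for positive exponents; raising the exponent by one also
    covers \<open>m = 0\<close>.\<close>
  then have "b [^] Suc m = \<zero>" using bD by simp
  ultimately have "b = \<zero>" by blast
  then show False using bc b(2) e(2) by auto
qed

end

text \<open>One exponent has to serve on both sides, since the Fitting idempotent is obtained by
  comparing the left and the right multiplier of the same power.\<close>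

locale strongly_pi_regular_ring = ring +
  assumes pi_regular: "b \<in> carrier R \<Longrightarrow>
    \<exists>m::nat. m > 0 \<and> (\<exists>c\<in>carrier R. \<exists>d\<in>carrier R.
      b [^] m = b [^] m \<otimes> b [^] m \<otimes> c \<and> b [^] m = d \<otimes> (b [^] m \<otimes> b [^] m))"
begin

text \<open>For \<open>p = b^m\<close> the two conditions give \<open>d p = d p^2 c = p c\<close>.
  This common value is the Fitting idempotent of \<open>b\<close>; its two descriptions place it in
  \<open>b R\<close> and in \<open>R b\<close>.\<close>

lemma power_multiple_idempotent:
  assumes b: "b \<in> carrier R"
  shows "\<exists>m::nat. m > 0 \<and> (\<exists>c\<in>carrier R. \<exists>d\<in>carrier R. \<exists>g. idempotent g \<and>
    g = b [^] m \<otimes> c \<and> g = d \<otimes> b [^] m \<and> g \<otimes> b [^] m = b [^] m)"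
proof -
  obtain m c d where m: "(m::nat) > 0" and c: "c \<in> carrier R" and d: "d \<in> carrier R"
    and 1: "b [^] m = b [^] m \<otimes> b [^] m \<otimes> c" and 2: "b [^] m = d \<otimes> (b [^] m \<otimes> b [^] m)"
    using pi_regular[OF b] by blast
  define p where "p = b [^] m"
  have p: "p \<in> carrier R" and 1: "p \<otimes> p \<otimes> c = p" and 2: "d \<otimes> (p \<otimes> p) = p"
    using b 1 2 by (simp_all add: p_def)
  have "d \<otimes> p = d \<otimes> (p \<otimes> p \<otimes> c)" using 1 by simp
  also have "\<dots> = d \<otimes> (p \<otimes> p) \<otimes> c" using p c d by (simp add: m_assoc)
  finally have eq: "d \<otimes> p = p \<otimes> c" using 2 by simp
  have "(p \<otimes> c) \<otimes> (p \<otimes> c) = (d \<otimes> p) \<otimes> (p \<otimes> c)" using eq by simp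
  also have "\<dots> = d \<otimes> (p \<otimes> p) \<otimes> c" using p c d by (simp add: m_assoc)
  finally have "idempotent (p \<otimes> c)" using 2 p c by (simp add: idempotent_def)
  moreover have "(p \<otimes> c) \<otimes> p = d \<otimes> (p \<otimes> p)" using eq p d by (simp add: m_assoc flip: eq)
  ultimately show ?thesis using m c d eq 2 unfolding p_def by metis
qed

text \<open>The Fitting idempotent of \<open>b\<close> lies in the corner, so primitivity leaves
  \<open>0\<close> or \<open>e\<close>: in the first case a power of \<open>b\<close> vanishes, in
  the second \<open>e\<close> is a multiple of \<open>b\<close> from either side.\<close>

lemma primitive_corner_nilpotent_or_unit:
  assumes e: "primitive_idempotent e" and b: "b \<in> corner e"
  shows "(\<exists>m::nat. b [^] m = \<zero>) \<or> (\<exists>c\<in>corner e. b \<otimes> c = e \<and> c \<otimes> b = e)"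
proof -
  note eD = primitive_idempotentD[OF e] and bD = cornerD[OF b]
  obtain m c d g where m: "(m::nat) > 0" and c: "c \<in> carrier R" and d: "d \<in> carrier R"
    and g: "idempotent g" "g = b [^] m \<otimes> c" "g = d \<otimes> b [^] m" "g \<otimes> b [^] m = b [^] m"
    using power_multiple_idempotent[OF bD(1)] by blast
  obtain k where k: "m = Suc k" using m gr0_implies_Suc by blast
  have bm: "b [^] m = b [^] k \<otimes> b" "b [^] m = b \<otimes> b [^] k"
    using k bD nat_pow_Suc2 by simp_all
  have "e \<otimes> g = (e \<otimes> b) \<otimes> b [^] k \<otimes> c" unfolding g(2) bm(2)
    using eD(2) bD(1) c by (simp add: m_assoc)
  then have eg: "e \<otimes> g = g" using bD g(2) bm(2) by simp
  have "g \<otimes> e = d \<otimes> (b [^] k \<otimes> (b \<otimes> e))" unfolding g(3) bm(1)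
    using eD(2) bD(1) d by (simp add: m_assoc)
  then have ge: "g \<otimes> e = g" using bD g(3) bm(1) by simp
  have "g = \<zero> \<or> g = e"
    using e g(1) eg ge idempotent_carrier unfolding primitive_idempotent_def corner_def by auto
  then show ?thesis
  proof
    assume "g = \<zero>"
    then have "b [^] m = \<zero>" using g(4) bD by (metis l_null nat_pow_closed)
    then show ?thesis by blast
  next
    assume ge: "g = e"
    \<comment> \<open>One factor \<open>b\<close> is split off from \<open>b [^] m\<close>; what
      remains, compressed to the corner, is a right inverse \<open>u\<close> and a left inverse
      \<open>v\<close>, and these coincide.\<close>
    define u where "u = e \<otimes> (b [^] k \<otimes> c) \<otimes> e"
    define v where "v = e \<otimes> (d \<otimes> b [^] k) \<otimes> e"
    have u: "u \<in> corner e" and v: "v \<in> corner e"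
      unfolding u_def v_def using bD c d by (auto intro!: corner_sandwich[OF eD(1)])
    have "b \<otimes> u = (b \<otimes> e) \<otimes> b [^] k \<otimes> c \<otimes> e" unfolding u_def
      using eD(2) bD(1) c by (simp add: m_assoc)
    also have "\<dots> = g \<otimes> e" using bD bm g(2) by simp
    finally have bu: "b \<otimes> u = e" using ge eD by simp
    have "v \<otimes> b = e \<otimes> (d \<otimes> (b [^] k \<otimes> (e \<otimes> b)))" unfolding v_def
      using eD(2) bD(1) d by (simp add: m_assoc)
    also have "\<dots> = e \<otimes> g" using bD bm g(3) by simp
    finally have vb: "v \<otimes> b = e" using ge eD by simp
    have "v = v \<otimes> (b \<otimes> u)" using bu v by (simp add: cornerD)
    also have "\<dots> = (v \<otimes> b) \<otimes> u" using bD(1) u v by (simp add: cornerD m_assoc)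
    finally have "v = u" using vb u by (simp add: cornerD)
    then show ?thesis using u bu vb by blast
  qed
qed

context
  fixes e assumes e: "primitive_idempotent e"
begin

text \<open>Nilpotency is symmetric in left and right, so through it the one-sided definition of
  nonunits yields statements about inverses on either side.\<close>

lemma corner_nonunits_iff_nilpotent:
  "b \<in> corner_nonunits e \<longleftrightarrow> b \<in> corner e \<and> (\<exists>m::nat. b [^] m = \<zero>)"
  using primitive_corner_nilpotent_or_unit[OF e, of b]
    corner_right_unit_not_nilpotent[of e b] primitive_idempotentD[OF e] cornerD(1)
  unfolding corner_nonunits_def by blast

lemma corner_unit_left:
  assumes "b \<in> corner e" "c \<in> carrier R" "c \<otimes> b = e"
  shows "b \<notin> corner_nonunits e"
  using corner_right_unit_not_nilpotent[of e b c] primitive_idempotentD[OF e] assms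
    corner_nonunits_iff_nilpotent by blast

lemma corner_unit_right:
  assumes "b \<in> corner e" "c \<in> carrier R" "b \<otimes> c = e"
  shows "b \<notin> corner_nonunits e"
  using corner_right_unit_not_nilpotent[of e b c] primitive_idempotentD[OF e] assms
    corner_nonunits_iff_nilpotent by blast

lemma corner_unit_two_sided:
  assumes "b \<in> corner e" "b \<notin> corner_nonunits e"
  shows "\<exists>c\<in>corner e. b \<otimes> c = e \<and> c \<otimes> b = e"
  using primitive_corner_nilpotent_or_unit[OF e] assms corner_nonunits_iff_nilpotent by blast

lemma corner_nonunits_corner: "b \<in> corner_nonunits e \<Longrightarrow> b \<in> corner e"
  by (simp add: corner_nonunits_def)

lemma corner_nonunits_carrier: "b \<in> corner_nonunits e \<Longrightarrow> b \<in> carrier R"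
  by (simp add: corner_nonunits_def corner_def)

lemma idempotent_not_nonunit: "e \<notin> corner_nonunits e"
  using corner_unit_left[of e e] primitive_idempotentD[OF e] corner_self by blast

lemma corner_nonunits_mult_right:
  assumes b: "b \<in> corner_nonunits e" and c: "c \<in> corner e"
  shows "b \<otimes> c \<in> corner_nonunits e"
proof (rule ccontr)
  note eD = primitive_idempotentD[OF e] and bc = cornerD(1)[OF c] corner_nonunits_carrier[OF b]
  assume "b \<otimes> c \<notin> corner_nonunits e"
  then obtain d where d: "d \<in> corner e" "b \<otimes> c \<otimes> d = e"
    using corner_unit_two_sided[of "b \<otimes> c"] corner_mult[OF eD(2) corner_nonunits_corner[OF b] c]
      by blast
  then have "b \<otimes> (c \<otimes> d) = e" using bc cornerD(1)[OF d(1)] by (simp add: m_assoc)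
  then show False
    using corner_unit_right[of b "c \<otimes> d"] bc d cornerD b corner_nonunits_corner by blast
qed

lemma corner_nonunits_mult_left:
  assumes b: "b \<in> corner_nonunits e" and c: "c \<in> corner e"
  shows "c \<otimes> b \<in> corner_nonunits e"
proof (rule ccontr)
  note eD = primitive_idempotentD[OF e] and bc = cornerD(1)[OF c] corner_nonunits_carrier[OF b]
  assume "c \<otimes> b \<notin> corner_nonunits e"
  then obtain d where d: "d \<in> corner e" "d \<otimes> (c \<otimes> b) = e"
    using corner_unit_two_sided[of "c \<otimes> b"] corner_mult[OF eD(2) c corner_nonunits_corner[OF b]]
      by blast
  then have "d \<otimes> c \<otimes> b = e" using bc cornerD(1)[OF d(1)] by (simp add: m_assoc)
  then show False
    using corner_unit_left[of b "d \<otimes> c"] bc d cornerD b corner_nonunits_corner by blast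
qed

text \<open>The usual locality argument: from \<open>u (b + c) = e\<close> follows
  \<open>u b = e - u c\<close> with \<open>u c\<close> nilpotent, so \<open>u b\<close> would be a
  unit.\<close>

lemma corner_nonunits_add:
  assumes b: "b \<in> corner_nonunits e" and c: "c \<in> corner_nonunits e"
  shows "b \<oplus> c \<in> corner_nonunits e"
proof (rule ccontr)
  note eD = primitive_idempotentD[OF e]
  note bc = corner_nonunits_corner[OF b] corner_nonunits_corner[OF c]
  assume "b \<oplus> c \<notin> corner_nonunits e"
  then obtain u where u: "u \<in> corner e" "u \<otimes> (b \<oplus> c) = e"
    using corner_unit_two_sided corner_add[OF eD(2) bc] by blast
  have car: "b \<in> carrier R" "c \<in> carrier R" "u \<in> carrier R" using bc u cornerD by auto
  have uc: "u \<otimes> c \<in> corner_nonunits e" using corner_nonunits_mult_left[OF c u(1)] .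
  have "u \<otimes> b = u \<otimes> (b \<oplus> c) \<ominus> u \<otimes> c" using car by algebra
  then have ub: "u \<otimes> b = e \<ominus> u \<otimes> c" using u by simp
  obtain m where "(u \<otimes> c) [^] (m::nat) = \<zero>" using uc corner_nonunits_iff_nilpotent by blast
  then obtain d where "d \<in> corner e" "(u \<otimes> b) \<otimes> d = e"
    using idempotent_minus_nilpotent_unit[OF eD(1) corner_nonunits_corner[OF uc]] ub by auto
  then show False using corner_nonunits_mult_left[OF b u(1)] unfolding corner_nonunits_def by blast
qed

end

end

section \<open>Subspaces and minimal members of families of subspaces\<close>

lemma (in vectorspace) subspaceI:
  assumes "W \<subseteq> carrier V" and "\<zero>\<^bsub>V\<^esub> \<in> W"
    and "\<And>v w. v \<in> W \<Longrightarrow> w \<in> W \<Longrightarrow> v \<oplus>\<^bsub>V\<^esub> w \<in> W"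
    and "\<And>c v. c \<in> carrier K \<Longrightarrow> v \<in> W \<Longrightarrow> c \<odot>\<^bsub>V\<^esub> v \<in> W"
  shows "subspace K W V"
  using assms vectorspace_axioms module_axioms
  by (auto simp: subspace_def LinearCombinations.submodule_def)

lemma (in vectorspace) subspaceD:
  assumes "subspace K W V"
  shows "W \<subseteq> carrier V" "\<zero>\<^bsub>V\<^esub> \<in> W"
    "\<And>v w. v \<in> W \<Longrightarrow> w \<in> W \<Longrightarrow> v \<oplus>\<^bsub>V\<^esub> w \<in> W"
    "\<And>c v. c \<in> carrier K \<Longrightarrow> v \<in> W \<Longrightarrow> c \<odot>\<^bsub>V\<^esub> v \<in> W"
  using assms by (auto simp: subspace_def LinearCombinations.submodule_def)

lemma (in vectorspace) subspace_uminus: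
  assumes "subspace K W V" and "w \<in> W"
  shows "\<ominus>\<^bsub>V\<^esub> w \<in> W"
proof -
  have "w \<in> carrier V" using assms subspaceD(1) by blast
  then have "(\<ominus>\<^bsub>K\<^esub> \<one>\<^bsub>K\<^esub>) \<odot>\<^bsub>V\<^esub> w = \<ominus>\<^bsub>V\<^esub> w" by (simp add: smult_l_minus)
  moreover have "(\<ominus>\<^bsub>K\<^esub> \<one>\<^bsub>K\<^esub>) \<odot>\<^bsub>V\<^esub> w \<in> W" using assms by (intro subspaceD(4)) auto
  ultimately show ?thesis by simp
qed

lemma (in vectorspace) subspace_minus:
  assumes "subspace K W V" and "v \<in> W" and "w \<in> W"
  shows "v \<ominus>\<^bsub>V\<^esub> w \<in> W"
  using subspaceD(3)[OF assms(1,2) subspace_uminus[OF assms(1,3)]]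
  by (simp add: a_minus_def)

text \<open>A member of least dimension is minimal: a vector of \<open>W\<close> outside a smaller
  member enlarges a largest independent subset of the latter. The descending chain arguments below
  all use this form.\<close>

lemma (in vectorspace) minimal_subspace_exists:
  assumes fd: "fin_dim" and W0: "W0 \<in> S" and S: "\<And>W. W \<in> S \<Longrightarrow> subspace K W V"
  shows "\<exists>W\<in>S. \<forall>W'\<in>S. W' \<subseteq> W \<longrightarrow> W' = W"
proof -
  \<comment> \<open>\<open>Max (C W)\<close> is the dimension of \<open>W\<close>, measured inside
    \<open>V\<close>, so that members need not be turned into vector spaces of their own.\<close>
  define C where "C W = card ` {B. B \<subseteq> W \<and> lin_indpt B}" for W
  have C_le: "n \<le> dim" if "W \<in> S" "n \<in> C W" for W n
    using that li_le_dim(2)[OF fd] subspaceD(1)[OF S] unfolding C_def by blast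
  have fin: "finite (C W)" if "W \<in> S" for W
    using C_le[OF that] by (meson finite_nat_set_iff_bounded_le)
  have "lin_indpt {}" by (auto simp: lin_dep_def)
  then have ne: "C W \<noteq> {}" for W unfolding C_def by blast
  obtain W where W: "W \<in> S" and least: "\<And>W'. W' \<in> S \<Longrightarrow> Max (C W) \<le> Max (C W')"
    using ex_has_least_nat[of "\<lambda>W. W \<in> S" W0 "\<lambda>W. Max (C W)"] W0 by blast
  have "W' = W" if W': "W' \<in> S" "W' \<subseteq> W" for W'
  proof (rule ccontr)
    assume "W' \<noteq> W"
    then obtain v where v: "v \<in> W" "v \<notin> W'" using W' by blast
    have "Max (C W') \<in> C W'" using fin ne W' by simp
    then obtain B where B: "B \<subseteq> W'" "lin_indpt B" "card B = Max (C W')" unfolding C_def by auto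
    have car: "B \<subseteq> carrier V" "v \<in> carrier V" using B W' v W S subspaceD(1) by blast+
    have "span B \<subseteq> W'" using span_is_subset[OF B(1)] S[OF W'(1)] by (simp add: subspace_def)
    then have "lin_indpt (B \<union> {v})"
      using lin_dep_iff_in_span[OF car(1) B(2) car(2)] v B by blast
    moreover have "card (B \<union> {v}) = Suc (card B)"
      using li_le_dim(1)[OF fd car(1) B(2)] v(2) B(1) by (auto simp: card_insert_if)
    ultimately have "Suc (Max (C W')) \<in> C W" using B(1,3) W'(2) v(1) unfolding C_def
      by (intro image_eqI[of _ _ "B \<union> {v}"]) auto
    then have "Suc (Max (C W')) \<le> Max (C W)" using fin[OF W] by simp
    then show False using least[OF W'(1)] by simp
  qed
  then show ?thesis using W by blast
qed

section \<open>One-sided images of multiplication and primitive idempotents\<close>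

context unital_algebra
begin

abbreviation algebra_mult (infixl \<open>\<cdot>\<close> 70) where "x \<cdot> y \<equiv> x \<otimes>\<^bsub>A\<^esub> y"

abbreviation algebra_smult (infixl \<open>\<bullet>\<close> 70) where "c \<bullet> x \<equiv> c \<odot>\<^bsub>A\<^esub> x"

lemma smult_one_mult:
  assumes "c \<in> carrier F" "x \<in> carrier A"
  shows "(c \<bullet> \<one>\<^bsub>A\<^esub>) \<cdot> x = c \<bullet> x" "x \<cdot> (c \<bullet> \<one>\<^bsub>A\<^esub>) = c \<bullet> x"
  using assms by (simp_all add: smult_mult_left smult_mult_right)

lemma corner_smult:
  assumes "e \<in> carrier A" "b \<in> corner e" "c \<in> carrier F"
  shows "c \<bullet> b \<in> corner e"
  using assms by (auto simp: corner_def smult_mult_left smult_mult_right)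

lemma subspace_corner:
  assumes "e \<in> carrier A"
  shows "subspace F (corner e) A"
  using assms corner_smult[OF assms] corner_add[OF assms]
  by (intro subspaceI) (auto simp: corner_def)

lemma subspace_left_image:
  assumes a: "a \<in> carrier A"
  shows "subspace F ((\<lambda>x. a \<cdot> x) ` carrier A) A"
proof (rule subspaceI)
  show "\<zero>\<^bsub>A\<^esub> \<in> (\<lambda>x. a \<cdot> x) ` carrier A"
    using a by (intro image_eqI[of _ _ "\<zero>\<^bsub>A\<^esub>"]) auto
  fix v w assume "v \<in> (\<lambda>x. a \<cdot> x) ` carrier A" "w \<in> (\<lambda>x. a \<cdot> x) ` carrier A"
  then show "v \<oplus>\<^bsub>A\<^esub> w \<in> (\<lambda>x. a \<cdot> x) ` carrier A"
    using a by (auto simp flip: r_distr)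
next
  fix c v assume "c \<in> carrier F" "v \<in> (\<lambda>x. a \<cdot> x) ` carrier A"
  then show "c \<bullet> v \<in> (\<lambda>x. a \<cdot> x) ` carrier A"
    using a by (auto simp flip: smult_mult_right)
qed (use a in auto)

lemma subspace_right_image:
  assumes a: "a \<in> carrier A"
  shows "subspace F ((\<lambda>x. x \<cdot> a) ` carrier A) A"
proof (rule subspaceI)
  show "\<zero>\<^bsub>A\<^esub> \<in> (\<lambda>x. x \<cdot> a) ` carrier A"
    using a by (intro image_eqI[of _ _ "\<zero>\<^bsub>A\<^esub>"]) auto
  fix v w assume "v \<in> (\<lambda>x. x \<cdot> a) ` carrier A" "w \<in> (\<lambda>x. x \<cdot> a) ` carrier A"
  then show "v \<oplus>\<^bsub>A\<^esub> w \<in> (\<lambda>x. x \<cdot> a) ` carrier A"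
    using a by (auto simp flip: l_distr)
next
  fix c v assume "c \<in> carrier F" "v \<in> (\<lambda>x. x \<cdot> a) ` carrier A"
  then show "c \<bullet> v \<in> (\<lambda>x. x \<cdot> a) ` carrier A"
    using a by (auto simp flip: smult_mult_left)
qed (use a in auto)

end

locale fin_dim_algebra = unital_algebra +
  assumes fin_dim: fin_dim
begin

text \<open>The right ideals \<open>b^k A\<close> descend and become constant, so \<open>b^m\<close>
  lies in \<open>b^m A = b^(2m) A\<close>. The statement covers all large \<open>m\<close>, so that
  it can share an exponent with its mirror image.\<close>

lemma power_in_left_image:
  assumes b: "b \<in> carrier A"
  shows "\<exists>k>0. \<forall>m\<ge>k. \<exists>c\<in>carrier A. b [^]\<^bsub>A\<^esub> (m::nat) = b [^]\<^bsub>A\<^esub> m \<cdot> b [^]\<^bsub>A\<^esub> m \<cdot> c"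
proof -
  define I where "I k = (\<lambda>x. b [^]\<^bsub>A\<^esub> k \<cdot> x) ` carrier A" for k :: nat
  have pow: "b [^]\<^bsub>A\<^esub> k \<in> carrier A" for k :: nat using b by simp
  have anti: "I m \<subseteq> I k" if "k \<le> m" for k m
  proof -
    have "b [^]\<^bsub>A\<^esub> m \<cdot> x = b [^]\<^bsub>A\<^esub> k \<cdot> (b [^]\<^bsub>A\<^esub> (m - k) \<cdot> x)" if "x \<in> carrier A" for x
      using b that \<open>k \<le> m\<close> by (simp add: nat_pow_mult flip: m_assoc)
    then show ?thesis unfolding I_def using b by auto
  qed
  have sub: "W \<in> I ` {k. k > 0} \<Longrightarrow> subspace F W A" for W
    unfolding I_def using subspace_left_image[OF pow] by auto
  have "I 1 \<in> I ` {k. k > 0}" by simp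
  from minimal_subspace_exists[OF fin_dim this sub]
  obtain k where k: "k > 0" and min: "\<And>m. m > 0 \<Longrightarrow> I m \<subseteq> I k \<Longrightarrow> I m = I k" by auto
  have "\<exists>c\<in>carrier A. b [^]\<^bsub>A\<^esub> m = b [^]\<^bsub>A\<^esub> m \<cdot> b [^]\<^bsub>A\<^esub> m \<cdot> c" if "m \<ge> k" for m
  proof -
    have "I m = I (m + m)"
      using min[of m] min[of "m + m"] anti[of k m] anti[of k "m + m"] k that by simp
    moreover have "b [^]\<^bsub>A\<^esub> m \<in> I m" unfolding I_def using b
      by (intro image_eqI[of _ _ "\<one>\<^bsub>A\<^esub>"]) auto
    ultimately show ?thesis unfolding I_def using b by (auto simp: nat_pow_mult)
  qed
  then show ?thesis using k by blast
qed

lemma power_in_right_image: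
  assumes b: "b \<in> carrier A"
  shows "\<exists>k>0. \<forall>m\<ge>k. \<exists>d\<in>carrier A. b [^]\<^bsub>A\<^esub> (m::nat) = d \<cdot> (b [^]\<^bsub>A\<^esub> m \<cdot> b [^]\<^bsub>A\<^esub> m)"
proof -
  define I where "I k = (\<lambda>x. x \<cdot> b [^]\<^bsub>A\<^esub> k) ` carrier A" for k :: nat
  have pow: "b [^]\<^bsub>A\<^esub> k \<in> carrier A" for k :: nat using b by simp
  have anti: "I m \<subseteq> I k" if "k \<le> m" for k m
  proof -
    have "x \<cdot> b [^]\<^bsub>A\<^esub> m = (x \<cdot> b [^]\<^bsub>A\<^esub> (m - k)) \<cdot> b [^]\<^bsub>A\<^esub> k" if "x \<in> carrier A" for x
      using b that \<open>k \<le> m\<close> by (simp add: nat_pow_mult m_assoc)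
    then show ?thesis unfolding I_def using b by auto
  qed
  have sub: "W \<in> I ` {k. k > 0} \<Longrightarrow> subspace F W A" for W
    unfolding I_def using subspace_right_image[OF pow] by auto
  have "I 1 \<in> I ` {k. k > 0}" by simp
  from minimal_subspace_exists[OF fin_dim this sub]
  obtain k where k: "k > 0" and min: "\<And>m. m > 0 \<Longrightarrow> I m \<subseteq> I k \<Longrightarrow> I m = I k" by auto
  have "\<exists>d\<in>carrier A. b [^]\<^bsub>A\<^esub> m = d \<cdot> (b [^]\<^bsub>A\<^esub> m \<cdot> b [^]\<^bsub>A\<^esub> m)" if "m \<ge> k" for m
  proof -
    have "I m = I (m + m)"
      using min[of m] min[of "m + m"] anti[of k m] anti[of k "m + m"] k that by simp
    moreover have "b [^]\<^bsub>A\<^esub> m \<in> I m" unfolding I_def using b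
      by (intro image_eqI[of _ _ "\<one>\<^bsub>A\<^esub>"]) auto
    ultimately show ?thesis unfolding I_def using b by (auto simp: nat_pow_mult)
  qed
  then show ?thesis using k by blast
qed

text \<open>Each side is stable from some exponent on, so the sum of the two bounds serves
  both.\<close>

sublocale pi_regular?: strongly_pi_regular_ring A
proof
  fix b assume b: "b \<in> carrier A"
  obtain k l where k: "k > 0" "\<forall>m\<ge>k. \<exists>c\<in>carrier A. b [^]\<^bsub>A\<^esub> (m::nat) = b [^]\<^bsub>A\<^esub> m \<cdot> b [^]\<^bsub>A\<^esub> m \<cdot> c"
    and l: "\<forall>m\<ge>l. \<exists>d\<in>carrier A. b [^]\<^bsub>A\<^esub> (m::nat) = d \<cdot> (b [^]\<^bsub>A\<^esub> m \<cdot> b [^]\<^bsub>A\<^esub> m)"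
    using power_in_left_image[OF b] power_in_right_image[OF b] by meson
  show "\<exists>m::nat. m > 0 \<and> (\<exists>c\<in>carrier A. \<exists>d\<in>carrier A.
      b [^]\<^bsub>A\<^esub> m = b [^]\<^bsub>A\<^esub> m \<cdot> b [^]\<^bsub>A\<^esub> m \<cdot> c \<and> b [^]\<^bsub>A\<^esub> m = d \<cdot> (b [^]\<^bsub>A\<^esub> m \<cdot> b [^]\<^bsub>A\<^esub> m))"
    using k(1) k(2)[rule_format, of "k + l"] l[rule_format, of "k + l"]
    by (intro exI[of _ "k + l"]) auto
qed

text \<open>A nonzero idempotent \<open>h\<close> with minimal corner is primitive: a nonzero
  idempotent \<open>k\<close> in \<open>corner h\<close> has \<open>corner k = corner h\<close>, so
  \<open>h\<close> lies in \<open>corner k\<close>, and \<open>k h\<close> equals both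
  \<open>h\<close> and \<open>k\<close>.\<close>

lemma primitive_idempotent_below:
  assumes g: "idempotent g" "g \<noteq> \<zero>\<^bsub>A\<^esub>"
  shows "\<exists>e\<in>corner g. primitive_idempotent e"
proof -
  define S where "S = corner ` {h \<in> corner g. idempotent h \<and> h \<noteq> \<zero>\<^bsub>A\<^esub>}"
  have "corner g \<in> S" unfolding S_def using g corner_self by blast
  have sub: "W \<in> S \<Longrightarrow> subspace F W A" for W
    unfolding S_def using subspace_corner idempotent_carrier by blast
  obtain W where W: "W \<in> S" "\<forall>W'\<in>S. W' \<subseteq> W \<longrightarrow> W' = W"
    using minimal_subspace_exists[OF fin_dim \<open>corner g \<in> S\<close> sub] by blast
  then obtain h where h: "h \<in> corner g" "idempotent h" "h \<noteq> \<zero>\<^bsub>A\<^esub>"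
    and Wh: "W = corner h"
    unfolding S_def by blast
  have min: "W' = corner h" if "W' \<in> S" "W' \<subseteq> corner h" for W'
    using W(2) that Wh by blast
  have trans: "corner k \<subseteq> corner l" if "k \<in> corner l" "l \<in> carrier A" for k l
  proof
    fix b assume b: "b \<in> corner k"
    note D = cornerD[OF that(1)] cornerD[OF b]
    have "l \<cdot> b = b" by (metis D that(2) m_assoc)
    moreover have "b \<cdot> l = b" by (metis D that(2) m_assoc)
    ultimately show "b \<in> corner l" using D by (simp add: corner_def)
  qed
  have "k = h" if k: "k \<in> corner h" "idempotent k" "k \<noteq> \<zero>\<^bsub>A\<^esub>" for k
  proof -
    have "corner k \<in> S" unfolding S_def
      using k trans[OF h(1)] g(1) idempotent_carrier by blast
    then have "corner k = corner h"
      using min trans[OF k(1)] h(2) idempotent_carrier by blast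
    then have "h \<in> corner k" using corner_self[OF h(2)] by simp
    then show ?thesis using cornerD[OF k(1)] cornerD(2) by fastforce
  qed
  then have "primitive_idempotent h"
    unfolding primitive_idempotent_def using h by blast
  then show ?thesis using h(1) by blast
qed

end


section \<open>Quotient spaces and commutators\<close>

text \<open>The map is controlled on \<open>W\<close> alone: later it is a linear map defined on
  \<open>A e\<close> and extended arbitrarily. For infinite \<open>I\<close> both sums have the
  default value zero, matched by \<open>f 0 = 0\<close>.\<close>

lemma finsum_additive_on:
  assumes "abelian_monoid G" and "abelian_monoid H"
    and W: "W \<subseteq> carrier G" "\<zero>\<^bsub>G\<^esub> \<in> W" "\<And>x y. x \<in> W \<Longrightarrow> y \<in> W \<Longrightarrow> x \<oplus>\<^bsub>G\<^esub> y \<in> W"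
    and f: "\<And>x. x \<in> W \<Longrightarrow> f x \<in> carrier H" "f \<zero>\<^bsub>G\<^esub> = \<zero>\<^bsub>H\<^esub>"
    and add: "\<And>x y. x \<in> W \<Longrightarrow> y \<in> W \<Longrightarrow> f (x \<oplus>\<^bsub>G\<^esub> y) = f x \<oplus>\<^bsub>H\<^esub> f y"
    and g: "\<And>i. i \<in> I \<Longrightarrow> g i \<in> W"
  shows "f (finsum G g I) = (\<Oplus>\<^bsub>H\<^esub>i\<in>I. f (g i))"
proof -
  interpret G: abelian_monoid G by fact
  interpret H: abelian_monoid H by fact
  show ?thesis
  proof (cases "finite I")
    case True
    then have "(\<forall>i\<in>I. g i \<in> W) \<longrightarrow> finsum G g I \<in> W \<and> f (finsum G g I) = (\<Oplus>\<^bsub>H\<^esub>i\<in>I. f (g i))"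
    proof induction
      case (insert i I)
      show ?case
      proof
        assume g: "\<forall>j\<in>insert i I. g j \<in> W"
        then have "g \<in> I \<rightarrow> carrier G" "g i \<in> carrier G" "(\<lambda>j. f (g j)) \<in> I \<rightarrow> carrier H"
          "f (g i) \<in> carrier H" using W(1) f(1) by auto
        then show "finsum G g (insert i I) \<in> W \<and>
            f (finsum G g (insert i I)) = (\<Oplus>\<^bsub>H\<^esub>j\<in>insert i I. f (g j))"
          using insert g W(3) by (simp add: add)
      qed
    qed (simp add: f W)
    then show ?thesis using g by blast
  qed (simp add: f G.finsum_infinite H.finsum_infinite)
qed

lemma finsum_additive_map:
  assumes "abelian_monoid G" and "abelian_monoid H"
    and f: "f \<in> carrier G \<rightarrow> carrier H" "f \<zero>\<^bsub>G\<^esub> = \<zero>\<^bsub>H\<^esub>"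
    and add: "\<And>x y. x \<in> carrier G \<Longrightarrow> y \<in> carrier G \<Longrightarrow> f (x \<oplus>\<^bsub>G\<^esub> y) = f x \<oplus>\<^bsub>H\<^esub> f y"
    and g: "g \<in> I \<rightarrow> carrier G"
  shows "f (finsum G g I) = (\<Oplus>\<^bsub>H\<^esub>i\<in>I. f (g i))"
proof -
  interpret G: abelian_monoid G by fact
  show ?thesis using assms by (intro finsum_additive_on[where W = "carrier G"]) auto
qed

lemma (in abelian_monoid) finsum_lessThan_Suc:
  assumes "f \<in> {..<Suc n} \<rightarrow> carrier G"
  shows "(\<Oplus>i\<in>{..<Suc n}. f i) = f n \<oplus> (\<Oplus>i\<in>{..<n}. f i)"
  using assms by (simp add: lessThan_Suc Pi_def)

context vectorspace
begin

context
  fixes W assumes W: "subspace K W V"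
begin

lemma subspace_abelian_subgroup: "abelian_subgroup W V"
proof (rule abelian_subgroupI3)
  show "additive_subgroup W V"
    using subspaceD[OF W] subspace_uminus[OF W]
    by (intro additive_subgroup.intro M.add.subgroupI) (auto simp: a_inv_def)
qed (rule M.abelian_group_axioms)

lemma coset_eq_iff:
  assumes "v \<in> carrier V" "w \<in> carrier V"
  shows "W +>\<^bsub>V\<^esub> v = W +>\<^bsub>V\<^esub> w \<longleftrightarrow> v \<ominus>\<^bsub>V\<^esub> w \<in> W"
proof -
  interpret W: abelian_subgroup W V by (rule subspace_abelian_subgroup)
  show ?thesis
  proof
    assume "W +>\<^bsub>V\<^esub> v = W +>\<^bsub>V\<^esub> w"
    then have "v \<in> W +>\<^bsub>V\<^esub> w" using W.a_rcos_self assms by blast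
    then obtain h where h: "h \<in> W" "v = h \<oplus>\<^bsub>V\<^esub> w" by (auto simp: a_r_coset_def r_coset_def)
    then have "h \<in> carrier V" using subspaceD(1)[OF W] by blast
    then have "v \<ominus>\<^bsub>V\<^esub> w = h" using h assms by (simp add: a_minus_def M.a_assoc M.r_neg)
    then show "v \<ominus>\<^bsub>V\<^esub> w \<in> W" using h by simp
  next
    assume h: "v \<ominus>\<^bsub>V\<^esub> w \<in> W"
    have "v = (v \<ominus>\<^bsub>V\<^esub> w) \<oplus>\<^bsub>V\<^esub> w" using assms by (simp add: a_minus_def M.a_assoc M.l_neg)
    then have "v \<in> W +>\<^bsub>V\<^esub> w" using M.a_rcosI[OF h subspaceD(1)[OF W] assms(2)] by simp
    then show "W +>\<^bsub>V\<^esub> v = W +>\<^bsub>V\<^esub> w"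
      using M.a_repr_independence[OF _ assms(2)] W.a_subgroup by metis
  qed
qed

abbreviation "quot \<equiv> quotient_space V W"

lemma quotient_carrier: "carrier quot = (\<lambda>v. W +>\<^bsub>V\<^esub> v) ` carrier V"
  by (auto simp: quotient_space_def A_RCOSETS_def RCOSETS_def a_r_coset_def)

lemma quotient_zero: "\<zero>\<^bsub>quot\<^esub> = W +>\<^bsub>V\<^esub> \<zero>\<^bsub>V\<^esub>"
  using subspaceD(1)[OF W] by (simp add: quotient_space_def)

lemma quotient_add:
  assumes "v \<in> carrier V" "w \<in> carrier V"
  shows "(W +>\<^bsub>V\<^esub> v) \<oplus>\<^bsub>quot\<^esub> (W +>\<^bsub>V\<^esub> w) = W +>\<^bsub>V\<^esub> (v \<oplus>\<^bsub>V\<^esub> w)"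
  using abelian_subgroup.a_rcos_sum[OF subspace_abelian_subgroup assms]
  by (simp add: quotient_space_def)

text \<open>The scalar action of \<open>quotient_space\<close> is a union over all representatives;
  all the cosets in this union are equal.\<close>

lemma quotient_smult:
  assumes c: "c \<in> carrier K" and v: "v \<in> carrier V"
  shows "c \<odot>\<^bsub>quot\<^esub> (W +>\<^bsub>V\<^esub> v) = W +>\<^bsub>V\<^esub> (c \<odot>\<^bsub>V\<^esub> v)"
proof -
  have eq: "W +>\<^bsub>V\<^esub> (c \<odot>\<^bsub>V\<^esub> x) = W +>\<^bsub>V\<^esub> (c \<odot>\<^bsub>V\<^esub> v)" if "x \<in> W +>\<^bsub>V\<^esub> v" for x
  proof -
    obtain h where h: "h \<in> W" "x = h \<oplus>\<^bsub>V\<^esub> v" using \<open>x \<in> _\<close> by (auto simp: a_r_coset_def r_coset_def)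
    have hc: "h \<in> carrier V" using h subspaceD(1)[OF W] by blast
    then have "c \<odot>\<^bsub>V\<^esub> x \<ominus>\<^bsub>V\<^esub> c \<odot>\<^bsub>V\<^esub> v = c \<odot>\<^bsub>V\<^esub> h"
      using h c v by (simp add: smult_r_distr a_minus_def M.a_assoc M.r_neg)
    then show ?thesis
      using coset_eq_iff[of "c \<odot>\<^bsub>V\<^esub> x" "c \<odot>\<^bsub>V\<^esub> v"] subspaceD(4)[OF W c h(1)] h hc c v by simp
  qed
  have "v \<in> W +>\<^bsub>V\<^esub> v"
    using abelian_subgroup.a_rcos_self[OF subspace_abelian_subgroup v] .
  then have "(\<Union>x\<in>W +>\<^bsub>V\<^esub> v. W +>\<^bsub>V\<^esub> (c \<odot>\<^bsub>V\<^esub> x)) = W +>\<^bsub>V\<^esub> (c \<odot>\<^bsub>V\<^esub> v)"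
    by (intro SUP_eq_const eq) auto
  then show ?thesis by (simp add: quotient_space_def)
qed

lemma quotient_vectorspace: "vectorspace K quot"
proof -
  have cases: thesis if "X \<in> carrier quot" "\<And>v. v \<in> carrier V \<Longrightarrow> X = W +>\<^bsub>V\<^esub> v \<Longrightarrow> thesis" for X thesis
    using that quotient_carrier by blast
  have mem: "v \<in> carrier V \<Longrightarrow> W +>\<^bsub>V\<^esub> v \<in> carrier quot" for v using quotient_carrier by blast
  note laws = quotient_zero quotient_add quotient_smult mem
  have "abelian_group quot"
  proof (rule abelian_groupI)
    fix X assume "X \<in> carrier quot"
    then obtain v where v: "v \<in> carrier V" "X = W +>\<^bsub>V\<^esub> v" by (rule cases)
    then have "(W +>\<^bsub>V\<^esub> (\<ominus>\<^bsub>V\<^esub> v)) \<oplus>\<^bsub>quot\<^esub> X = \<zero>\<^bsub>quot\<^esub>" by (simp add: laws M.l_neg)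
    then show "\<exists>Y\<in>carrier quot. Y \<oplus>\<^bsub>quot\<^esub> X = \<zero>\<^bsub>quot\<^esub>"
      using mem[of "\<ominus>\<^bsub>V\<^esub> v"] v by blast
  qed (auto elim!: cases simp: laws M.a_assoc M.a_comm M.a_lcomm)
  then have "module K quot"
    by (intro moduleI R.cring_axioms)
      (auto elim!: cases simp: laws smult_l_distr smult_r_distr smult_assoc1)
  then show ?thesis by (simp add: vectorspace_def field_axioms)
qed

lemma quotient_linear_map: "linear_map K V quot (\<lambda>v. W +>\<^bsub>V\<^esub> v)"
proof (intro linear_map.intro mod_hom.intro mod_hom_axioms.intro)
  show "module K quot" using quotient_vectorspace by (simp add: vectorspace_def)
  show "(\<lambda>v. W +>\<^bsub>V\<^esub> v) \<in> module_hom K V quot"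
    by (auto simp: module_hom_def quotient_add quotient_smult quotient_carrier)
qed (rule quotient_vectorspace vectorspace_axioms module_axioms)+

text \<open>The quotient is nonzero and spanned by the class of \<open>z\<close>. In this form
  \<open>k(A) = 1\<close> can be used with elements and without the quotient.\<close>

lemma quotient_dim_1_iff:
  assumes fd: fin_dim
  shows "vectorspace.dim K quot = 1 \<longleftrightarrow>
    (\<exists>z\<in>carrier V. z \<notin> W \<and> (\<forall>v\<in>carrier V. \<exists>c\<in>carrier K. v \<ominus>\<^bsub>V\<^esub> c \<odot>\<^bsub>V\<^esub> z \<in> W))"
proof -
  interpret Q: vectorspace K quot by (rule quotient_vectorspace)
  have span: "Q.span {X} = (\<lambda>c. c \<odot>\<^bsub>quot\<^esub> X) ` carrier K" if "X \<in> carrier quot" for X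
  proof -
    have lincomb: "Q.lincomb a {X} = a X \<odot>\<^bsub>quot\<^esub> X" if "a X \<in> carrier K" for a
      using that \<open>X \<in> carrier quot\<close> by (simp add: Q.lincomb_def)
    then have "c \<odot>\<^bsub>quot\<^esub> X \<in> Q.span {X}" if "c \<in> carrier K" for c
      using that \<open>X \<in> carrier quot\<close> by (auto simp: Q.finite_span intro!: exI[of _ "\<lambda>_. c"])
    moreover have "\<exists>c\<in>carrier K. Y = c \<odot>\<^bsub>quot\<^esub> X" if "Y \<in> Q.span {X}" for Y
      using that lincomb \<open>X \<in> carrier quot\<close> by (auto simp: Q.finite_span)
    ultimately show ?thesis by blast
  qed
  have gen_iff: "Q.gen_set {W +>\<^bsub>V\<^esub> z} \<longleftrightarrow>
      (\<forall>v\<in>carrier V. \<exists>c\<in>carrier K. v \<ominus>\<^bsub>V\<^esub> c \<odot>\<^bsub>V\<^esub> z \<in> W)" if z: "z \<in> carrier V" for z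
  proof -
    have "W +>\<^bsub>V\<^esub> z \<in> carrier quot" using z quotient_carrier by blast
    from span[OF this]
    have "Q.span {W +>\<^bsub>V\<^esub> z} = (\<lambda>c. W +>\<^bsub>V\<^esub> (c \<odot>\<^bsub>V\<^esub> z)) ` carrier K"
      using z by (simp add: quotient_smult cong: image_cong_simp)
    moreover have "Q.span {W +>\<^bsub>V\<^esub> z} \<subseteq> carrier quot"
      using z quotient_carrier by (intro Q.span_is_subset2) blast
    then have "Q.gen_set {W +>\<^bsub>V\<^esub> z} \<longleftrightarrow> carrier quot \<subseteq> Q.span {W +>\<^bsub>V\<^esub> z}"
      by blast
    ultimately have "Q.gen_set {W +>\<^bsub>V\<^esub> z} \<longleftrightarrow>
      (\<forall>v\<in>carrier V. W +>\<^bsub>V\<^esub> v \<in> (\<lambda>c. W +>\<^bsub>V\<^esub> (c \<odot>\<^bsub>V\<^esub> z)) ` carrier K)"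
      by (simp only: quotient_carrier image_subset_iff)
    then show ?thesis using z by (simp add: coset_eq_iff image_iff)
  qed
  have nz: "W +>\<^bsub>V\<^esub> z = \<zero>\<^bsub>quot\<^esub> \<longleftrightarrow> z \<in> W" if "z \<in> carrier V" for z
    using coset_eq_iff[OF that M.zero_closed] that
      by (simp add: quotient_zero a_minus_def M.minus_equality[of "\<zero>\<^bsub>V\<^esub>" "\<zero>\<^bsub>V\<^esub>"])
  show ?thesis
  proof
    assume dim: "Q.dim = 1"
    \<comment> \<open>Finite dimension comes first, as it provides a basis whose size is
      \<open>dim\<close>.\<close>
    have "Q.fin_dim"
      using linear_map.rank_nullity_main(2)[OF quotient_linear_map fd]
        by (simp add: quotient_carrier)
    then obtain B where B: "finite B" "Q.basis B" using Q.finite_basis_exists by blast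
    then have "card B = 1" using Q.dim_basis dim by simp
    then obtain X where X: "B = {X}" using card_1_singletonE by blast
    then have Xb: "Q.lin_indpt {X}" "Q.gen_set {X}" "X \<in> carrier quot"
      using B by (auto simp: Q.basis_def)
    then have "X \<noteq> \<zero>\<^bsub>quot\<^esub>" using Q.vs_zero_lin_dep[of "{X}"] by auto
    moreover obtain z where z: "z \<in> carrier V" "X = W +>\<^bsub>V\<^esub> z" using Xb(3) quotient_carrier by blast
    ultimately have "z \<notin> W" "\<forall>v\<in>carrier V. \<exists>c\<in>carrier K. v \<ominus>\<^bsub>V\<^esub> c \<odot>\<^bsub>V\<^esub> z \<in> W"
      using Xb(2) gen_iff[OF z(1)] nz[OF z(1)] by auto
    then show "\<exists>z\<in>carrier V. z \<notin> W \<and> (\<forall>v\<in>carrier V. \<exists>c\<in>carrier K. v \<ominus>\<^bsub>V\<^esub> c \<odot>\<^bsub>V\<^esub> z \<in> W)"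
      using z(1) by blast
  next
    assume "\<exists>z\<in>carrier V. z \<notin> W \<and> (\<forall>v\<in>carrier V. \<exists>c\<in>carrier K. v \<ominus>\<^bsub>V\<^esub> c \<odot>\<^bsub>V\<^esub> z \<in> W)"
    then obtain z where "z \<in> carrier V" "z \<notin> W" "Q.gen_set {W +>\<^bsub>V\<^esub> z}" using gen_iff by blast
    then show "Q.dim = 1" using nz quotient_carrier by (intro Q.dim1I) auto
  qed
qed

end

end

section \<open>Principal one-sided ideals and the commutator subspace\<close>

context ring
begin

text \<open>For an idempotent \<open>e\<close> this is \<open>e R\<close>, and its counterpart
  \<open>principal_left e\<close> is \<open>R e\<close>.\<close>

definition principal_right :: "'a \<Rightarrow> 'a set" where
  "principal_right e = {y \<in> carrier R. e \<otimes> y = y}"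

definition principal_left :: "'a \<Rightarrow> 'a set" where
  "principal_left e = {x \<in> carrier R. x \<otimes> e = x}"

lemma principal_rightD: "y \<in> principal_right e \<Longrightarrow> y \<in> carrier R" "y \<in> principal_right e \<Longrightarrow> e \<otimes> y = y"
  by (auto simp: principal_right_def)

lemma principal_leftD: "x \<in> principal_left e \<Longrightarrow> x \<in> carrier R" "x \<in> principal_left e \<Longrightarrow> x \<otimes> e = x"
  by (auto simp: principal_left_def)

lemma corner_principal: "corner e = principal_right e \<inter> principal_left e"
  by (auto simp: corner_def principal_right_def principal_left_def)

lemma principal_right_mult:
  "e \<in> carrier R \<Longrightarrow> y \<in> principal_right e \<Longrightarrow> a \<in> carrier R \<Longrightarrow> y \<otimes> a \<in> principal_right e"
  by (simp add: principal_right_def flip: m_assoc)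

lemma principal_left_mult:
  "e \<in> carrier R \<Longrightarrow> x \<in> principal_left e \<Longrightarrow> a \<in> carrier R \<Longrightarrow> a \<otimes> x \<in> principal_left e"
  by (simp add: principal_left_def m_assoc)

lemma principal_mult_corner:
  "e \<in> carrier R \<Longrightarrow> y \<in> principal_right e \<Longrightarrow> x \<in> principal_left e \<Longrightarrow> y \<otimes> x \<in> corner e"
  by (simp add: corner_principal principal_right_mult principal_left_mult principal_rightD principal_leftD)

lemma principal_sandwich_corner:
  "e \<in> carrier R \<Longrightarrow> y \<in> principal_right e \<Longrightarrow> a \<in> carrier R \<Longrightarrow> x \<in> principal_left e \<Longrightarrow>
    y \<otimes> a \<otimes> x \<in> corner e"
  by (simp add: principal_mult_corner principal_right_mult)

end

context unital_algebra
begin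

definition commutators :: "'c set" where
  "commutators = {x \<cdot> y \<ominus>\<^bsub>A\<^esub> y \<cdot> x | x y. x \<in> carrier A \<and> y \<in> carrier A}"

lemma commutator_subspace_span: "commutator_subspace F A = span commutators"
  by (simp add: commutator_subspace_def commutators_def)

lemma commutators_carrier: "commutators \<subseteq> carrier A"
  by (auto simp: commutators_def)

lemma subspace_commutator_subspace: "subspace F (commutator_subspace F A) A"
  by (simp add: commutator_subspace_span span_is_subspace commutators_carrier)

lemma commutator_in_subspace:
  "x \<in> carrier A \<Longrightarrow> y \<in> carrier A \<Longrightarrow> x \<cdot> y \<ominus>\<^bsub>A\<^esub> y \<cdot> x \<in> commutator_subspace F A"
  using in_own_span[OF commutators_carrier] by (auto simp: commutator_subspace_span commutators_def)

lemma commutator_subspace_least: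
  assumes "subspace F W A"
    and "\<And>x y. x \<in> carrier A \<Longrightarrow> y \<in> carrier A \<Longrightarrow> x \<cdot> y \<ominus>\<^bsub>A\<^esub> y \<cdot> x \<in> W"
  shows "commutator_subspace F A \<subseteq> W"
  using assms unfolding commutator_subspace_span
  by (intro span_is_subset) (auto simp: commutators_def subspace_def)

lemma commutator_codim_1_iff:
  assumes "fin_dim"
  shows "commutator_codim F A = 1 \<longleftrightarrow>
    (\<exists>z\<in>carrier A. z \<notin> commutator_subspace F A \<and>
      (\<forall>a\<in>carrier A. \<exists>c\<in>carrier F. a \<ominus>\<^bsub>A\<^esub> c \<bullet> z \<in> commutator_subspace F A))"
  unfolding commutator_codim_def
  by (rule quotient_dim_1_iff[OF subspace_commutator_subspace assms])

end


section \<open>Traces from characters of a corner\<close>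

text \<open>A unital algebra homomorphism from \<open>e A e\<close> to \<open>F\<close>. Two
  instances occur: the residue modulo the nonunits when \<open>e\<close> is primitive, and the
  coefficient of \<open>e\<close> when the corner consists of scalars.\<close>

locale corner_character = unital_algebra +
  fixes e :: 'c and \<pi> :: "'c \<Rightarrow> 'a"
  assumes e: "idempotent e"
    and \<pi>_closed: "b \<in> corner e \<Longrightarrow> \<pi> b \<in> carrier F"
    and \<pi>_add: "\<lbrakk>b \<in> corner e; b' \<in> corner e\<rbrakk> \<Longrightarrow> \<pi> (b \<oplus>\<^bsub>A\<^esub> b') = \<pi> b \<oplus> \<pi> b'"
    and \<pi>_mult: "\<lbrakk>b \<in> corner e; b' \<in> corner e\<rbrakk> \<Longrightarrow> \<pi> (b \<cdot> b') = \<pi> b \<otimes> \<pi> b'"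
    and \<pi>_smult: "\<lbrakk>c \<in> carrier F; b \<in> corner e\<rbrakk> \<Longrightarrow> \<pi> (c \<bullet> b) = c \<otimes> \<pi> b"
    and \<pi>_one: "\<pi> e = \<one>"
begin

lemma e_carrier: "e \<in> carrier A" and e_idem: "e \<cdot> e = e"
  using e by (auto simp: idempotent_def)

lemma e_principal: "e \<in> principal_right e" "e \<in> principal_left e"
  using e_carrier e_idem by (auto simp: principal_right_def principal_left_def)

lemma \<pi>_zero: "\<pi> \<zero>\<^bsub>A\<^esub> = \<zero>"
  using \<pi>_smult[of \<zero> e] \<pi>_closed[of e] corner_self[OF e] e_carrier by simp

lemma \<pi>_minus:
  assumes "b \<in> corner e" "b' \<in> corner e"
  shows "\<pi> (b \<ominus>\<^bsub>A\<^esub> b') = \<pi> b \<ominus> \<pi> b'"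
proof -
  have d: "b \<ominus>\<^bsub>A\<^esub> b' \<in> corner e" using assms e_carrier by (simp add: corner_minus)
  have "b \<in> carrier A" "b' \<in> carrier A" using assms cornerD(1) by auto
  then have "(b \<ominus>\<^bsub>A\<^esub> b') \<oplus>\<^bsub>A\<^esub> b' = b" by (simp add: a_minus_def M.a_assoc M.l_neg)
  then have "\<pi> (b \<ominus>\<^bsub>A\<^esub> b') \<oplus> \<pi> b' = \<pi> b" using \<pi>_add[OF d assms(2)] by simp
  then show ?thesis using \<pi>_closed[OF d] \<pi>_closed[OF assms(1)] \<pi>_closed[OF assms(2)]
    by (metis R.add.inv_solve_right' R.minus_eq)
qed

text \<open>Membership and value are proved together, because \<open>\<pi>\<close> is additive on
  the corner and the induction has to know that partial sums stay there.\<close>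

lemma \<pi>_finsum:
  assumes "\<And>i. i \<in> I \<Longrightarrow> g i \<in> corner e" and "finite I"
  shows "(\<Oplus>\<^bsub>A\<^esub>i\<in>I. g i) \<in> corner e \<and> \<pi> (\<Oplus>\<^bsub>A\<^esub>i\<in>I. g i) = (\<Oplus>i\<in>I. \<pi> (g i))"
  using assms(2,1)
proof induction
  case empty
  then show ?case using \<pi>_zero e_carrier by (simp add: corner_def)
next
  case (insert i I)
  then have g: "g \<in> I \<rightarrow> carrier A" "g i \<in> carrier A" using cornerD(1) by auto
  have p: "(\<lambda>i. \<pi> (g i)) \<in> I \<rightarrow> carrier F" "\<pi> (g i) \<in> carrier F" using insert.prems \<pi>_closed by auto
  show ?case using insert g p e_carrier by (simp add: \<pi>_add corner_add)
qed

text \<open>Consider the pairing \<open>(u, v) \<mapsto> \<pi> (u v)\<close> on \<open>e A\<close>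
  and \<open>A e\<close>. The condition says that \<open>\<Sum> x_i y_i\<close> acts as the identity
  as far as this pairing can see, as it does for dual bases.\<close>

definition dual_system :: "nat \<Rightarrow> (nat \<Rightarrow> 'c) \<Rightarrow> (nat \<Rightarrow> 'c) \<Rightarrow> bool" where
  "dual_system n x y \<longleftrightarrow>
    (\<forall>i<n. x i \<in> principal_left e \<and> y i \<in> principal_right e) \<and>
    (\<forall>u\<in>principal_right e. \<forall>v\<in>principal_left e.
      \<pi> (u \<cdot> v) = (\<Oplus>i\<in>{..<n}. \<pi> (u \<cdot> x i) \<otimes> \<pi> (y i \<cdot> v)))"

context
  fixes n x y assumes dual: "dual_system n x y"
begin

lemma dual_mem: "i < n \<Longrightarrow> x i \<in> principal_left e" "i < n \<Longrightarrow> y i \<in> principal_right e"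
  using dual by (auto simp: dual_system_def)

lemma dual_carrier: "i < n \<Longrightarrow> x i \<in> carrier A" "i < n \<Longrightarrow> y i \<in> carrier A"
  using dual_mem principal_leftD(1) principal_rightD(1) by blast+

lemma dual_expand:
  assumes "u \<in> principal_right e" "v \<in> principal_left e"
  shows "\<pi> (u \<cdot> v) = (\<Oplus>i\<in>{..<n}. \<pi> (u \<cdot> x i) \<otimes> \<pi> (y i \<cdot> v))"
  using dual assms by (auto simp: dual_system_def)

text \<open>\<open>\<pi> (y_i a x_j)\<close> are matrix coefficients of the left action of
  \<open>a\<close> on \<open>A e\<close> modulo the kernel of the pairing, so this is the trace of
  that action.\<close>

definition ch_trace :: "'c \<Rightarrow> 'a" where
  "ch_trace a = (\<Oplus>i\<in>{..<n}. \<pi> (y i \<cdot> a \<cdot> x i))"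

lemma sandwich_corner: "i < n \<Longrightarrow> j < n \<Longrightarrow> a \<in> carrier A \<Longrightarrow> y i \<cdot> a \<cdot> x j \<in> corner e"
  using dual_mem e_carrier by (intro principal_sandwich_corner) auto

lemma ch_trace_closed: "a \<in> carrier A \<Longrightarrow> ch_trace a \<in> carrier F"
  unfolding ch_trace_def using sandwich_corner \<pi>_closed by (intro R.finsum_closed) auto

lemma ch_trace_add:
  assumes "a \<in> carrier A" "b \<in> carrier A"
  shows "ch_trace (a \<oplus>\<^bsub>A\<^esub> b) = ch_trace a \<oplus> ch_trace b"
proof -
  have "ch_trace (a \<oplus>\<^bsub>A\<^esub> b) =
      (\<Oplus>i\<in>{..<n}. \<pi> (y i \<cdot> a \<cdot> x i) \<oplus> \<pi> (y i \<cdot> b \<cdot> x i))"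
    unfolding ch_trace_def
  proof (intro R.finsum_cong' refl)
    fix i assume "i \<in> {..<n}"
    then have i: "i < n" by simp
    have "y i \<cdot> (a \<oplus>\<^bsub>A\<^esub> b) \<cdot> x i = y i \<cdot> a \<cdot> x i \<oplus>\<^bsub>A\<^esub> y i \<cdot> b \<cdot> x i"
      using dual_carrier[OF i] assms by (simp add: r_distr l_distr)
    then show "\<pi> (y i \<cdot> (a \<oplus>\<^bsub>A\<^esub> b) \<cdot> x i) =
        \<pi> (y i \<cdot> a \<cdot> x i) \<oplus> \<pi> (y i \<cdot> b \<cdot> x i)"
      using sandwich_corner i assms \<pi>_add by simp
  qed (use sandwich_corner \<pi>_closed assms in auto)
  also have "\<dots> = ch_trace a \<oplus> ch_trace b"
    unfolding ch_trace_def using sandwich_corner \<pi>_closed assms by (intro R.finsum_addf) auto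
  finally show ?thesis .
qed

lemma ch_trace_smult:
  assumes "c \<in> carrier F" "a \<in> carrier A"
  shows "ch_trace (c \<bullet> a) = c \<otimes> ch_trace a"
proof -
  have "ch_trace (c \<bullet> a) = (\<Oplus>i\<in>{..<n}. c \<otimes> \<pi> (y i \<cdot> a \<cdot> x i))"
    unfolding ch_trace_def
  proof (intro R.finsum_cong' refl)
    fix i assume "i \<in> {..<n}"
    then have i: "i < n" by simp
    have "y i \<cdot> (c \<bullet> a) \<cdot> x i = c \<bullet> (y i \<cdot> a \<cdot> x i)"
      using dual_carrier[OF i] assms by (simp add: smult_mult_left smult_mult_right)
    then show "\<pi> (y i \<cdot> (c \<bullet> a) \<cdot> x i) = c \<otimes> \<pi> (y i \<cdot> a \<cdot> x i)"
      using sandwich_corner i assms \<pi>_smult by simp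
  qed (use sandwich_corner \<pi>_closed assms in auto)
  also have "\<dots> = c \<otimes> ch_trace a"
    unfolding ch_trace_def using sandwich_corner \<pi>_closed assms by (subst R.finsum_rdistr) auto
  finally show ?thesis .
qed

text \<open>The dual expansion, inserted between \<open>a\<close> and \<open>b\<close>, is matrix
  multiplication.\<close>

lemma ch_trace_mult:
  assumes "a \<in> carrier A" "b \<in> carrier A"
  shows "ch_trace (a \<cdot> b) =
    (\<Oplus>i\<in>{..<n}. \<Oplus>j\<in>{..<n}. \<pi> (y i \<cdot> a \<cdot> x j) \<otimes> \<pi> (y j \<cdot> b \<cdot> x i))"
  unfolding ch_trace_def
proof (intro R.finsum_cong' refl)
  fix i assume "i \<in> {..<n}"
  then have i: "i < n" by simp
  note c = dual_carrier[OF i] assms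
  have "\<pi> (y i \<cdot> (a \<cdot> b) \<cdot> x i) = \<pi> ((y i \<cdot> a) \<cdot> (b \<cdot> x i))"
    using c by (simp add: m_assoc)
  also have "\<dots> = (\<Oplus>j\<in>{..<n}. \<pi> (y i \<cdot> a \<cdot> x j) \<otimes> \<pi> (y j \<cdot> (b \<cdot> x i)))"
    using dual_mem[OF i] assms e_carrier
    by (intro dual_expand principal_right_mult principal_left_mult)
  also have "\<dots> = (\<Oplus>j\<in>{..<n}. \<pi> (y i \<cdot> a \<cdot> x j) \<otimes> \<pi> (y j \<cdot> b \<cdot> x i))"
    using sandwich_corner \<pi>_closed assms i c dual_carrier
    by (intro R.finsum_cong' refl) (auto simp: m_assoc)
  finally show "\<pi> (y i \<cdot> (a \<cdot> b) \<cdot> x i) =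
    (\<Oplus>j\<in>{..<n}. \<pi> (y i \<cdot> a \<cdot> x j) \<otimes> \<pi> (y j \<cdot> b \<cdot> x i))" .
qed (use sandwich_corner \<pi>_closed assms in \<open>auto intro!: R.finsum_closed\<close>)

lemma ch_trace_commute:
  assumes "a \<in> carrier A" "b \<in> carrier A"
  shows "ch_trace (a \<cdot> b) = ch_trace (b \<cdot> a)"
proof -
  have "ch_trace (a \<cdot> b) =
    (\<Oplus>j\<in>{..<n}. \<Oplus>i\<in>{..<n}. \<pi> (y i \<cdot> a \<cdot> x j) \<otimes> \<pi> (y j \<cdot> b \<cdot> x i))"
    unfolding ch_trace_mult[OF assms] using sandwich_corner \<pi>_closed assms
    by (intro R.finsum_finsum_swap) auto
  also have "\<dots> = ch_trace (b \<cdot> a)"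
    unfolding ch_trace_mult[OF assms(2,1)] using sandwich_corner \<pi>_closed assms
    by (intro R.finsum_cong' refl) (auto simp: R.m_comm intro!: R.finsum_closed)
  finally show ?thesis .
qed

text \<open>\<open>e\<close> acts with rank one: \<open>\<pi> (y_i e x_i)\<close> factors through
  \<open>e\<close>, and after swapping the two scalars the sum is the dual expansion of
  \<open>\<pi> (e e) = 1\<close>.\<close>

lemma ch_trace_idempotent: "ch_trace e = \<one>"
proof -
  have "ch_trace e = (\<Oplus>i\<in>{..<n}. \<pi> (e \<cdot> x i) \<otimes> \<pi> (y i \<cdot> e))"
    unfolding ch_trace_def
  proof (intro R.finsum_cong' refl)
    fix i assume "i \<in> {..<n}"
    then have i: "i < n" by simp
    have c: "e \<cdot> x i \<in> corner e" "y i \<cdot> e \<in> corner e"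
      using dual_mem[OF i] e_principal e_carrier by (auto intro: principal_mult_corner)
    have "y i \<cdot> e \<cdot> x i = (y i \<cdot> e) \<cdot> (e \<cdot> x i)"
      using dual_carrier[OF i] e_carrier e_idem by (metis m_assoc m_closed)
    then have "\<pi> (y i \<cdot> e \<cdot> x i) = \<pi> (y i \<cdot> e) \<otimes> \<pi> (e \<cdot> x i)"
      using c by (simp add: \<pi>_mult)
    then show "\<pi> (y i \<cdot> e \<cdot> x i) = \<pi> (e \<cdot> x i) \<otimes> \<pi> (y i \<cdot> e)"
      using c \<pi>_closed by (simp add: R.m_comm)
  next
    show "(\<lambda>i. \<pi> (e \<cdot> x i) \<otimes> \<pi> (y i \<cdot> e)) \<in> {..<n} \<rightarrow> carrier F"
      using dual_mem e_principal e_carrier by (auto intro!: \<pi>_closed principal_mult_corner)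
  qed
  also have "\<dots> = \<one>"
    using dual_expand[OF e_principal] e_idem \<pi>_one by simp
  finally show ?thesis .
qed

lemma ch_trace_minus:
  assumes "a \<in> carrier A" "b \<in> carrier A"
  shows "ch_trace (a \<ominus>\<^bsub>A\<^esub> b) = ch_trace a \<ominus> ch_trace b"
proof -
  have "(a \<ominus>\<^bsub>A\<^esub> b) \<oplus>\<^bsub>A\<^esub> b = a" using assms by (simp add: a_minus_def M.a_assoc M.l_neg)
  then have "ch_trace (a \<ominus>\<^bsub>A\<^esub> b) \<oplus> ch_trace b = ch_trace a"
    using ch_trace_add[of "a \<ominus>\<^bsub>A\<^esub> b" b] assms by simp
  then show ?thesis using ch_trace_closed assms
    by (metis R.add.inv_solve_right' R.minus_eq M.minus_closed)
qed

lemma ch_trace_commutator_subspace: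
  assumes "a \<in> commutator_subspace F A"
  shows "ch_trace a = \<zero>"
proof -
  have "subspace F {a \<in> carrier A. ch_trace a = \<zero>} A"
    using ch_trace_smult[of \<zero> "\<zero>\<^bsub>A\<^esub>"] ch_trace_closed
    by (intro subspaceI) (auto simp: ch_trace_add ch_trace_smult)
  then have "commutator_subspace F A \<subseteq> {a \<in> carrier A. ch_trace a = \<zero>}"
    by (rule commutator_subspace_least)
      (auto simp: ch_trace_minus ch_trace_commute ch_trace_closed R.minus_eq R.r_neg)
  then show ?thesis using assms by blast
qed

lemma idempotent_not_commutator: "e \<notin> commutator_subspace F A"
  using ch_trace_commutator_subspace ch_trace_idempotent by auto

text \<open>The first hypothesis bounds the codimension of \<open>K(A)\<close> by one. As
  \<open>K(A)\<close> lies in the kernel of the trace and the trace is \<open>1\<close> at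
  \<open>e\<close>, the kernel cannot be larger than \<open>K(A)\<close>.\<close>

lemma ch_trace_zero_commutator:
  assumes "\<forall>a\<in>carrier A. \<exists>c\<in>carrier F. a \<ominus>\<^bsub>A\<^esub> c \<bullet> z \<in> commutator_subspace F A"
    and z: "z \<in> carrier A" and a: "a \<in> carrier A" "ch_trace a = \<zero>"
  shows "a \<in> commutator_subspace F A"
proof -
  obtain c where c: "c \<in> carrier F" "a \<ominus>\<^bsub>A\<^esub> c \<bullet> z \<in> commutator_subspace F A" using assms by blast
  obtain d where d: "d \<in> carrier F" "e \<ominus>\<^bsub>A\<^esub> d \<bullet> z \<in> commutator_subspace F A"
    using assms(1) e_carrier by blast
  have tz: "ch_trace z \<in> carrier F" using ch_trace_closed z by simp
  have "\<one> \<ominus> d \<otimes> ch_trace z = \<zero>" using ch_trace_commutator_subspace[OF d(2)]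
    z d e_carrier by (simp add: ch_trace_minus ch_trace_smult ch_trace_idempotent)
  then have "ch_trace z \<noteq> \<zero>" using d(1) by (auto simp: a_minus_def)
  moreover have "\<zero> \<ominus> c \<otimes> ch_trace z = \<zero>" using ch_trace_commutator_subspace[OF c(2)]
    z c a by (simp add: ch_trace_minus ch_trace_smult)
  then have "c \<otimes> ch_trace z = \<zero>" using c(1) tz by (simp add: a_minus_def)
  ultimately have "c = \<zero>" using c(1) tz field.integral by blast
  then show ?thesis using c(2) z a by (simp add: a_minus_def M.minus_equality[of "\<zero>\<^bsub>A\<^esub>" "\<zero>\<^bsub>A\<^esub>"])
qed

end

end

section \<open>Residues of a corner modulo an ideal\<close>

lemma (in vectorspace) subspace_finsum:
  assumes "subspace K W V" and "finite I" and "\<And>i. i \<in> I \<Longrightarrow> g i \<in> W"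
  shows "(\<Oplus>\<^bsub>V\<^esub>i\<in>I. g i) \<in> W"
  using assms(2,3)
proof induction
  case empty
  then show ?case using subspaceD(2)[OF assms(1)] by simp
next
  case (insert i I)
  then have "g \<in> I \<rightarrow> carrier V" "g i \<in> carrier V" using subspaceD(1)[OF assms(1)] by auto
  then show ?case using insert subspaceD(3)[OF assms(1)] by simp
qed

context ring
begin

lemma add_minus_interchange:
  assumes "p \<in> carrier R" "q \<in> carrier R" "s \<in> carrier R" "t \<in> carrier R"
  shows "(p \<oplus> q) \<ominus> (s \<oplus> t) = (p \<ominus> s) \<oplus> (q \<ominus> t)"
  using assms by algebra

lemma minus_zero_imp_eq:
  assumes "a \<in> carrier R" "b \<in> carrier R" "a \<ominus> b = \<zero>"
  shows "a = b"
proof -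
  have "a = (a \<ominus> b) \<oplus> b" using assms(1,2) by algebra
  then show ?thesis using assms by simp
qed

lemma minus_add_swap:
  assumes "p \<in> carrier R" "s \<in> carrier R" "t \<in> carrier R"
  shows "p \<ominus> (t \<oplus> s) = (p \<ominus> s) \<ominus> t"
  using assms by algebra

end

context unital_algebra
begin

lemma subspace_principal_left:
  assumes "e \<in> carrier A"
  shows "subspace F (principal_left e) A"
  using assms by (intro subspaceI) (auto simp: principal_left_def l_distr smult_mult_left)

lemma subspace_principal_right:
  assumes "e \<in> carrier A"
  shows "subspace F (principal_right e) A"
  using assms by (intro subspaceI) (auto simp: principal_right_def r_distr smult_mult_right)

context
  fixes e N
  assumes e: "idempotent e" and N: "subspace F N A" "N \<subseteq> corner e" "e \<notin> N"
    and N_left: "\<And>b n. b \<in> corner e \<Longrightarrow> n \<in> N \<Longrightarrow> b \<cdot> n \<in> N"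
    and N_right: "\<And>b n. b \<in> corner e \<Longrightarrow> n \<in> N \<Longrightarrow> n \<cdot> b \<in> N"
    and scalar: "\<And>b. b \<in> corner e \<Longrightarrow> \<exists>c\<in>carrier F. b \<ominus>\<^bsub>A\<^esub> c \<bullet> e \<in> N"
begin

definition residue :: "'c \<Rightarrow> 'a" where
  "residue b = (THE c. c \<in> carrier F \<and> b \<ominus>\<^bsub>A\<^esub> c \<bullet> e \<in> N)"

text \<open>If two residues differed by \<open>k \<noteq> 0\<close>, then
  \<open>k e \<in> N\<close>, and division by \<open>k\<close> would put \<open>e\<close> into
  \<open>N\<close>.\<close>

lemma residue_unique:
  assumes b: "b \<in> corner e" and c: "c \<in> carrier F" "b \<ominus>\<^bsub>A\<^esub> c \<bullet> e \<in> N"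
    and d: "d \<in> carrier F" "b \<ominus>\<^bsub>A\<^esub> d \<bullet> e \<in> N"
  shows "c = d"
proof (rule ccontr)
  assume "c \<noteq> d"
  have ec: "e \<in> carrier A" "b \<in> carrier A" using e b idempotent_carrier cornerD(1) by auto
  define k where "k = c \<ominus> d"
  have k: "k \<in> carrier F" "k \<noteq> \<zero>" using \<open>c \<noteq> d\<close> c d by (simp_all add: k_def)
  have "(b \<ominus>\<^bsub>A\<^esub> d \<bullet> e) \<ominus>\<^bsub>A\<^esub> (b \<ominus>\<^bsub>A\<^esub> c \<bullet> e) \<in> N"
    using subspace_minus[OF N(1) d(2) c(2)] .
  moreover have "(b \<ominus>\<^bsub>A\<^esub> d \<bullet> e) \<ominus>\<^bsub>A\<^esub> (b \<ominus>\<^bsub>A\<^esub> c \<bullet> e) = c \<bullet> e \<ominus>\<^bsub>A\<^esub> d \<bullet> e"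
  proof -
    have "c \<bullet> e \<in> carrier A" "d \<bullet> e \<in> carrier A" using c d ec by auto
    then show ?thesis using ec(2) by algebra
  qed
  moreover have "c \<bullet> e \<ominus>\<^bsub>A\<^esub> d \<bullet> e = k \<bullet> e"
    using c d ec by (simp add: k_def a_minus_def smult_l_distr smult_l_minus)
  ultimately have "k \<bullet> e \<in> N" by simp
  then have "inv k \<bullet> (k \<bullet> e) \<in> N"
    using k by (intro subspaceD(4)[OF N(1), of "inv k"]) (auto simp: field_Units)
  then show False using N(3) k ec by (simp add: field_Units flip: smult_assoc1)
qed

lemma residue:
  assumes b: "b \<in> corner e"
  shows "residue b \<in> carrier F" "b \<ominus>\<^bsub>A\<^esub> residue b \<bullet> e \<in> N"
proof -
  have "\<exists>!c. c \<in> carrier F \<and> b \<ominus>\<^bsub>A\<^esub> c \<bullet> e \<in> N"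
    using scalar[OF b] residue_unique[OF b] by blast
  from theI'[OF this] show "residue b \<in> carrier F" "b \<ominus>\<^bsub>A\<^esub> residue b \<bullet> e \<in> N"
    by (auto simp: residue_def)
qed

lemma residue_eqI:
  assumes "b \<in> corner e" "c \<in> carrier F" "b \<ominus>\<^bsub>A\<^esub> c \<bullet> e \<in> N"
  shows "residue b = c"
  using residue_unique[OF assms(1) residue[OF assms(1)] assms(2,3)] .

lemma residue_zero: "n \<in> N \<Longrightarrow> residue n = \<zero>"
  using N e idempotent_carrier cornerD(1)
  by (intro residue_eqI) (auto simp: a_minus_def M.minus_equality[of "\<zero>\<^bsub>A\<^esub>" "\<zero>\<^bsub>A\<^esub>"])

text \<open>With residues \<open>\<rho>\<close>, \<open>\<rho>'\<close> of \<open>b\<close>,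
  \<open>b'\<close>, multiplicativity follows from \<open>b b' - \<rho> \<rho>' e = (b - \<rho> e)
  b' + \<rho> (b' - \<rho>' e)\<close>, where both summands lie in the ideal
  \<open>N\<close>.\<close>

lemma corner_character_residue: "corner_character F A e residue"
proof unfold_locales
  have ec: "e \<in> carrier A" using e idempotent_carrier by auto
  fix b assume b: "b \<in> corner e"
  note r = residue[OF b]
  have bc: "b \<in> carrier A" using b cornerD(1) by auto
  show "residue b \<in> carrier F" by (rule r)
  {
    fix c assume c: "c \<in> carrier F"
    have "c \<bullet> b \<ominus>\<^bsub>A\<^esub> (c \<otimes> residue b) \<bullet> e = c \<bullet> (b \<ominus>\<^bsub>A\<^esub> residue b \<bullet> e)"
      using r bc ec c by (simp add: a_minus_def smult_r_distr smult_r_minus smult_assoc1)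
    then show "residue (c \<bullet> b) = c \<otimes> residue b"
      using subspaceD(4)[OF N(1) c r(2)] r(1) c b ec
        by (intro residue_eqI) (auto simp: corner_smult)
  }
  fix b' assume b': "b' \<in> corner e"
  note r' = residue[OF b']
  have bc': "b' \<in> carrier A" using b' cornerD(1) by auto
  have re: "residue b \<bullet> e \<in> carrier A" "residue b' \<bullet> e \<in> carrier A" using r r' ec by auto
  have "(b \<oplus>\<^bsub>A\<^esub> b') \<ominus>\<^bsub>A\<^esub> (residue b \<oplus> residue b') \<bullet> e =
      (b \<ominus>\<^bsub>A\<^esub> residue b \<bullet> e) \<oplus>\<^bsub>A\<^esub> (b' \<ominus>\<^bsub>A\<^esub> residue b' \<bullet> e)"
    using r(1) r'(1) ec bc bc' re by (simp add: smult_l_distr add_minus_interchange)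
  then show "residue (b \<oplus>\<^bsub>A\<^esub> b') = residue b \<oplus> residue b'"
    using subspaceD(3)[OF N(1) r(2) r'(2)] r(1) r'(1) corner_add[OF ec b b']
    by (intro residue_eqI) auto
  have "(b \<ominus>\<^bsub>A\<^esub> residue b \<bullet> e) \<cdot> b' = b \<cdot> b' \<ominus>\<^bsub>A\<^esub> residue b \<bullet> b'"
    using r(1) ec bc bc' re cornerD(2)[OF b']
    by (simp add: a_minus_def l_distr l_minus smult_mult_left)
  moreover have "residue b \<bullet> (b' \<ominus>\<^bsub>A\<^esub> residue b' \<bullet> e) =
      residue b \<bullet> b' \<ominus>\<^bsub>A\<^esub> (residue b \<otimes> residue b') \<bullet> e"
    using r(1) r'(1) ec bc' re by (simp add: a_minus_def smult_r_distr smult_r_minus smult_assoc1)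
  moreover have "(p \<ominus>\<^bsub>A\<^esub> q) \<oplus>\<^bsub>A\<^esub> (q \<ominus>\<^bsub>A\<^esub> s) = p \<ominus>\<^bsub>A\<^esub> s"
    if "p \<in> carrier A" "q \<in> carrier A" "s \<in> carrier A" for p q s
    using that by algebra
  ultimately have "b \<cdot> b' \<ominus>\<^bsub>A\<^esub> (residue b \<otimes> residue b') \<bullet> e =
      (b \<ominus>\<^bsub>A\<^esub> residue b \<bullet> e) \<cdot> b' \<oplus>\<^bsub>A\<^esub>
      residue b \<bullet> (b' \<ominus>\<^bsub>A\<^esub> residue b' \<bullet> e)"
    using r(1) r'(1) ec bc bc' by simp
  then show "residue (b \<cdot> b') = residue b \<otimes> residue b'"
    using subspaceD(3)[OF N(1) N_right[OF b' r(2)] subspaceD(4)[OF N(1) r(1) r'(2)]]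
      r(1) r'(1) corner_mult[OF ec b b'] by (intro residue_eqI) auto
next
  have ec: "e \<in> carrier A" using e idempotent_carrier by auto
  show "residue e = \<one>"
    using subspaceD(2)[OF N(1)] ec corner_self[OF e]
    by (intro residue_eqI) (auto simp: a_minus_def M.r_neg)
qed (rule e)

end

end

context corner_character
begin

text \<open>The image of \<open>v \<mapsto> v - \<Sum> \<pi>(y\<^sub>i v) x\<^sub>i\<close> shrinks strictly when a suitable pair is
  appended to a system that is not dual.\<close>

lemma dual_system_exists:
  assumes fin_dim
  shows "\<exists>n x y. dual_system n x y"
proof -
  define pairs where "pairs n x y \<longleftrightarrow>
    (\<forall>i<n. x i \<in> principal_left e \<and> y i \<in> principal_right e)"
    for n :: nat and x y :: "nat \<Rightarrow> 'c"
  \<comment> \<open>The error of the expansion in the given pairs; the system is dual exactly when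
    \<open>\<pi> (u E v)\<close> vanishes for all \<open>u\<close> and \<open>v\<close>.\<close>
  define E where "E n x y v = v \<ominus>\<^bsub>A\<^esub> (\<Oplus>\<^bsub>A\<^esub>i\<in>{..<n}. \<pi> (y i \<cdot> v) \<bullet> x i)"
    for n :: nat and x y :: "nat \<Rightarrow> 'c" and v
  define W where "W n x y = E n x y ` principal_left e" for n :: nat and x y :: "nat \<Rightarrow> 'c"
  note L = subspace_principal_left[OF e_carrier] and R = subspace_principal_right[OF e_carrier]
  have prod: "\<pi> (u \<cdot> v) \<in> carrier F" "u \<cdot> v \<in> corner e" "u \<in> carrier A" "v \<in> carrier A"
    if "u \<in> principal_right e" "v \<in> principal_left e" for u v
    using that e_carrier principal_mult_corner \<pi>_closed principal_rightD(1)
      principal_leftD(1) by auto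
  have term_mem: "\<pi> (y i \<cdot> v) \<bullet> x i \<in> principal_left e"
    if "pairs n x y" "i < n" "v \<in> principal_left e" for n x y i v
    using that prod subspaceD(4)[OF L] by (auto simp: pairs_def)
  have sum_mem: "(\<Oplus>\<^bsub>A\<^esub>i\<in>{..<n}. \<pi> (y i \<cdot> v) \<bullet> x i) \<in> principal_left e"
    if "pairs n x y" "v \<in> principal_left e" for n x y v
    using that term_mem by (intro subspace_finsum[OF L]) auto
  have E_mem: "E n x y v \<in> principal_left e"
    if "pairs n x y" "v \<in> principal_left e" for n x y v
    unfolding E_def using that sum_mem subspace_minus[OF L] by blast
  have E_add: "E n x y (v \<oplus>\<^bsub>A\<^esub> w) = E n x y v \<oplus>\<^bsub>A\<^esub> E n x y w"
    if p: "pairs n x y" and v: "v \<in> principal_left e" and w: "w \<in> principal_left e" for n x y v w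
  proof -
    let ?s = "\<lambda>v. \<Oplus>\<^bsub>A\<^esub>i\<in>{..<n}. \<pi> (y i \<cdot> v) \<bullet> x i"
    have "?s (v \<oplus>\<^bsub>A\<^esub> w) = (\<Oplus>\<^bsub>A\<^esub>i\<in>{..<n}. \<pi> (y i \<cdot> v) \<bullet> x i \<oplus>\<^bsub>A\<^esub> \<pi> (y i \<cdot> w) \<bullet> x i)"
    proof (intro M.finsum_cong' refl)
      fix i assume "i \<in> {..<n}"
      then have xy: "y i \<in> principal_right e" "x i \<in> principal_left e"
        using p by (auto simp: pairs_def)
      then show "\<pi> (y i \<cdot> (v \<oplus>\<^bsub>A\<^esub> w)) \<bullet> x i =
          \<pi> (y i \<cdot> v) \<bullet> x i \<oplus>\<^bsub>A\<^esub> \<pi> (y i \<cdot> w) \<bullet> x i"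
        using prod[OF xy(1) v] prod[OF xy(1) w] principal_leftD(1)[OF xy(2)]
        by (simp add: r_distr \<pi>_add smult_l_distr)
    qed (use term_mem[OF p] v w principal_leftD(1) in blast)
    also have "\<dots> = ?s v \<oplus>\<^bsub>A\<^esub> ?s w"
      using term_mem[OF p] v w principal_leftD(1) by (intro M.finsum_addf) blast+
    finally have s: "?s (v \<oplus>\<^bsub>A\<^esub> w) = ?s v \<oplus>\<^bsub>A\<^esub> ?s w" .
    have "?s v \<in> carrier A" "?s w \<in> carrier A" "v \<in> carrier A" "w \<in> carrier A"
      using sum_mem[OF p] v w principal_leftD(1) by blast+
    then show ?thesis unfolding E_def s by (simp add: add_minus_interchange)
  qed
  have E_smult: "E n x y (c \<bullet> v) = c \<bullet> E n x y v"
    if p: "pairs n x y" and v: "v \<in> principal_left e" and c: "c \<in> carrier F" for n x y v c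
  proof -
    let ?s = "\<lambda>v. \<Oplus>\<^bsub>A\<^esub>i\<in>{..<n}. \<pi> (y i \<cdot> v) \<bullet> x i"
    have "?s (c \<bullet> v) = (\<Oplus>\<^bsub>A\<^esub>i\<in>{..<n}. c \<bullet> (\<pi> (y i \<cdot> v) \<bullet> x i))"
    proof (intro M.finsum_cong' refl)
      fix i assume "i \<in> {..<n}"
      then have xy: "y i \<in> principal_right e" "x i \<in> principal_left e"
        using p by (auto simp: pairs_def)
      then show "\<pi> (y i \<cdot> (c \<bullet> v)) \<bullet> x i = c \<bullet> (\<pi> (y i \<cdot> v) \<bullet> x i)"
        using prod[OF xy(1) v] principal_leftD(1)[OF xy(2)] c
        by (simp add: smult_mult_right \<pi>_smult smult_assoc1)
    qed (use term_mem[OF p] v c principal_leftD(1) in blast)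
    also have "\<dots> = c \<bullet> ?s v"
      using term_mem[OF p] v c principal_leftD(1)
      by (intro finsum_additive_map[symmetric] M.abelian_monoid_axioms) (auto simp: smult_r_distr)
    finally have s: "?s (c \<bullet> v) = c \<bullet> ?s v" .
    have "?s v \<in> carrier A" "v \<in> carrier A"
      using sum_mem[OF p] v principal_leftD(1) by blast+
    then show ?thesis unfolding E_def s
      using c by (simp add: a_minus_def smult_r_distr smult_r_minus)
  qed
  have W_sub: "subspace F (W n x y) A" if p: "pairs n x y" for n x y
  proof (rule subspaceI)
    show "W n x y \<subseteq> carrier A" unfolding W_def using E_mem[OF p] principal_leftD(1) by blast
    have "E n x y (\<zero> \<bullet> \<zero>\<^bsub>A\<^esub>) = \<zero> \<bullet> E n x y \<zero>\<^bsub>A\<^esub>" using E_smult[OF p] subspaceD(2)[OF L] by blast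
    then have "E n x y \<zero>\<^bsub>A\<^esub> = \<zero>\<^bsub>A\<^esub>"
      using E_mem[OF p subspaceD(2)[OF L]] principal_leftD(1) by simp
    then show "\<zero>\<^bsub>A\<^esub> \<in> W n x y" unfolding W_def using subspaceD(2)[OF L] by (metis image_eqI)
    fix v w assume "v \<in> W n x y" "w \<in> W n x y"
    then show "v \<oplus>\<^bsub>A\<^esub> w \<in> W n x y" unfolding W_def
      using E_add[OF p] subspaceD(3)[OF L] by (auto simp flip: E_add[OF p])
  next
    fix c v assume "c \<in> carrier F" "v \<in> W n x y"
    then show "c \<bullet> v \<in> W n x y" unfolding W_def
      using subspaceD(4)[OF L] by (auto simp flip: E_smult[OF p])
  qed
  have \<pi>_E: "\<pi> (u \<cdot> E n x y v) = \<pi> (u \<cdot> v) \<ominus> (\<Oplus>i\<in>{..<n}. \<pi> (u \<cdot> x i) \<otimes> \<pi> (y i \<cdot> v))"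
    if p: "pairs n x y" and u: "u \<in> principal_right e" and v: "v \<in> principal_left e" for n x y u v
  proof -
    let ?s = "\<Oplus>\<^bsub>A\<^esub>i\<in>{..<n}. \<pi> (y i \<cdot> v) \<bullet> x i"
    have tc: "\<pi> (y i \<cdot> v) \<bullet> x i \<in> carrier A" if "i < n" for i
      using term_mem[OF p that v] principal_leftD(1) by blast
    have xi: "x i \<in> principal_left e" "y i \<in> principal_right e" if "i < n" for i
      using that p by (auto simp: pairs_def)
    have "u \<cdot> ?s = (\<Oplus>\<^bsub>A\<^esub>i\<in>{..<n}. u \<cdot> (\<pi> (y i \<cdot> v) \<bullet> x i))"
      using tc prod[OF u v] by (intro finsum_rdistr) auto
    also have "\<pi> \<dots> = (\<Oplus>i\<in>{..<n}. \<pi> (u \<cdot> (\<pi> (y i \<cdot> v) \<bullet> x i)))"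
      using term_mem[OF p _ v] u by (intro \<pi>_finsum[THEN conjunct2] prod(2)) auto
    also have "\<dots> = (\<Oplus>i\<in>{..<n}. \<pi> (u \<cdot> x i) \<otimes> \<pi> (y i \<cdot> v))"
    proof (intro R.finsum_cong' refl)
      fix i assume "i \<in> {..<n}"
      then have i: "i < n" by simp
      show "\<pi> (u \<cdot> (\<pi> (y i \<cdot> v) \<bullet> x i)) = \<pi> (u \<cdot> x i) \<otimes> \<pi> (y i \<cdot> v)"
        using prod[OF u xi(1)[OF i]] prod[OF xi(2)[OF i] v]
        by (simp add: smult_mult_right \<pi>_smult R.m_comm)
    qed (use prod u v xi in auto)
    finally have s: "\<pi> (u \<cdot> ?s) = (\<Oplus>i\<in>{..<n}. \<pi> (u \<cdot> x i) \<otimes> \<pi> (y i \<cdot> v))" .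
    have sm: "?s \<in> principal_left e" by (rule sum_mem[OF p v])
    have "u \<cdot> E n x y v = u \<cdot> v \<ominus>\<^bsub>A\<^esub> u \<cdot> ?s"
      unfolding E_def using prod[OF u v] principal_leftD(1)[OF sm]
      by (simp add: a_minus_def r_distr r_minus)
    then show ?thesis using \<pi>_minus prod[OF u v] prod[OF u sm] s by simp
  qed
  define S where "S = {W n x y | n x y. pairs n x y}"
  have "pairs 0 (\<lambda>_. e) (\<lambda>_. e)" by (simp add: pairs_def)
  then have S_ne: "W 0 (\<lambda>_. e) (\<lambda>_. e) \<in> S" unfolding S_def by blast
  have S_sub: "subspace F W' A" if "W' \<in> S" for W' using that W_sub unfolding S_def by blast
  then obtain W0 where W0: "W0 \<in> S" "\<forall>W'\<in>S. W' \<subseteq> W0 \<longrightarrow> W' = W0"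
    using minimal_subspace_exists[OF assms S_ne S_sub] by blast
  then obtain n x y where p: "pairs n x y" and W0_eq: "W0 = W n x y" unfolding S_def by blast
  have min: "W m x' y' = W n x y" if "pairs m x' y'" "W m x' y' \<subseteq> W n x y" for m x' y'
    using W0(2) that W0_eq unfolding S_def by blast
  have "\<pi> (u \<cdot> E n x y v) = \<zero>"
    if u: "u \<in> principal_right e" and v: "v \<in> principal_left e" for u v
  proof (rule ccontr)
    let ?c = "\<pi> (u \<cdot> E n x y v)"
    assume c: "?c \<noteq> \<zero>"
    note Ev = E_mem[OF p v]
    have cF: "?c \<in> carrier F" "inv ?c \<in> carrier F" using c prod[OF u Ev] by (auto simp: field_Units)
    \<comment> \<open>A vector of the image, scaled so that \<open>\<pi> (u w) = 1\<close>; it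
      becomes the new entry of \<open>x\<close>.\<close>
    define w where "w = inv ?c \<bullet> E n x y v"
    have wW: "w \<in> W n x y" unfolding w_def
      using subspaceD(4)[OF W_sub[OF p] cF(2)] v by (auto simp: W_def)
    have wL: "w \<in> principal_left e" unfolding w_def using subspaceD(4)[OF L cF(2) Ev] .
    have "\<pi> (u \<cdot> w) = inv ?c \<otimes> ?c"
      unfolding w_def using prod[OF u Ev] cF by (simp add: smult_mult_right \<pi>_smult)
    then have uw: "\<pi> (u \<cdot> w) = \<one>" using c cF by (simp add: field_Units)
    have xi: "x i \<in> principal_left e" "y i \<in> principal_right e" if "i < n" for i
      using that p by (auto simp: pairs_def)
    \<comment> \<open>Chosen so that \<open>y' = u - r\<close> represents the functional
      \<open>v \<mapsto> \<pi> (u E v)\<close>. Appending \<open>w\<close> and \<open>y'\<close>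
      then replaces \<open>E v\<close> by \<open>E v - \<pi> (u E v) w\<close>.\<close>
    define r where "r = (\<Oplus>\<^bsub>A\<^esub>i\<in>{..<n}. \<pi> (u \<cdot> x i) \<bullet> y i)"
    have r_term: "\<pi> (u \<cdot> x i) \<bullet> y i \<in> principal_right e" if "i < n" for i
      using prod[OF u] xi[OF that] subspaceD(4)[OF R] by blast
    have rR: "r \<in> principal_right e" unfolding r_def
      using r_term by (intro subspace_finsum[OF R]) auto
    define y' where "y' = u \<ominus>\<^bsub>A\<^esub> r"
    have y'R: "y' \<in> principal_right e" unfolding y'_def using subspace_minus[OF R u rR] .
    have y': "\<pi> (y' \<cdot> v) = \<pi> (u \<cdot> E n x y v)" if v: "v \<in> principal_left e" for v
    proof -
      have "r \<cdot> v = (\<Oplus>\<^bsub>A\<^esub>i\<in>{..<n}. (\<pi> (u \<cdot> x i) \<bullet> y i) \<cdot> v)"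
        unfolding r_def using r_term principal_rightD(1) prod(4)[OF u v]
        by (intro finsum_ldistr) auto
      also have "\<pi> \<dots> = (\<Oplus>i\<in>{..<n}. \<pi> ((\<pi> (u \<cdot> x i) \<bullet> y i) \<cdot> v))"
        using r_term v by (intro \<pi>_finsum[THEN conjunct2] prod(2)) auto
      also have "\<dots> = (\<Oplus>i\<in>{..<n}. \<pi> (u \<cdot> x i) \<otimes> \<pi> (y i \<cdot> v))"
      proof (intro R.finsum_cong' refl)
        fix i assume "i \<in> {..<n}"
        then have i: "i < n" by simp
        show "\<pi> ((\<pi> (u \<cdot> x i) \<bullet> y i) \<cdot> v) = \<pi> (u \<cdot> x i) \<otimes> \<pi> (y i \<cdot> v)"
          using prod[OF u xi(1)[OF i]] prod[OF xi(2)[OF i] v]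
          by (simp add: smult_mult_left \<pi>_smult)
      qed (use prod u v xi in auto)
      finally have "\<pi> (r \<cdot> v) = (\<Oplus>i\<in>{..<n}. \<pi> (u \<cdot> x i) \<otimes> \<pi> (y i \<cdot> v))" .
      moreover have "y' \<cdot> v = u \<cdot> v \<ominus>\<^bsub>A\<^esub> r \<cdot> v"
        unfolding y'_def using prod[OF u v] prod[OF rR v] by (simp add: a_minus_def l_distr l_minus)
      ultimately show ?thesis using \<pi>_E[OF p u v] \<pi>_minus prod[OF u v] prod[OF rR v] by simp
    qed
    have p': "pairs (Suc n) (x(n := w)) (y(n := y'))"
      using p wL y'R by (auto simp: pairs_def less_Suc_eq)
    have E': "E (Suc n) (x(n := w)) (y(n := y')) v = E n x y v \<ominus>\<^bsub>A\<^esub> \<pi> (u \<cdot> E n x y v) \<bullet> w"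
      if v: "v \<in> principal_left e" for v
    proof -
      let ?s = "\<Oplus>\<^bsub>A\<^esub>i\<in>{..<n}. \<pi> (y i \<cdot> v) \<bullet> x i" and ?t = "\<pi> (y' \<cdot> v) \<bullet> w"
      have "(\<Oplus>\<^bsub>A\<^esub>i\<in>{..<Suc n}. \<pi> ((y(n := y')) i \<cdot> v) \<bullet> (x(n := w)) i) = ?t \<oplus>\<^bsub>A\<^esub>
          (\<Oplus>\<^bsub>A\<^esub>i\<in>{..<n}. \<pi> ((y(n := y')) i \<cdot> v) \<bullet> (x(n := w)) i)"
        using term_mem[OF p' _ v] principal_leftD(1) by (subst M.finsum_lessThan_Suc) auto
      also have "(\<Oplus>\<^bsub>A\<^esub>i\<in>{..<n}. \<pi> ((y(n := y')) i \<cdot> v) \<bullet> (x(n := w)) i) = ?s"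
        using term_mem[OF p _ v] principal_leftD(1) by (intro M.finsum_cong') auto
      finally have "E (Suc n) (x(n := w)) (y(n := y')) v = v \<ominus>\<^bsub>A\<^esub> (?t \<oplus>\<^bsub>A\<^esub> ?s)" unfolding E_def
        by simp
      moreover have "?s \<in> carrier A" "?t \<in> carrier A" "v \<in> carrier A"
        using sum_mem[OF p v] prod[OF y'R v] wL principal_leftD(1) by auto
      ultimately have "E (Suc n) (x(n := w)) (y(n := y')) v = (v \<ominus>\<^bsub>A\<^esub> ?s) \<ominus>\<^bsub>A\<^esub> ?t"
        by (simp add: minus_add_swap)
      then show ?thesis unfolding E_def[of n x y] using y'[OF v] by (simp add: E_def)
    qed
    have "W (Suc n) (x(n := w)) (y(n := y')) \<subseteq> W n x y"
    proof
      fix a assume "a \<in> W (Suc n) (x(n := w)) (y(n := y'))"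
      then obtain v where v: "v \<in> principal_left e"
        and a: "a = E (Suc n) (x(n := w)) (y(n := y')) v"
        by (auto simp: W_def)
      have "E n x y v \<in> W n x y" using v by (auto simp: W_def)
      then show "a \<in> W n x y" unfolding a E'[OF v]
        using subspace_minus[OF W_sub[OF p]] subspaceD(4)[OF W_sub[OF p] prod(1)[OF u E_mem[OF p v]] wW] by blast
    qed
    \<comment> \<open>By minimality \<open>w\<close> still lies in the new image. But
      \<open>\<pi> (u _)\<close> vanishes on that image, since \<open>\<pi> (u w) = 1\<close>;
      applied to \<open>w\<close> itself this gives \<open>1 = 0\<close>.\<close>
    from min[OF p' this] wW obtain v' where v': "v' \<in> principal_left e"
      and w_eq: "w = E (Suc n) (x(n := w)) (y(n := y')) v'" by (auto simp: W_def)
    note Ev' = E_mem[OF p v']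
    let ?d = "\<pi> (u \<cdot> E n x y v')"
    have dF: "?d \<in> carrier F" using prod[OF u Ev'] by simp
    have dw: "?d \<bullet> w \<in> principal_left e" using subspaceD(4)[OF L dF wL] .
    have "u \<cdot> w = u \<cdot> (E n x y v' \<ominus>\<^bsub>A\<^esub> ?d \<bullet> w)" using w_eq E'[OF v'] by simp
    also have "\<dots> = u \<cdot> E n x y v' \<ominus>\<^bsub>A\<^esub> u \<cdot> (?d \<bullet> w)"
      using prod[OF u Ev'] prod[OF u dw] by (simp add: a_minus_def r_distr r_minus)
    finally have "\<pi> (u \<cdot> w) = ?d \<ominus> \<pi> (u \<cdot> (?d \<bullet> w))"
      using \<pi>_minus[OF prod(2)[OF u Ev'] prod(2)[OF u dw]] by simp
    also have "u \<cdot> (?d \<bullet> w) = ?d \<bullet> (u \<cdot> w)"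
      using prod[OF u wL] dF by (simp add: smult_mult_right)
    finally have "\<one> = \<zero>"
      using uw \<pi>_smult[OF dF prod(2)[OF u wL]] dF by (simp add: a_minus_def R.r_neg)
    then show False by simp
  qed
  note \<pi>_E_zero = this
  have "\<pi> (u \<cdot> v) = (\<Oplus>i\<in>{..<n}. \<pi> (u \<cdot> x i) \<otimes> \<pi> (y i \<cdot> v))"
    if u: "u \<in> principal_right e" and v: "v \<in> principal_left e" for u v
  proof -
    have sF: "(\<Oplus>i\<in>{..<n}. \<pi> (u \<cdot> x i) \<otimes> \<pi> (y i \<cdot> v)) \<in> carrier F"
      using p u v prod(1) by (intro R.finsum_closed) (auto simp: pairs_def)
    show ?thesis
      by (rule R.minus_zero_imp_eq[OF prod(1)[OF u v] sF trans[OF sym[OF \<pi>_E[OF p u v]] \<pi>_E_zero[OF u v]]])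
  qed
  then have "dual_system n x y" using p unfolding dual_system_def pairs_def by blast
  then show ?thesis by blast
qed

end


section \<open>Codimension one\<close>

context unital_algebra
begin

text \<open>The conditions say \<open>e A e = F e\<close> and \<open>A e A = A\<close>.\<close>

definition full_split_idempotent :: "'c \<Rightarrow> bool" where
  "full_split_idempotent e \<longleftrightarrow> idempotent e \<and> e \<noteq> \<zero>\<^bsub>A\<^esub> \<and>
    (\<forall>b\<in>corner e. \<exists>c\<in>carrier F. b = c \<bullet> e) \<and>
    (\<exists>n::nat. \<exists>x y. (\<forall>i<n. x i \<in> principal_left e \<and> y i \<in> principal_right e) \<and>
      (\<Oplus>\<^bsub>A\<^esub>i\<in>{..<n}. x i \<cdot> y i) = \<one>\<^bsub>A\<^esub>)"

text \<open>The residue construction with \<open>N = 0\<close>: the residue of \<open>b\<close> is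
  its coefficient with respect to \<open>e\<close>.\<close>

lemma full_split_corner_character:
  assumes "full_split_idempotent e"
  shows "corner_character F A e (residue e {\<zero>\<^bsub>A\<^esub>})"
    and "\<And>b. b \<in> corner e \<Longrightarrow> residue e {\<zero>\<^bsub>A\<^esub>} b \<bullet> e = b"
proof -
  have e: "idempotent e" "e \<in> carrier A" "e \<noteq> \<zero>\<^bsub>A\<^esub>"
    using assms idempotent_carrier by (auto simp: full_split_idempotent_def)
  have N: "subspace F {\<zero>\<^bsub>A\<^esub>} A" by (intro subspaceI) auto
  have scalar: "\<exists>c\<in>carrier F. b \<ominus>\<^bsub>A\<^esub> c \<bullet> e \<in> {\<zero>\<^bsub>A\<^esub>}" if "b \<in> corner e" for b
    using assms that e(2) by (force simp: full_split_idempotent_def a_minus_def M.r_neg)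
  have hyps: "{\<zero>\<^bsub>A\<^esub>} \<subseteq> corner e" "e \<notin> {\<zero>\<^bsub>A\<^esub>}"
    "\<And>b n. b \<in> corner e \<Longrightarrow> n \<in> {\<zero>\<^bsub>A\<^esub>} \<Longrightarrow> b \<cdot> n \<in> {\<zero>\<^bsub>A\<^esub>}"
    "\<And>b n. b \<in> corner e \<Longrightarrow> n \<in> {\<zero>\<^bsub>A\<^esub>} \<Longrightarrow> n \<cdot> b \<in> {\<zero>\<^bsub>A\<^esub>}"
    using e by (auto simp: corner_def)
  show "corner_character F A e (residue e {\<zero>\<^bsub>A\<^esub>})"
    by (rule corner_character_residue[OF e(1) N hyps scalar])
  fix b assume b: "b \<in> corner e"
  have r: "residue e {\<zero>\<^bsub>A\<^esub>} b \<in> carrier F" by (rule residue(1)[OF e(1) N hyps scalar b])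
  have "b \<ominus>\<^bsub>A\<^esub> residue e {\<zero>\<^bsub>A\<^esub>} b \<bullet> e \<in> {\<zero>\<^bsub>A\<^esub>}"
    by (rule residue(2)[OF e(1) N hyps scalar b])
  then show "residue e {\<zero>\<^bsub>A\<^esub>} b \<bullet> e = b"
    using minus_zero_imp_eq[OF cornerD(1)[OF b] smult_closed[OF r e(2)]] by simp
qed

text \<open>Moving each factor \<open>x\<^sub>i\<close> to the right changes \<open>a = \<Sum> x\<^sub>i y\<^sub>i a\<close> by commutators only.\<close>

lemma sum_cyclic_shift:
  fixes x y :: "nat \<Rightarrow> 'c"
  assumes W: "subspace F W A" and xy: "\<And>i. i < n \<Longrightarrow> x i \<in> carrier A" "\<And>i. i < n \<Longrightarrow> y i \<in> carrier A"
    and comm: "\<And>i. i < n \<Longrightarrow> y i \<cdot> x i \<ominus>\<^bsub>A\<^esub> x i \<cdot> y i \<in> W"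
  shows "(\<Oplus>\<^bsub>A\<^esub>i\<in>{..<n}. y i \<cdot> x i) \<ominus>\<^bsub>A\<^esub> (\<Oplus>\<^bsub>A\<^esub>i\<in>{..<n}. x i \<cdot> y i) \<in> W"
proof -
  let ?d = "\<lambda>i. y i \<cdot> x i \<ominus>\<^bsub>A\<^esub> x i \<cdot> y i"
  have d: "?d i \<in> carrier A" if "i < n" for i using xy that by simp
  have "(\<Oplus>\<^bsub>A\<^esub>i\<in>{..<n}. y i \<cdot> x i) = (\<Oplus>\<^bsub>A\<^esub>i\<in>{..<n}. ?d i \<oplus>\<^bsub>A\<^esub> x i \<cdot> y i)"
    using xy by (intro M.finsum_cong' refl) (auto simp: a_minus_def M.a_assoc M.l_neg)
  also have "\<dots> = (\<Oplus>\<^bsub>A\<^esub>i\<in>{..<n}. ?d i) \<oplus>\<^bsub>A\<^esub> (\<Oplus>\<^bsub>A\<^esub>i\<in>{..<n}. x i \<cdot> y i)"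
    using xy by (intro M.finsum_addf) auto
  finally have eq: "(\<Oplus>\<^bsub>A\<^esub>i\<in>{..<n}. y i \<cdot> x i) = \<dots>" .
  have "(\<Oplus>\<^bsub>A\<^esub>i\<in>{..<n}. ?d i) \<in> W" using comm by (intro subspace_finsum[OF W]) auto
  moreover have "(\<Oplus>\<^bsub>A\<^esub>i\<in>{..<n}. ?d i) \<in> carrier A" "(\<Oplus>\<^bsub>A\<^esub>i\<in>{..<n}. x i \<cdot> y i) \<in> carrier A"
    using d xy by (auto intro!: M.finsum_closed)
  ultimately show ?thesis unfolding eq by (simp add: a_minus_def M.a_assoc M.r_neg)
qed

text \<open>Inserting \<open>1 = \<Sum> x_i y_i\<close> between \<open>u\<close> and
  \<open>v\<close> shows that the given system is dual, so the trace keeps \<open>e\<close> out of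
  \<open>K(A)\<close>. Conversely \<open>a\<close> is congruent to \<open>\<Sum> y_i a x_i\<close>,
  an element of the corner and hence a multiple of \<open>e\<close>.\<close>

lemma full_split_commutator_codim:
  assumes fs: "full_split_idempotent e"
  shows "e \<notin> commutator_subspace F A"
    and "\<forall>a\<in>carrier A. \<exists>c\<in>carrier F. a \<ominus>\<^bsub>A\<^esub> c \<bullet> e \<in> commutator_subspace F A"
proof -
  define \<pi> where "\<pi> = residue e {\<zero>\<^bsub>A\<^esub>}"
  interpret corner_character F A e \<pi>
    unfolding \<pi>_def by (rule full_split_corner_character(1)[OF fs])
  have \<pi>_e: "\<pi> b \<bullet> e = b" if "b \<in> corner e" for b
    unfolding \<pi>_def by (rule full_split_corner_character(2)[OF fs that])
  obtain n :: nat and x y where xy: "\<And>i. i < n \<Longrightarrow> x i \<in> principal_left e"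
      "\<And>i. i < n \<Longrightarrow> y i \<in> principal_right e"
    and one: "(\<Oplus>\<^bsub>A\<^esub>i\<in>{..<n}. x i \<cdot> y i) = \<one>\<^bsub>A\<^esub>"
    using fs unfolding full_split_idempotent_def by blast
  have c: "x i \<in> carrier A" "y i \<in> carrier A" if "i < n" for i
    using xy[OF that] principal_leftD(1) principal_rightD(1) by auto
  have corner: "y i \<cdot> v \<in> corner e" if "v \<in> principal_left e" "i < n" for v i
    using that xy e_carrier by (auto intro: principal_mult_corner)
  have corner': "u \<cdot> x i \<in> corner e" if "u \<in> principal_right e" "i < n" for u i
    using that xy e_carrier by (auto intro: principal_mult_corner)
  have "dual_system n x y"
    unfolding dual_system_def
  proof (intro conjI ballI allI impI)
    fix u v assume u: "u \<in> principal_right e" and v: "v \<in> principal_left e"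
    have uv: "u \<in> carrier A" "v \<in> carrier A"
      using u v principal_leftD(1) principal_rightD(1) by auto
    have "u \<cdot> v = u \<cdot> (\<Oplus>\<^bsub>A\<^esub>i\<in>{..<n}. x i \<cdot> y i) \<cdot> v" using uv one by simp
    also have "\<dots> = (\<Oplus>\<^bsub>A\<^esub>i\<in>{..<n}. u \<cdot> (x i \<cdot> y i) \<cdot> v)"
      using uv c by (simp add: finsum_rdistr finsum_ldistr Pi_def)
    also have "\<dots> = (\<Oplus>\<^bsub>A\<^esub>i\<in>{..<n}. (u \<cdot> x i) \<cdot> (y i \<cdot> v))"
      using uv c by (intro M.finsum_cong' refl) (auto simp: m_assoc)
    also have "\<pi> \<dots> = (\<Oplus>i\<in>{..<n}. \<pi> ((u \<cdot> x i) \<cdot> (y i \<cdot> v)))"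
      using corner_mult[OF e_carrier corner'[OF u] corner[OF v]]
      by (intro \<pi>_finsum[THEN conjunct2]) auto
    also have "\<dots> = (\<Oplus>i\<in>{..<n}. \<pi> (u \<cdot> x i) \<otimes> \<pi> (y i \<cdot> v))"
      using corner[OF v] corner'[OF u] \<pi>_mult \<pi>_closed by (intro R.finsum_cong' refl) auto
    finally show "\<pi> (u \<cdot> v) = (\<Oplus>i\<in>{..<n}. \<pi> (u \<cdot> x i) \<otimes> \<pi> (y i \<cdot> v))" .
  qed (use xy in auto)
  then show "e \<notin> commutator_subspace F A" by (rule idempotent_not_commutator)
  show "\<forall>a\<in>carrier A. \<exists>c\<in>carrier F. a \<ominus>\<^bsub>A\<^esub> c \<bullet> e \<in> commutator_subspace F A"
  proof
    fix a assume a: "a \<in> carrier A"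
    let ?K = "commutator_subspace F A" and ?s = "\<Oplus>\<^bsub>A\<^esub>i\<in>{..<n}. (y i \<cdot> a) \<cdot> x i"
    have "?s \<ominus>\<^bsub>A\<^esub> (\<Oplus>\<^bsub>A\<^esub>i\<in>{..<n}. x i \<cdot> (y i \<cdot> a)) \<in> ?K"
      using c a
        by (intro sum_cyclic_shift[OF subspace_commutator_subspace] commutator_in_subspace) auto
    also have "(\<Oplus>\<^bsub>A\<^esub>i\<in>{..<n}. x i \<cdot> (y i \<cdot> a)) = (\<Oplus>\<^bsub>A\<^esub>i\<in>{..<n}. x i \<cdot> y i) \<cdot> a"
      using c a by (subst finsum_ldistr) (auto simp: m_assoc intro!: M.finsum_cong')
    also have "\<dots> = a" using one a by simp
    finally have "\<ominus>\<^bsub>A\<^esub> (?s \<ominus>\<^bsub>A\<^esub> a) \<in> ?K" by (rule subspace_uminus[OF subspace_commutator_subspace])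
    note neg = this
    have sc: "?s \<in> corner e"
      using principal_right_mult[OF e_carrier xy(2) a] corner'
        by (intro \<pi>_finsum[THEN conjunct1]) auto
    then have "?s \<in> carrier A" using cornerD(1) by auto
    moreover have "\<ominus>\<^bsub>A\<^esub> (p \<ominus>\<^bsub>A\<^esub> q) = q \<ominus>\<^bsub>A\<^esub> p" if "p \<in> carrier A" "q \<in> carrier A" for p q
      using that by algebra
    ultimately have "\<ominus>\<^bsub>A\<^esub> (?s \<ominus>\<^bsub>A\<^esub> a) = a \<ominus>\<^bsub>A\<^esub> ?s" using a by blast
    then have "a \<ominus>\<^bsub>A\<^esub> \<pi> ?s \<bullet> e \<in> ?K" using \<pi>_e[OF sc] neg by simp
    then show "\<exists>c\<in>carrier F. a \<ominus>\<^bsub>A\<^esub> c \<bullet> e \<in> ?K" using \<pi>_closed[OF sc] by blast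
  qed
qed

lemma full_split_commutator_codim_1:
  assumes "fin_dim" and "full_split_idempotent e"
  shows "commutator_codim F A = 1"
  using full_split_commutator_codim[OF assms(2)] assms(2) idempotent_carrier
  unfolding commutator_codim_1_iff[OF assms(1)] full_split_idempotent_def by blast

end

text \<open>The splitting hypothesis in terms of elements: modulo its nonunits, every primitive
  corner is \<open>F\<close>. Modules and universes do not enter this form.\<close>

locale locally_split_algebra = fin_dim_algebra +
  assumes local_split: "\<lbrakk>primitive_idempotent e; b \<in> corner e\<rbrakk> \<Longrightarrow>
    \<exists>c\<in>carrier F. b \<ominus>\<^bsub>A\<^esub> c \<bullet> e \<in> corner_nonunits e"
begin

lemma subspace_corner_nonunits:
  assumes e: "primitive_idempotent e"
  shows "subspace F (corner_nonunits e) A"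
proof (rule subspaceI)
  note eD = primitive_idempotentD[OF e]
  show "corner_nonunits e \<subseteq> carrier A" using corner_nonunits_carrier[OF e] by blast
  show "\<zero>\<^bsub>A\<^esub> \<in> corner_nonunits e"
    unfolding corner_nonunits_iff_nilpotent[OF e] using eD
    by (auto simp: corner_def intro!: exI[of _ "1::nat"])
  fix v w assume "v \<in> corner_nonunits e" "w \<in> corner_nonunits e"
  then show "v \<oplus>\<^bsub>A\<^esub> w \<in> corner_nonunits e" by (rule corner_nonunits_add[OF e])
next
  note eD = primitive_idempotentD[OF e]
  fix c v assume c: "c \<in> carrier F" and v: "v \<in> corner_nonunits e"
  have vc: "v \<in> corner e" by (rule corner_nonunits_corner[OF e v])
  have "c \<bullet> v = (c \<bullet> e) \<cdot> v" using c eD cornerD[OF vc] by (simp add: smult_mult_left)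
  also have "\<dots> \<in> corner_nonunits e"
    using c corner_smult[OF eD(2) corner_self[OF eD(1)] c]
      by (intro corner_nonunits_mult_left[OF e v])
  finally show "c \<bullet> v \<in> corner_nonunits e" .
qed

lemma primitive_residue:
  assumes e: "primitive_idempotent e"
  defines "\<pi> \<equiv> residue e (corner_nonunits e)"
  shows "corner_character F A e \<pi>"
    and "\<And>n. n \<in> corner_nonunits e \<Longrightarrow> \<pi> n = \<zero>"
    and "\<And>b. b \<in> corner e \<Longrightarrow> b \<ominus>\<^bsub>A\<^esub> \<pi> b \<bullet> e \<in> corner_nonunits e"
proof -
  have sub: "corner_nonunits e \<subseteq> corner e" using corner_nonunits_corner[OF e] by blast
  note hyps = primitive_idempotentD(1)[OF e] subspace_corner_nonunits[OF e] sub
    idempotent_not_nonunit[OF e] corner_nonunits_mult_left[OF e] corner_nonunits_mult_right[OF e]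
    local_split[OF e]
  show "corner_character F A e \<pi>" unfolding \<pi>_def by (rule corner_character_residue[OF hyps])
  show "\<pi> n = \<zero>" if "n \<in> corner_nonunits e" for n
    unfolding \<pi>_def by (rule residue_zero[OF hyps that])
  show "b \<ominus>\<^bsub>A\<^esub> \<pi> b \<bullet> e \<in> corner_nonunits e" if "b \<in> corner e" for b
    unfolding \<pi>_def by (rule residue(2)[OF hyps that])
qed

text \<open>The trace attached to the residue character of \<open>e\<close> vanishes on
  \<open>K(A)\<close> and is \<open>1\<close> at \<open>e\<close>.\<close>

lemma primitive_not_commutator:
  assumes e: "primitive_idempotent e"
  shows "e \<notin> commutator_subspace F A"
  using corner_character.dual_system_exists[OF primitive_residue(1)[OF e] fin_dim]
    corner_character.idempotent_not_commutator[OF primitive_residue(1)[OF e]] by blast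

end

context fin_dim_algebra
begin

text \<open>In a right ideal \<open>L\<close> minimal with \<open>L N \<noteq> 0\<close>, some \<open>l \<noteq> 0\<close> satisfies
  \<open>l = l m\<close> with \<open>m\<close> nilpotent.\<close>

lemma idempotent_nil_ideal_zero:
  assumes N: "subspace F N A"
    and nil: "\<And>n. n \<in> N \<Longrightarrow> \<exists>m::nat. n [^]\<^bsub>A\<^esub> m = \<zero>\<^bsub>A\<^esub>"
    and mult: "\<And>n n'. n \<in> N \<Longrightarrow> n' \<in> N \<Longrightarrow> n \<cdot> n' \<in> N"
    and gen: "N \<subseteq> span {n \<cdot> n' | n n'. n \<in> N \<and> n' \<in> N}"
  shows "N = {\<zero>\<^bsub>A\<^esub>}"
proof (rule ccontr)
  let ?P = "{n \<cdot> n' | n n'. n \<in> N \<and> n' \<in> N}"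
  note Nc = subsetD[OF subspaceD(1)[OF N]]
  assume "N \<noteq> {\<zero>\<^bsub>A\<^esub>}"
  then obtain n0 where n0: "n0 \<in> N" "n0 \<noteq> \<zero>\<^bsub>A\<^esub>" using subspaceD(2)[OF N] by blast
  \<comment> \<open>Since \<open>N\<close> is spanned by products of its elements, an
    \<open>l\<close> that kills all these products kills \<open>N\<close>.\<close>
  have annihilates: "\<exists>n\<in>N. \<exists>n'\<in>N. l \<cdot> (n \<cdot> n') \<noteq> \<zero>\<^bsub>A\<^esub>"
    if l: "l \<in> carrier A" and r: "r \<in> N" "l \<cdot> r \<noteq> \<zero>\<^bsub>A\<^esub>" for l r
  proof (rule ccontr)
    assume "\<not> ?thesis"
    then have "?P \<subseteq> {x \<in> carrier A. l \<cdot> x = \<zero>\<^bsub>A\<^esub>}" using Nc by auto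
    moreover have "subspace F {x \<in> carrier A. l \<cdot> x = \<zero>\<^bsub>A\<^esub>} A"
      using l by (intro subspaceI) (auto simp: r_distr smult_mult_right)
    ultimately have "span ?P \<subseteq> {x \<in> carrier A. l \<cdot> x = \<zero>\<^bsub>A\<^esub>}"
      by (intro span_is_subset) (auto simp: subspace_def)
    then show False using r gen by blast
  qed
  define S where "S = {L. subspace F L A \<and> L \<subseteq> N \<and> (\<forall>l\<in>L. \<forall>n\<in>N. l \<cdot> n \<in> L) \<and>
    (\<exists>l\<in>L. \<exists>n\<in>N. l \<cdot> n \<noteq> \<zero>\<^bsub>A\<^esub>)}"
  have "\<one>\<^bsub>A\<^esub> \<cdot> n0 \<noteq> \<zero>\<^bsub>A\<^esub>" using n0 Nc by simp
  then obtain n n' where "n \<in> N" "n' \<in> N" "\<one>\<^bsub>A\<^esub> \<cdot> (n \<cdot> n') \<noteq> \<zero>\<^bsub>A\<^esub>"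
    using annihilates[of "\<one>\<^bsub>A\<^esub>" n0] n0 by auto
  then have "\<exists>l\<in>N. \<exists>n\<in>N. l \<cdot> n \<noteq> \<zero>\<^bsub>A\<^esub>" using Nc by (intro bexI[of _ n] bexI[of _ n']) auto
  then have NS: "N \<in> S" unfolding S_def using N mult by blast
  have S_sub: "subspace F L A" if "L \<in> S" for L using that unfolding S_def by blast
  obtain L where L: "L \<in> S" and min: "\<And>L'. L' \<in> S \<Longrightarrow> L' \<subseteq> L \<Longrightarrow> L' = L"
    using minimal_subspace_exists[OF fin_dim NS S_sub] by blast
  then obtain l n1 where l: "l \<in> L" "n1 \<in> N" "l \<cdot> n1 \<noteq> \<zero>\<^bsub>A\<^esub>" and LN: "L \<subseteq> N"
    and Lr: "\<And>l n. l \<in> L \<Longrightarrow> n \<in> N \<Longrightarrow> l \<cdot> n \<in> L" unfolding S_def by blast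
  have lc: "l \<in> carrier A" using l LN Nc by blast
  \<comment> \<open>\<open>l N\<close> belongs to the family again, as \<open>l N N = 0\<close>
    would imply \<open>l N = 0\<close>. Minimality forces \<open>l N = L\<close>, so
    \<open>l\<close> itself has the form \<open>l m\<close>.\<close>
  define L' where "L' = (\<lambda>n. l \<cdot> n) ` N"
  have "subspace F L' A"
  proof (rule subspaceI)
    show "L' \<subseteq> carrier A" using lc Nc by (auto simp: L'_def)
    show "\<zero>\<^bsub>A\<^esub> \<in> L'" unfolding L'_def
      using lc subspaceD(2)[OF N] by (intro image_eqI[of _ _ "\<zero>\<^bsub>A\<^esub>"]) auto
    fix v w assume "v \<in> L'" "w \<in> L'"
    then obtain a b where ab: "a \<in> N" "b \<in> N" "v = l \<cdot> a" "w = l \<cdot> b" by (auto simp: L'_def)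
    then have "v \<oplus>\<^bsub>A\<^esub> w = l \<cdot> (a \<oplus>\<^bsub>A\<^esub> b)" using lc Nc by (simp add: r_distr)
    then show "v \<oplus>\<^bsub>A\<^esub> w \<in> L'" unfolding L'_def using subspaceD(3)[OF N ab(1,2)] by blast
  next
    fix c v assume c: "c \<in> carrier F" and "v \<in> L'"
    then obtain a where a: "a \<in> N" "v = l \<cdot> a" by (auto simp: L'_def)
    then have "c \<bullet> v = l \<cdot> (c \<bullet> a)" using lc Nc c by (simp add: smult_mult_right)
    then show "c \<bullet> v \<in> L'" unfolding L'_def using subspaceD(4)[OF N c a(1)] by blast
  qed
  moreover have L'L: "L' \<subseteq> L" using Lr l(1) by (auto simp: L'_def)
  moreover have "\<forall>a\<in>L'. \<forall>n\<in>N. a \<cdot> n \<in> L'"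
    using lc Nc mult by (auto simp: L'_def m_assoc)
  moreover have "\<exists>a\<in>L'. \<exists>n\<in>N. a \<cdot> n \<noteq> \<zero>\<^bsub>A\<^esub>"
  proof -
    obtain n n' where nn: "n \<in> N" "n' \<in> N" "l \<cdot> (n \<cdot> n') \<noteq> \<zero>\<^bsub>A\<^esub>"
      using annihilates[OF lc l(2,3)] by blast
    then have "(l \<cdot> n) \<cdot> n' \<noteq> \<zero>\<^bsub>A\<^esub>" using lc Nc by (simp add: m_assoc)
    then show ?thesis unfolding L'_def using nn by blast
  qed
  ultimately have "L' \<in> S" unfolding S_def using LN by blast
  then have "L' = L" using min L'L by blast
  then obtain m where m: "m \<in> N" "l = l \<cdot> m" using l(1) by (auto simp: L'_def)
  have "l = l \<cdot> m [^]\<^bsub>A\<^esub> k" for k :: nat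
  proof (induction k)
    case 0
    then show ?case using lc by simp
  next
    case (Suc k)
    have "l \<cdot> m [^]\<^bsub>A\<^esub> Suc k = (l \<cdot> m [^]\<^bsub>A\<^esub> k) \<cdot> m"
      using lc Nc[OF m(1)] by (simp add: m_assoc)
    then show ?case using Suc m(2) by simp
  qed
  moreover obtain k :: nat where "m [^]\<^bsub>A\<^esub> k = \<zero>\<^bsub>A\<^esub>" using nil[OF m(1)] by blast
  ultimately have "l = \<zero>\<^bsub>A\<^esub>" using lc by (metis r_null)
  then show False using l Nc by simp
qed

end

context locally_split_algebra
begin

text \<open>The hypotheses are \<open>k(A) = 1\<close> in the form supplied by
  \<open>commutator_codim_1_iff\<close>.\<close>

lemma full_split_idempotent_exists:
  assumes z: "z \<in> carrier A" "z \<notin> commutator_subspace F A"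
    and K: "\<forall>a\<in>carrier A. \<exists>c\<in>carrier F. a \<ominus>\<^bsub>A\<^esub> c \<bullet> z \<in> commutator_subspace F A"
  shows "\<exists>e. full_split_idempotent e"
proof -
  let ?K = "commutator_subspace F A"
  \<comment> \<open>In the zero algebra \<open>z\<close> would be \<open>0\<close> and hence lie in
    \<open>K(A)\<close>.\<close>
  have "\<one>\<^bsub>A\<^esub> \<noteq> \<zero>\<^bsub>A\<^esub>"
  proof
    assume "\<one>\<^bsub>A\<^esub> = \<zero>\<^bsub>A\<^esub>"
    then have "z = \<zero>\<^bsub>A\<^esub>" using z(1) by (metis l_null l_one)
    then show False using z(2) subspaceD(2)[OF subspace_commutator_subspace] by simp
  qed
  moreover have "idempotent \<one>\<^bsub>A\<^esub>" by (simp add: idempotent_def)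
  ultimately obtain e where prim: "primitive_idempotent e"
    using primitive_idempotent_below by blast
  note eD = primitive_idempotentD[OF prim]
  define N where "N = corner_nonunits e"
  define \<pi> where "\<pi> = residue e N"
  interpret corner_character F A e \<pi>
    unfolding \<pi>_def N_def by (rule primitive_residue(1)[OF prim])
  have \<pi>_N: "\<pi> n = \<zero>" if "n \<in> N" for n
    using that unfolding \<pi>_def N_def by (rule primitive_residue(2)[OF prim])
  have decomp: "b \<ominus>\<^bsub>A\<^esub> \<pi> b \<bullet> e \<in> N" if "b \<in> corner e" for b
    using that unfolding \<pi>_def N_def by (rule primitive_residue(3)[OF prim])
  have N: "subspace F N A" unfolding N_def by (rule subspace_corner_nonunits[OF prim])
  have NcE: "n \<in> corner e" if "n \<in> N" for n
    using that corner_nonunits_corner[OF prim] by (simp add: N_def)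
  have Nc: "n \<in> carrier A" if "n \<in> N" for n using NcE[OF that] cornerD(1) by blast
  have N_left: "b \<cdot> n \<in> N" if "n \<in> N" "b \<in> corner e" for b n
    using that corner_nonunits_mult_left[OF prim] by (simp add: N_def)
  have N_right: "n \<cdot> b \<in> N" if "n \<in> N" "b \<in> corner e" for b n
    using that corner_nonunits_mult_right[OF prim] by (simp add: N_def)
  obtain n x y where dual: "dual_system n x y" using dual_system_exists[OF fin_dim] by blast
  note xy = dual_mem[OF dual] and xyc = dual_carrier[OF dual]
  note R = principal_rightD and L = principal_leftD

  \<comment> \<open>The annihilator of the simple module on top of \<open>e A\<close>: an element
    acts on it as zero iff all its matrix coefficients \<open>\<pi> (u a v)\<close> vanish.\<close>
  define I where "I = {a \<in> carrier A. \<forall>u\<in>principal_right e. \<forall>v\<in>principal_left e.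
    \<pi> (u \<cdot> a \<cdot> v) = \<zero>}"
  \<comment> \<open>The trace is a sum of matrix coefficients, and here its kernel is contained in
    \<open>K(A)\<close>.\<close>
  have IK: "a \<in> ?K" if "a \<in> I" for a
  proof -
    have a: "a \<in> carrier A" using that by (simp add: I_def)
    have "ch_trace n x y a = (\<Oplus>i\<in>{..<n}. \<zero>)"
      unfolding ch_trace_def[OF dual]
        using that xy by (intro R.finsum_cong' refl) (auto simp: I_def)
    then show ?thesis using ch_trace_zero_commutator[OF dual K z(1) a] by simp
  qed
  have I_right: "a \<cdot> b \<in> I" if "a \<in> I" "b \<in> carrier A" for a b
  proof -
    have "u \<cdot> (a \<cdot> b) \<cdot> v = u \<cdot> a \<cdot> (b \<cdot> v)"
      if "u \<in> principal_right e" "v \<in> principal_left e" for u v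
      using that R(1) L(1) \<open>a \<in> I\<close> \<open>b \<in> carrier A\<close> by (simp add: I_def m_assoc)
    then show ?thesis using that principal_left_mult[OF e_carrier] by (auto simp: I_def)
  qed
  \<comment> \<open>The Fitting idempotent \<open>g\<close> of \<open>a\<close> lies in
    \<open>a A\<close> and so in \<open>I\<close>. If \<open>g \<noteq> 0\<close>, a primitive
    \<open>f\<close> in its corner satisfies \<open>f = g f \<in> I\<close>, which would place
    \<open>f\<close> in \<open>K(A)\<close>. Hence \<open>g = 0\<close>, and a power of
    \<open>a\<close> vanishes.\<close>
  have I_nil: "\<exists>m::nat. a [^]\<^bsub>A\<^esub> m = \<zero>\<^bsub>A\<^esub>" if a: "a \<in> I" for a
  proof -
    have ac: "a \<in> carrier A" using a by (simp add: I_def)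
    obtain m c d g where m: "(m::nat) > 0" and c: "c \<in> carrier A" and g: "idempotent g"
      "g = a [^]\<^bsub>A\<^esub> m \<cdot> c" "g \<cdot> a [^]\<^bsub>A\<^esub> m = a [^]\<^bsub>A\<^esub> m"
      using power_multiple_idempotent[OF ac] by blast
    obtain k where k: "m = Suc k" using m gr0_implies_Suc by blast
    have "g = a \<cdot> (a [^]\<^bsub>A\<^esub> k \<cdot> c)"
      unfolding g(2) k nat_pow_Suc2[OF ac] using ac c by (simp add: m_assoc)
    then have gI: "g \<in> I" using I_right[OF a, of "a [^]\<^bsub>A\<^esub> k \<cdot> c"] ac c by simp
    have "g = \<zero>\<^bsub>A\<^esub>"
    proof (rule ccontr)
      assume "g \<noteq> \<zero>\<^bsub>A\<^esub>"
      then obtain f where f: "f \<in> corner g" "primitive_idempotent f"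
        using primitive_idempotent_below g(1) by blast
      have "g \<cdot> f \<in> I" using I_right[OF gI] cornerD(1)[OF f(1)] by blast
      then have "f \<in> ?K" using IK cornerD(2)[OF f(1)] by simp
      then show False using primitive_not_commutator[OF f(2)] by blast
    qed
    then have "a [^]\<^bsub>A\<^esub> m = \<zero>\<^bsub>A\<^esub>" using g(3) ac by (metis l_null nat_pow_closed)
    then show ?thesis by blast
  qed

  define s where "s = (\<Oplus>\<^bsub>A\<^esub>i\<in>{..<n}. x i \<cdot> y i)"
  have sc: "s \<in> carrier A" unfolding s_def using xyc by (intro M.finsum_closed) auto
  \<comment> \<open>Duality says precisely that \<open>s\<close> and \<open>1\<close> have the same
    matrix coefficients.\<close>
  have "\<one>\<^bsub>A\<^esub> \<ominus>\<^bsub>A\<^esub> s \<in> I"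
  proof -
    have "\<pi> (u \<cdot> (\<one>\<^bsub>A\<^esub> \<ominus>\<^bsub>A\<^esub> s) \<cdot> v) = \<zero>"
      if u: "u \<in> principal_right e" and v: "v \<in> principal_left e" for u v
    proof -
      note uv = R(1)[OF u] L(1)[OF v]
      have corner: "y i \<cdot> v \<in> corner e" "u \<cdot> x i \<in> corner e" if "i < n" for i
        using that xy u v e_carrier by (auto intro: principal_mult_corner)
      have "u \<cdot> s \<cdot> v = (\<Oplus>\<^bsub>A\<^esub>i\<in>{..<n}. u \<cdot> (x i \<cdot> y i) \<cdot> v)"
        unfolding s_def using uv xyc by (simp add: finsum_rdistr finsum_ldistr Pi_def)
      also have "\<dots> = (\<Oplus>\<^bsub>A\<^esub>i\<in>{..<n}. (u \<cdot> x i) \<cdot> (y i \<cdot> v))"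
        using uv xyc by (intro M.finsum_cong' refl) (auto simp: m_assoc)
      also have "\<pi> \<dots> = (\<Oplus>i\<in>{..<n}. \<pi> ((u \<cdot> x i) \<cdot> (y i \<cdot> v)))"
        using corner_mult[OF e_carrier corner(2,1)] by (intro \<pi>_finsum[THEN conjunct2]) auto
      also have "\<dots> = (\<Oplus>i\<in>{..<n}. \<pi> (u \<cdot> x i) \<otimes> \<pi> (y i \<cdot> v))"
        using corner \<pi>_mult \<pi>_closed by (intro R.finsum_cong' refl) auto
      also have "\<dots> = \<pi> (u \<cdot> v)" by (rule dual_expand[OF dual u v, symmetric])
      finally have "\<pi> (u \<cdot> s \<cdot> v) = \<pi> (u \<cdot> v)" .
      moreover have "u \<cdot> (\<one>\<^bsub>A\<^esub> \<ominus>\<^bsub>A\<^esub> s) \<cdot> v = u \<cdot> v \<ominus>\<^bsub>A\<^esub> u \<cdot> s \<cdot> v"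
        using uv sc by (simp add: a_minus_def r_distr l_distr r_minus l_minus)
      moreover have "u \<cdot> v \<in> corner e" "u \<cdot> s \<cdot> v \<in> corner e"
        using u v sc e_carrier by (auto intro: principal_mult_corner principal_sandwich_corner)
      ultimately show ?thesis using \<pi>_minus \<pi>_closed by (simp add: a_minus_def R.r_neg)
    qed
    then show ?thesis using sc by (simp add: I_def)
  qed
  then obtain m :: nat where "(\<one>\<^bsub>A\<^esub> \<ominus>\<^bsub>A\<^esub> s) [^]\<^bsub>A\<^esub> m = \<zero>\<^bsub>A\<^esub>" using I_nil by blast
  moreover have "\<one>\<^bsub>A\<^esub> \<ominus>\<^bsub>A\<^esub> (\<one>\<^bsub>A\<^esub> \<ominus>\<^bsub>A\<^esub> s) = s" using sc one_closed by algebra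
  ultimately obtain w where w: "w \<in> carrier A" "w \<cdot> s = \<one>\<^bsub>A\<^esub>"
    using one_minus_nilpotent_unit[of "\<one>\<^bsub>A\<^esub> \<ominus>\<^bsub>A\<^esub> s" m] sc by auto
  \<comment> \<open>A left inverse of \<open>s\<close> is absorbed into the \<open>x_i\<close>; the
    \<open>y_i\<close> are kept, and \<open>\<Sum> x'_i y_i = w s = 1\<close>.\<close>
  define x' where "x' i = w \<cdot> x i" for i
  have x': "x' i \<in> principal_left e" if "i < n" for i
    unfolding x'_def using principal_left_mult[OF e_carrier xy(1)[OF that] w(1)] .
  have x'c: "x' i \<in> carrier A" if "i < n" for i using L(1)[OF x'[OF that]] .
  have one: "(\<Oplus>\<^bsub>A\<^esub>i\<in>{..<n}. x' i \<cdot> y i) = \<one>\<^bsub>A\<^esub>"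
  proof -
    have "(\<Oplus>\<^bsub>A\<^esub>i\<in>{..<n}. x' i \<cdot> y i) = (\<Oplus>\<^bsub>A\<^esub>i\<in>{..<n}. w \<cdot> (x i \<cdot> y i))"
      using w(1) xyc by (intro M.finsum_cong' refl) (auto simp: x'_def m_assoc)
    also have "\<dots> = w \<cdot> s" unfolding s_def using w(1) xyc by (intro finsum_rdistr[symmetric]) auto
    finally show ?thesis using w(2) by simp
  qed

  \<comment> \<open>\<open>span P\<close> is the ideal \<open>N^2\<close> of the corner.\<close>
  define P where "P = {n \<cdot> n' | n n'. n \<in> N \<and> n' \<in> N}"
  have Pc: "P \<subseteq> carrier A" using Nc by (auto simp: P_def)
  have N2: "subspace F (span P) A" by (rule span_is_subspace[OF Pc])
  have PN2: "a \<cdot> b \<in> span P" if "a \<in> N" "b \<in> N" for a b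
  proof -
    have "a \<cdot> b \<in> P" unfolding P_def using that by blast
    then show ?thesis using in_own_span[OF Pc] by blast
  qed
  \<comment> \<open>Multiples of \<open>e\<close> are central in the corner. Subtracting the
    residues leaves \<open>r\<close>, \<open>r'\<close> in \<open>N\<close>, and the commutator
    becomes \<open>r r' - r' r\<close>.\<close>
  have corner_comm: "b \<cdot> b' \<ominus>\<^bsub>A\<^esub> b' \<cdot> b \<in> span P"
    if b: "b \<in> corner e" and b': "b' \<in> corner e" for b b'
  proof -
    define r where "r = b \<ominus>\<^bsub>A\<^esub> \<pi> b \<bullet> e"
    define r' where "r' = b' \<ominus>\<^bsub>A\<^esub> \<pi> b' \<bullet> e"
    define c where "c = \<pi> b" define c' where "c' = \<pi> b'"
    have r: "r \<in> N" "r' \<in> N" using decomp b b' by (auto simp: r_def r'_def)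
    have cF: "c \<in> carrier F" "c' \<in> carrier F" using \<pi>_closed b b' by (auto simp: c_def c'_def)
    note rc = Nc[OF r(1)] Nc[OF r(2)]
    have ce: "c \<bullet> e \<in> carrier A" "c' \<bullet> e \<in> carrier A" using cF e_carrier by auto
    have bb: "b = c \<bullet> e \<oplus>\<^bsub>A\<^esub> r" "b' = c' \<bullet> e \<oplus>\<^bsub>A\<^esub> r'"
    proof -
      have "p = q \<oplus>\<^bsub>A\<^esub> (p \<ominus>\<^bsub>A\<^esub> q)" if "p \<in> carrier A" "q \<in> carrier A" for p q using that by algebra
      then show "b = c \<bullet> e \<oplus>\<^bsub>A\<^esub> r" "b' = c' \<bullet> e \<oplus>\<^bsub>A\<^esub> r'"
        unfolding r_def r'_def c_def[symmetric] c'_def[symmetric]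
        using cornerD(1)[OF b] cornerD(1)[OF b'] ce by blast+
    qed
    have scal: "(d \<bullet> e) \<cdot> t = d \<bullet> t" "t \<cdot> (d \<bullet> e) = d \<bullet> t"
      if "d \<in> carrier F" "t \<in> corner e" for d t
      using that e_carrier cornerD[OF that(2)] by (simp_all add: smult_mult_left smult_mult_right)
    have ceC: "c \<bullet> e \<in> corner e" "c' \<bullet> e \<in> corner e"
      using corner_smult[OF e_carrier corner_self[OF eD(1)]] cF by auto
    have b1: "b \<cdot> b' = (c' \<bullet> (c \<bullet> e) \<oplus>\<^bsub>A\<^esub> c' \<bullet> r) \<oplus>\<^bsub>A\<^esub> (c \<bullet> r' \<oplus>\<^bsub>A\<^esub> r \<cdot> r')"
      unfolding bb using ce rc by (simp add: l_distr r_distr scal cF ceC NcE r M.a_assoc)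
    have b2: "b' \<cdot> b = (c \<bullet> (c' \<bullet> e) \<oplus>\<^bsub>A\<^esub> c \<bullet> r') \<oplus>\<^bsub>A\<^esub> (c' \<bullet> r \<oplus>\<^bsub>A\<^esub> r' \<cdot> r)"
      unfolding bb using ce rc by (simp add: l_distr r_distr scal cF ceC NcE r M.a_assoc)
    have cc: "c' \<bullet> (c \<bullet> e) = c \<bullet> (c' \<bullet> e)"
      using cF e_carrier by (simp add: R.m_comm flip: smult_assoc1)
    have alg: "((p \<oplus>\<^bsub>A\<^esub> q) \<oplus>\<^bsub>A\<^esub> (t \<oplus>\<^bsub>A\<^esub> u)) \<ominus>\<^bsub>A\<^esub> ((p \<oplus>\<^bsub>A\<^esub> t) \<oplus>\<^bsub>A\<^esub> (q \<oplus>\<^bsub>A\<^esub> v)) = u \<ominus>\<^bsub>A\<^esub> v"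
      if "p \<in> carrier A" "q \<in> carrier A" "t \<in> carrier A" "u \<in> carrier A" "v \<in> carrier A"
        for p q t u v
      using that by algebra
    have "b \<cdot> b' \<ominus>\<^bsub>A\<^esub> b' \<cdot> b = r \<cdot> r' \<ominus>\<^bsub>A\<^esub> r' \<cdot> r"
      unfolding b1 b2 cc using cF rc ce by (intro alg) auto
    moreover have "r \<cdot> r' \<in> span P" "r' \<cdot> r \<in> span P" using PN2 r by blast+
    ultimately show ?thesis using subspace_minus[OF N2] by simp
  qed

  \<comment> \<open>The sum of the diagonal entries of the matrix \<open>(y_i a x'_j)\<close> over
    the corner, a refinement of the trace that has not yet been reduced by
    \<open>\<pi>\<close>.\<close>
  define Tr where "Tr a = (\<Oplus>\<^bsub>A\<^esub>i\<in>{..<n}. y i \<cdot> a \<cdot> x' i)" for a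
  have Tr_closed: "Tr a \<in> carrier A" if "a \<in> carrier A" for a
    unfolding Tr_def using that xyc x'c by (intro M.finsum_closed) auto
  have Tr_add: "Tr (a \<oplus>\<^bsub>A\<^esub> b) = Tr a \<oplus>\<^bsub>A\<^esub> Tr b" if "a \<in> carrier A" "b \<in> carrier A" for a b
  proof -
    have "Tr (a \<oplus>\<^bsub>A\<^esub> b) = (\<Oplus>\<^bsub>A\<^esub>i\<in>{..<n}. y i \<cdot> a \<cdot> x' i \<oplus>\<^bsub>A\<^esub> y i \<cdot> b \<cdot> x' i)"
      unfolding Tr_def using that xyc x'c
      by (intro M.finsum_cong' refl) (auto simp: l_distr r_distr)
    then show ?thesis unfolding Tr_def using that xyc x'c by (simp add: M.finsum_addf Pi_def)
  qed
  have Tr_smult: "Tr (c \<bullet> a) = c \<bullet> Tr a" if "c \<in> carrier F" "a \<in> carrier A" for c a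
  proof -
    have "Tr (c \<bullet> a) = (\<Oplus>\<^bsub>A\<^esub>i\<in>{..<n}. c \<bullet> (y i \<cdot> a \<cdot> x' i))"
      unfolding Tr_def using that xyc x'c
      by (intro M.finsum_cong' refl) (auto simp: smult_mult_left smult_mult_right)
    also have "\<dots> = c \<bullet> Tr a" unfolding Tr_def using that xyc x'c
      by (intro finsum_additive_map[symmetric] M.abelian_monoid_axioms) (auto simp: smult_r_distr)
    finally show ?thesis .
  qed
  have Tr_comm: "Tr (a \<cdot> b) \<ominus>\<^bsub>A\<^esub> Tr (b \<cdot> a) \<in> span P"
    if a: "a \<in> carrier A" and b: "b \<in> carrier A" for a b
  proof -
    define p where "p i j = y i \<cdot> a \<cdot> x' j" for i j
    define q where "q i j = y i \<cdot> b \<cdot> x' j" for i j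
    have pq: "p i j \<in> corner e" "q i j \<in> corner e" if "i < n" "j < n" for i j
      using that a b xy x' e_carrier unfolding p_def q_def
      by (auto intro: principal_sandwich_corner)
    have pqc: "p i j \<in> carrier A" "q i j \<in> carrier A" if "i < n" "j < n" for i j
      using cornerD(1)[OF pq(1)[OF that]] cornerD(1)[OF pq(2)[OF that]] .
    \<comment> \<open>Inserting \<open>1 = \<Sum> x'_j y_j\<close> turns products into matrix
      products. Hence \<open>Tr (a b)\<close> and \<open>Tr (b a)\<close> differ only in the order
      of the entries, that is, by commutators of the corner.\<close>
    have expand: "y i \<cdot> (a \<cdot> b) \<cdot> x' i =
        (\<Oplus>\<^bsub>A\<^esub>j\<in>{..<n}. (y i \<cdot> a \<cdot> x' j) \<cdot> (y j \<cdot> b \<cdot> x' i))"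
      if i: "i < n" and a: "a \<in> carrier A" and b: "b \<in> carrier A" for i a b
    proof -
      note c = xyc(2)[OF i] x'c[OF i] a b
      have "y i \<cdot> (a \<cdot> b) \<cdot> x' i =
          (y i \<cdot> a) \<cdot> (\<Oplus>\<^bsub>A\<^esub>j\<in>{..<n}. x' j \<cdot> y j) \<cdot> (b \<cdot> x' i)"
        unfolding one using c by (simp add: m_assoc)
      also have "\<dots> = (\<Oplus>\<^bsub>A\<^esub>j\<in>{..<n}. (y i \<cdot> a) \<cdot> (x' j \<cdot> y j) \<cdot> (b \<cdot> x' i))"
        using c xyc x'c by (simp add: finsum_rdistr finsum_ldistr Pi_def)
      also have "\<dots> = (\<Oplus>\<^bsub>A\<^esub>j\<in>{..<n}. (y i \<cdot> a \<cdot> x' j) \<cdot> (y j \<cdot> b \<cdot> x' i))"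
        using c xyc x'c by (intro M.finsum_cong' refl) (auto simp: m_assoc)
      finally show ?thesis .
    qed
    have "Tr (a \<cdot> b) = (\<Oplus>\<^bsub>A\<^esub>i\<in>{..<n}. \<Oplus>\<^bsub>A\<^esub>j\<in>{..<n}. p i j \<cdot> q j i)"
      unfolding Tr_def p_def q_def using expand[OF _ a b] xyc x'c a b
      by (intro M.finsum_cong' refl) (auto intro!: M.finsum_closed)
    moreover have "Tr (b \<cdot> a) = (\<Oplus>\<^bsub>A\<^esub>j\<in>{..<n}. \<Oplus>\<^bsub>A\<^esub>i\<in>{..<n}. q j i \<cdot> p i j)"
      unfolding Tr_def p_def q_def using expand[OF _ b a] xyc x'c a b
      by (intro M.finsum_cong' refl) (auto intro!: M.finsum_closed)
    moreover have "\<dots> = (\<Oplus>\<^bsub>A\<^esub>i\<in>{..<n}. \<Oplus>\<^bsub>A\<^esub>j\<in>{..<n}. q j i \<cdot> p i j)"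
      using pqc by (intro finsum_finsum_swap) auto
    moreover have "(\<Oplus>\<^bsub>A\<^esub>i\<in>{..<n}. \<Oplus>\<^bsub>A\<^esub>j\<in>{..<n}. p i j \<cdot> q j i) =
      (\<Oplus>\<^bsub>A\<^esub>i\<in>{..<n}. \<Oplus>\<^bsub>A\<^esub>j\<in>{..<n}. p i j \<cdot> q j i \<ominus>\<^bsub>A\<^esub> q j i \<cdot> p i j) \<oplus>\<^bsub>A\<^esub>
      (\<Oplus>\<^bsub>A\<^esub>i\<in>{..<n}. \<Oplus>\<^bsub>A\<^esub>j\<in>{..<n}. q j i \<cdot> p i j)" (is "_ = ?D \<oplus>\<^bsub>A\<^esub> ?Q")
    proof -
      have "(\<Oplus>\<^bsub>A\<^esub>j\<in>{..<n}. p i j \<cdot> q j i) =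
          (\<Oplus>\<^bsub>A\<^esub>j\<in>{..<n}. p i j \<cdot> q j i \<ominus>\<^bsub>A\<^esub> q j i \<cdot> p i j) \<oplus>\<^bsub>A\<^esub> (\<Oplus>\<^bsub>A\<^esub>j\<in>{..<n}. q j i \<cdot> p i j)"
        if i: "i < n" for i
      proof -
        have "(\<Oplus>\<^bsub>A\<^esub>j\<in>{..<n}. p i j \<cdot> q j i) =
            (\<Oplus>\<^bsub>A\<^esub>j\<in>{..<n}. (p i j \<cdot> q j i \<ominus>\<^bsub>A\<^esub> q j i \<cdot> p i j) \<oplus>\<^bsub>A\<^esub> q j i \<cdot> p i j)"
          using pqc i by (intro M.finsum_cong' refl) (auto simp: a_minus_def M.a_assoc M.l_neg)
        then show ?thesis using pqc i by (simp add: M.finsum_addf Pi_def)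
      qed
      then have "(\<Oplus>\<^bsub>A\<^esub>i\<in>{..<n}. \<Oplus>\<^bsub>A\<^esub>j\<in>{..<n}. p i j \<cdot> q j i) =
          (\<Oplus>\<^bsub>A\<^esub>i\<in>{..<n}. (\<Oplus>\<^bsub>A\<^esub>j\<in>{..<n}. p i j \<cdot> q j i \<ominus>\<^bsub>A\<^esub> q j i \<cdot> p i j) \<oplus>\<^bsub>A\<^esub>
            (\<Oplus>\<^bsub>A\<^esub>j\<in>{..<n}. q j i \<cdot> p i j))"
        using pqc by (intro M.finsum_cong' refl) (auto intro!: M.finsum_closed M.a_closed)
      then show ?thesis using pqc by (simp add: M.finsum_addf Pi_def M.finsum_closed)
    qed
    ultimately have eq: "Tr (a \<cdot> b) = ?D \<oplus>\<^bsub>A\<^esub> Tr (b \<cdot> a)" by simp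
    have D: "?D \<in> span P"
      using corner_comm pq by (intro subspace_finsum[OF N2]) auto
    then have "?D \<in> carrier A" using subspaceD(1)[OF N2] by blast
    then have "Tr (a \<cdot> b) \<ominus>\<^bsub>A\<^esub> Tr (b \<cdot> a) = ?D"
      unfolding eq using Tr_closed[of "b \<cdot> a"] a b by (simp add: a_minus_def M.a_assoc M.r_neg)
    then show ?thesis using D by simp
  qed
  have Tr_K: "Tr a \<in> span P" if "a \<in> ?K" for a
  proof -
    have "subspace F {a \<in> carrier A. Tr a \<in> span P} A"
    proof (rule subspaceI)
      have "Tr (\<zero> \<bullet> \<zero>\<^bsub>A\<^esub>) = \<zero>\<^bsub>A\<^esub>" using Tr_closed by (subst Tr_smult) auto
      then show "\<zero>\<^bsub>A\<^esub> \<in> {a \<in> carrier A. Tr a \<in> span P}" using subspaceD(2)[OF N2] by simp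
    qed (use Tr_add Tr_smult subspaceD(3,4)[OF N2] in auto)
    moreover have "a \<cdot> b \<ominus>\<^bsub>A\<^esub> b \<cdot> a \<in> {a \<in> carrier A. Tr a \<in> span P}"
      if a: "a \<in> carrier A" and b: "b \<in> carrier A" for a b
    proof -
      have "(a \<cdot> b \<ominus>\<^bsub>A\<^esub> b \<cdot> a) \<oplus>\<^bsub>A\<^esub> b \<cdot> a = a \<cdot> b"
        using a b by (simp add: a_minus_def M.a_assoc M.l_neg)
      then have "Tr (a \<cdot> b) = Tr (a \<cdot> b \<ominus>\<^bsub>A\<^esub> b \<cdot> a) \<oplus>\<^bsub>A\<^esub> Tr (b \<cdot> a)"
        using Tr_add[of "a \<cdot> b \<ominus>\<^bsub>A\<^esub> b \<cdot> a" "b \<cdot> a"] a b by simp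
      then have "Tr (a \<cdot> b \<ominus>\<^bsub>A\<^esub> b \<cdot> a) = Tr (a \<cdot> b) \<ominus>\<^bsub>A\<^esub> Tr (b \<cdot> a)"
        using Tr_closed a b by (simp add: a_minus_def M.a_assoc M.r_neg)
      then show ?thesis using Tr_comm[OF a b] a b by simp
    qed
    ultimately have "?K \<subseteq> {a \<in> carrier A. Tr a \<in> span P}" by (rule commutator_subspace_least)
    then show ?thesis using that by blast
  qed
  \<comment> \<open>For \<open>r \<in> N \<subseteq> I \<subseteq> K(A)\<close> the value
    \<open>Tr r\<close> lies in \<open>N^2\<close>. A cyclic shift shows that
    \<open>Tr r - r\<close> does too, so \<open>r\<close> lies in \<open>N^2\<close>.\<close>
  have "N \<subseteq> span P"
  proof
    fix r assume r: "r \<in> N"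
    note rc = Nc[OF r] and rD = cornerD[OF NcE[OF r]]
    have ex: "e \<cdot> x' i \<in> corner e" if "i < n" for i
      by (rule principal_mult_corner[OF e_carrier e_principal(1) x'[OF that]])
    have "r \<in> principal_left e" using rc rD by (simp add: principal_left_def)
    then have yr: "y i \<cdot> r \<in> corner e" if "i < n" for i
      by (rule principal_mult_corner[OF e_carrier xy(2)[OF that]])
    have "r \<in> I"
    proof -
      have "\<pi> (u \<cdot> r \<cdot> v) = \<zero>"
        if u: "u \<in> principal_right e" and v: "v \<in> principal_left e" for u v
      proof -
        have uv: "u \<cdot> e \<in> corner e" "e \<cdot> v \<in> corner e"
          using u v e_principal e_carrier by (auto intro: principal_mult_corner)
        have "u \<cdot> r \<cdot> v = u \<cdot> (e \<cdot> (r \<cdot> e)) \<cdot> v" using rD by simp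
        also have "\<dots> = (u \<cdot> e) \<cdot> r \<cdot> (e \<cdot> v)"
          using R(1)[OF u] L(1)[OF v] rc e_carrier by (simp only: m_assoc m_closed)
        also have "\<dots> \<in> N" using N_right[OF N_left[OF r uv(1)] uv(2)] .
        finally show ?thesis using \<pi>_N by blast
      qed
      then show ?thesis using rc by (simp add: I_def)
    qed
    then have TrP: "Tr r \<in> span P" using IK Tr_K by blast
    \<comment> \<open>Writing \<open>r = r e\<close> puts an \<open>e\<close> in front of
      \<open>x'_i\<close>. Now both factors of each term lie in the corner, and shifting them costs
      only commutators of the corner.\<close>
    have "Tr r = (\<Oplus>\<^bsub>A\<^esub>i\<in>{..<n}. (y i \<cdot> r) \<cdot> (e \<cdot> x' i))"
      unfolding Tr_def
    proof (intro M.finsum_cong' refl)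
      fix i assume "i \<in> {..<n}"
      then have i: "i < n" by simp
      have "(y i \<cdot> r) \<cdot> (e \<cdot> x' i) = y i \<cdot> (r \<cdot> e) \<cdot> x' i"
        using xyc x'c i rc e_carrier by (simp only: m_assoc m_closed)
      then show "y i \<cdot> r \<cdot> x' i = (y i \<cdot> r) \<cdot> (e \<cdot> x' i)" using rD by simp
    qed (use xyc x'c rc e_carrier in auto)
    moreover have "\<dots> \<ominus>\<^bsub>A\<^esub> (\<Oplus>\<^bsub>A\<^esub>i\<in>{..<n}. (e \<cdot> x' i) \<cdot> (y i \<cdot> r)) \<in> span P"
      using xyc x'c rc e_carrier corner_comm[OF yr ex] by (intro sum_cyclic_shift[OF N2]) auto
    moreover have "(\<Oplus>\<^bsub>A\<^esub>i\<in>{..<n}. (e \<cdot> x' i) \<cdot> (y i \<cdot> r)) = r"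
    proof -
      have "(\<Oplus>\<^bsub>A\<^esub>i\<in>{..<n}. (e \<cdot> x' i) \<cdot> (y i \<cdot> r)) = (\<Oplus>\<^bsub>A\<^esub>i\<in>{..<n}. e \<cdot> (x' i \<cdot> y i) \<cdot> r)"
        using xyc x'c rc e_carrier by (intro M.finsum_cong' refl) (auto simp: m_assoc)
      also have "\<dots> = e \<cdot> (\<Oplus>\<^bsub>A\<^esub>i\<in>{..<n}. x' i \<cdot> y i) \<cdot> r"
        using xyc x'c rc e_carrier by (simp add: finsum_rdistr finsum_ldistr Pi_def)
      finally show ?thesis using one e_carrier rD by simp
    qed
    ultimately have "Tr r \<ominus>\<^bsub>A\<^esub> r \<in> span P" by simp
    then have "Tr r \<ominus>\<^bsub>A\<^esub> (Tr r \<ominus>\<^bsub>A\<^esub> r) \<in> span P" using subspace_minus[OF N2 TrP] by blast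
    moreover have "p \<ominus>\<^bsub>A\<^esub> (p \<ominus>\<^bsub>A\<^esub> q) = q" if "p \<in> carrier A" "q \<in> carrier A" for p q
      using that by algebra
    ultimately show "r \<in> span P" using Tr_closed[OF rc] rc by simp
  qed
  then have "N = {\<zero>\<^bsub>A\<^esub>}"
    using N_left NcE corner_nonunits_iff_nilpotent[OF prim]
    by (intro idempotent_nil_ideal_zero[OF N]) (auto simp: N_def P_def)
  then have scalar: "b = \<pi> b \<bullet> e" if "b \<in> corner e" for b
    using minus_zero_imp_eq[OF cornerD(1)[OF that] smult_closed[OF \<pi>_closed[OF that] e_carrier]]
      decomp[OF that] by simp
  have "full_split_idempotent e"
    unfolding full_split_idempotent_def
  proof (intro conjI ballI)
    show "\<exists>c\<in>carrier F. b = c \<bullet> e" if "b \<in> corner e" for b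
      using scalar[OF that] \<pi>_closed[OF that] by blast
    show "\<exists>n::nat. \<exists>x y. (\<forall>i<n. x i \<in> principal_left e \<and> y i \<in> principal_right e) \<and>
      (\<Oplus>\<^bsub>A\<^esub>i\<in>{..<n}. x i \<cdot> y i) = \<one>\<^bsub>A\<^esub>"
      using x' xy(2) one by blast
  qed (use eD in auto)
  then show ?thesis by blast
qed

end


section \<open>Right modules in a universe\<close>

context right_module
begin

lemma act_zero: "r \<in> carrier R \<Longrightarrow> r \<odot>\<^bsub>M\<^esub> \<zero>\<^bsub>M\<^esub> = \<zero>\<^bsub>M\<^esub>"
  using act_add_distr[of r "\<zero>\<^bsub>M\<^esub>" "\<zero>\<^bsub>M\<^esub>"] act_closed[of r "\<zero>\<^bsub>M\<^esub>"]
  by (metis M.add.r_cancel_one' M.l_zero M.zero_closed)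

lemma zero_act: "m \<in> carrier M \<Longrightarrow> \<zero> \<odot>\<^bsub>M\<^esub> m = \<zero>\<^bsub>M\<^esub>"
  using act_scalar_distr[of \<zero> \<zero> m] act_closed[of \<zero> m]
  by (metis M.add.r_cancel_one' R.l_zero R.zero_closed)

lemma uminus_act:
  assumes "r \<in> carrier R" "m \<in> carrier M"
  shows "(\<ominus> r) \<odot>\<^bsub>M\<^esub> m = \<ominus>\<^bsub>M\<^esub> (r \<odot>\<^bsub>M\<^esub> m)"
proof -
  have "(\<ominus> r) \<odot>\<^bsub>M\<^esub> m \<oplus>\<^bsub>M\<^esub> r \<odot>\<^bsub>M\<^esub> m = \<zero>\<^bsub>M\<^esub>"
    using act_scalar_distr[of "\<ominus> r" r m] assms by (simp add: R.l_neg zero_act)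
  then show ?thesis using assms act_closed by (simp add: M.minus_equality)
qed

end

lemma right_moduleI:
  assumes "ring R" "abelian_group M"
    and "\<And>r m. r \<in> carrier R \<Longrightarrow> m \<in> carrier M \<Longrightarrow> r \<odot>\<^bsub>M\<^esub> m \<in> carrier M"
    and "\<And>r s m. r \<in> carrier R \<Longrightarrow> s \<in> carrier R \<Longrightarrow> m \<in> carrier M \<Longrightarrow>
      (r \<oplus>\<^bsub>R\<^esub> s) \<odot>\<^bsub>M\<^esub> m = r \<odot>\<^bsub>M\<^esub> m \<oplus>\<^bsub>M\<^esub> s \<odot>\<^bsub>M\<^esub> m"
    and "\<And>r m n. r \<in> carrier R \<Longrightarrow> m \<in> carrier M \<Longrightarrow> n \<in> carrier M \<Longrightarrow>
      r \<odot>\<^bsub>M\<^esub> (m \<oplus>\<^bsub>M\<^esub> n) = r \<odot>\<^bsub>M\<^esub> m \<oplus>\<^bsub>M\<^esub> r \<odot>\<^bsub>M\<^esub> n"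
    and "\<And>r s m. r \<in> carrier R \<Longrightarrow> s \<in> carrier R \<Longrightarrow> m \<in> carrier M \<Longrightarrow>
      (r \<otimes>\<^bsub>R\<^esub> s) \<odot>\<^bsub>M\<^esub> m = s \<odot>\<^bsub>M\<^esub> (r \<odot>\<^bsub>M\<^esub> m)"
    and "\<And>m. m \<in> carrier M \<Longrightarrow> \<one>\<^bsub>R\<^esub> \<odot>\<^bsub>M\<^esub> m = m"
  shows "right_module R M"
  using assms by (intro right_module.intro right_module_axioms.intro) auto

lemma right_homI:
  assumes "f \<in> extensional (carrier M)" "\<And>x. x \<in> carrier M \<Longrightarrow> f x \<in> carrier N"
    and "\<And>x y. x \<in> carrier M \<Longrightarrow> y \<in> carrier M \<Longrightarrow> f (x \<oplus>\<^bsub>M\<^esub> y) = f x \<oplus>\<^bsub>N\<^esub> f y"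
    and "\<And>r x. r \<in> carrier R \<Longrightarrow> x \<in> carrier M \<Longrightarrow> f (r \<odot>\<^bsub>M\<^esub> x) = r \<odot>\<^bsub>N\<^esub> f x"
  shows "f \<in> right_hom R M N"
  using assms by (auto simp: right_hom_def module_hom_def)

lemma right_homD:
  assumes "f \<in> right_hom R M N"
  shows "f \<in> extensional (carrier M)" "\<And>x. x \<in> carrier M \<Longrightarrow> f x \<in> carrier N"
    "\<And>x y. x \<in> carrier M \<Longrightarrow> y \<in> carrier M \<Longrightarrow> f (x \<oplus>\<^bsub>M\<^esub> y) = f x \<oplus>\<^bsub>N\<^esub> f y"
    "\<And>r x. r \<in> carrier R \<Longrightarrow> x \<in> carrier M \<Longrightarrow> f (r \<odot>\<^bsub>M\<^esub> x) = r \<odot>\<^bsub>N\<^esub> f x"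
  using assms by (auto simp: right_hom_def module_hom_def)

lemma right_hom_eqI:
  assumes "f \<in> right_hom R M N" "g \<in> right_hom R M N" "\<And>x. x \<in> carrier M \<Longrightarrow> f x = g x"
  shows "f = g"
  using assms right_homD(1) by (blast intro: extensionalityI)

text \<open>The operations are independent of the representatives chosen by \<^const>\<open>inv_into\<close> only
  under the assumptions of \<open>module_congruence\<close> below.\<close>

definition transport :: "('u \<Rightarrow> 'v) \<Rightarrow> ('a, 'u, 'n) module_scheme \<Rightarrow> ('a, 'v) module" where
  "transport \<phi> M =
    \<lparr>carrier = \<phi> ` carrier M, mult = (\<lambda>_ _. \<phi> \<zero>\<^bsub>M\<^esub>), one = \<phi> \<zero>\<^bsub>M\<^esub>, zero = \<phi> \<zero>\<^bsub>M\<^esub>,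
     add = (\<lambda>p q. \<phi> (inv_into (carrier M) \<phi> p \<oplus>\<^bsub>M\<^esub> inv_into (carrier M) \<phi> q)),
     smult = (\<lambda>r p. \<phi> (r \<odot>\<^bsub>M\<^esub> inv_into (carrier M) \<phi> p))\<rparr>"

text \<open>\<open>\<phi>\<close> may identify elements, as long as the operations respect this. An
  injective \<open>\<phi>\<close> gives a copy of \<open>M\<close> in another type, a general one
  gives a coded quotient.\<close>

locale module_congruence = right_module R M
  for R :: "('a, 'm) ring_scheme" (structure) and M :: "('a, 'u, 'n) module_scheme" (structure) +
  fixes \<phi> :: "'u \<Rightarrow> 'v"
  assumes cong_add: "\<lbrakk>x \<in> carrier M; x' \<in> carrier M; y \<in> carrier M; y' \<in> carrier M;
      \<phi> x = \<phi> x'; \<phi> y = \<phi> y'\<rbrakk> \<Longrightarrow> \<phi> (x \<oplus>\<^bsub>M\<^esub> y) = \<phi> (x' \<oplus>\<^bsub>M\<^esub> y')"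
    and cong_act: "\<lbrakk>r \<in> carrier R; x \<in> carrier M; x' \<in> carrier M; \<phi> x = \<phi> x'\<rbrakk>
      \<Longrightarrow> \<phi> (r \<odot>\<^bsub>M\<^esub> x) = \<phi> (r \<odot>\<^bsub>M\<^esub> x')"
begin

lemma transport_carrier: "carrier (transport \<phi> M) = \<phi> ` carrier M"
  by (simp add: transport_def)

lemma transport_zero: "\<zero>\<^bsub>transport \<phi> M\<^esub> = \<phi> \<zero>\<^bsub>M\<^esub>"
  by (simp add: transport_def)

lemma inv_into_mem: "x \<in> carrier M \<Longrightarrow> inv_into (carrier M) \<phi> (\<phi> x) \<in> carrier M"
  by (simp add: inv_into_into)

lemma inv_into_eq: "x \<in> carrier M \<Longrightarrow> \<phi> (inv_into (carrier M) \<phi> (\<phi> x)) = \<phi> x"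
  by (simp add: f_inv_into_f)

lemma transport_add:
  "x \<in> carrier M \<Longrightarrow> y \<in> carrier M \<Longrightarrow> \<phi> x \<oplus>\<^bsub>transport \<phi> M\<^esub> \<phi> y = \<phi> (x \<oplus>\<^bsub>M\<^esub> y)"
  unfolding transport_def by (simp, intro cong_add) (auto simp: inv_into_mem inv_into_eq)

lemma transport_act:
  "r \<in> carrier R \<Longrightarrow> x \<in> carrier M \<Longrightarrow> r \<odot>\<^bsub>transport \<phi> M\<^esub> \<phi> x = \<phi> (r \<odot>\<^bsub>M\<^esub> x)"
  unfolding transport_def by (simp, intro cong_act) (auto simp: inv_into_mem inv_into_eq)

lemma transport_module: "right_module R (transport \<phi> M)"
proof (rule right_moduleI)
  note laws = transport_carrier transport_zero transport_add transport_act act_closed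
  show "abelian_group (transport \<phi> M)"
  proof (rule abelian_groupI)
    fix p assume "p \<in> carrier (transport \<phi> M)"
    then obtain x where x: "x \<in> carrier M" "p = \<phi> x" by (auto simp: laws)
    then show "\<exists>q\<in>carrier (transport \<phi> M). q \<oplus>\<^bsub>transport \<phi> M\<^esub> p = \<zero>\<^bsub>transport \<phi> M\<^esub>"
      by (intro bexI[of _ "\<phi> (\<ominus>\<^bsub>M\<^esub> x)"]) (auto simp: laws M.l_neg)
  qed (auto simp: laws M.a_assoc M.a_comm M.a_lcomm)
  show "ring R" by unfold_locales
qed (auto simp: transport_carrier transport_zero transport_add transport_act act_closed
    act_scalar_distr act_add_distr act_assoc act_one)

end

lemma (in right_module) inj_module_congruence:
  assumes "inj_on \<phi> (carrier M)"
  shows "module_congruence R M \<phi>"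
  using assms by unfold_locales (auto simp: inj_on_eq_iff)

section \<open>Right ideals as modules, and their quotients inside a universe\<close>

context ring
begin

definition right_ideal_module :: "'a set \<Rightarrow> ('a, 'a) module" where
  "right_ideal_module Y = \<lparr>carrier = Y, mult = mult R, one = one R, zero = zero R, add = add R,
    smult = (\<lambda>a x. x \<otimes> a)\<rparr>"

lemma right_ideal_module_simps [simp]:
  "carrier (right_ideal_module Y) = Y" "zero (right_ideal_module Y) = \<zero>"
  "add (right_ideal_module Y) = add R" "a \<odot>\<^bsub>right_ideal_module Y\<^esub> x = x \<otimes> a"
  by (auto simp: right_ideal_module_def)

lemma right_ideal_module:
  assumes Y: "Y \<subseteq> carrier R" "\<zero> \<in> Y" "\<And>x y. x \<in> Y \<Longrightarrow> y \<in> Y \<Longrightarrow> x \<oplus> y \<in> Y"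
    and act: "\<And>x a. x \<in> Y \<Longrightarrow> a \<in> carrier R \<Longrightarrow> x \<otimes> a \<in> Y"
  shows "right_module R (right_ideal_module Y)"
proof (rule right_moduleI)
  note c = subsetD[OF Y(1)]
  show "abelian_group (right_ideal_module Y)"
  proof (rule abelian_groupI)
    fix x assume "x \<in> carrier (right_ideal_module Y)"
    then have x: "x \<in> Y" by simp
    \<comment> \<open>Negatives come from acting by \<open>-1\<close>; the closure assumptions on
      \<open>Y\<close> speak of sums and the action.\<close>
    have "x \<otimes> (\<ominus> \<one>) \<oplus> x = \<zero>" using c[OF x] by (simp add: r_minus l_neg)
    then show "\<exists>y\<in>carrier (right_ideal_module Y).
        y \<oplus>\<^bsub>right_ideal_module Y\<^esub> x = \<zero>\<^bsub>right_ideal_module Y\<^esub>"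
      using act[OF x, of "\<ominus> \<one>"] by auto
  qed (use Y c in \<open>auto simp: a_assoc a_comm a_lcomm\<close>)
qed (use Y act subsetD[OF Y(1)] in \<open>auto simp: r_distr l_distr m_assoc ring_axioms\<close>)

end

text \<open>A coset of \<open>Z\<close> is represented by a chosen element, which is then sent into
  the universe by \<open>g\<close>. The cosets themselves are sets of elements, and an injection on
  \<open>R\<close> does not place these in the type \<open>'u\<close>.\<close>

definition class_code :: "('a, 'm) ring_scheme \<Rightarrow> 'a set \<Rightarrow> ('a \<Rightarrow> 'u) \<Rightarrow> 'a \<Rightarrow> 'u" where
  "class_code R Z g x = g (SOME y. y \<in> carrier R \<and> x \<ominus>\<^bsub>R\<^esub> y \<in> Z)"

text \<open>Congruent elements have the same set of possible representatives, so \<open>SOME\<close>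
  returns the same one. Conversely, by injectivity of \<open>g\<close>, equal codes mean a common
  representative.\<close>

lemma (in ring) class_code_eq_iff:
  assumes g: "inj_on g (carrier R)" and Z: "\<zero> \<in> Z" "Z \<subseteq> carrier R"
    "\<And>x y. x \<in> Z \<Longrightarrow> y \<in> Z \<Longrightarrow> x \<ominus> y \<in> Z"
    and x: "x \<in> carrier R" and y: "y \<in> carrier R"
  shows "class_code R Z g x = class_code R Z g y \<longleftrightarrow> x \<ominus> y \<in> Z"
proof -
  define rep where "rep x = (SOME y. y \<in> carrier R \<and> x \<ominus> y \<in> Z)" for x
  have rep: "rep x \<in> carrier R \<and> x \<ominus> rep x \<in> Z" if "x \<in> carrier R" for x
    unfolding rep_def by (rule someI[of _ x]) (use that Z in \<open>auto simp: a_minus_def r_neg\<close>)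
  have alg: "p \<ominus> q = (p \<ominus> r) \<ominus> (q \<ominus> r)" "p \<ominus> q = (p \<ominus> r) \<ominus> (\<zero> \<ominus> (r \<ominus> q))"
    if "p \<in> carrier R" "q \<in> carrier R" "r \<in> carrier R" for p q r
    using that by (algebra, algebra)
  have trans: "p \<ominus> q \<in> Z" if "p \<ominus> r \<in> Z" "q \<ominus> r \<in> Z" "p \<in> carrier R" "q \<in> carrier R" "r \<in> carrier R"
    for p q r
    using Z(3)[OF that(1,2)] alg(1)[OF that(3-5)] by simp
  have trans': "p \<ominus> q \<in> Z"
    if "p \<ominus> r \<in> Z" "r \<ominus> q \<in> Z" "p \<in> carrier R" "q \<in> carrier R" "r \<in> carrier R" for p q r
    using Z(3)[OF that(1) Z(3)[OF Z(1) that(2)]] alg(2)[OF that(3-5)] by simp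
  show ?thesis
  proof
    assume "class_code R Z g x = class_code R Z g y"
    then have "g (rep x) = g (rep y)" by (simp add: class_code_def rep_def)
    then have "rep x = rep y" using g rep x y by (auto dest: inj_onD)
    then show "x \<ominus> y \<in> Z" using trans[of x "rep x" y] rep[OF x] rep[OF y] x y by simp
  next
    assume xy: "x \<ominus> y \<in> Z"
    have "y \<ominus> x \<in> Z" using trans[of y y x] xy x y Z(1) by (simp add: a_minus_def r_neg)
    then have "x \<ominus> r \<in> Z \<longleftrightarrow> y \<ominus> r \<in> Z" if "r \<in> carrier R" for r
      using trans' xy x y that by blast
    then have "(\<lambda>r. r \<in> carrier R \<and> x \<ominus> r \<in> Z) = (\<lambda>r. r \<in> carrier R \<and> y \<ominus> r \<in> Z)" by auto
    then show "class_code R Z g x = class_code R Z g y" by (simp add: class_code_def)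
  qed
qed

lemma (in ring) class_code_congruence:
  assumes g: "inj_on g (carrier R)" and Z: "\<zero> \<in> Z" "Z \<subseteq> carrier R"
    "\<And>x y. x \<in> Z \<Longrightarrow> y \<in> Z \<Longrightarrow> x \<ominus> y \<in> Z" "\<And>x a. x \<in> Z \<Longrightarrow> a \<in> carrier R \<Longrightarrow> x \<otimes> a \<in> Z"
    and Y: "Y \<subseteq> carrier R" "\<zero> \<in> Y" "\<And>x y. x \<in> Y \<Longrightarrow> y \<in> Y \<Longrightarrow> x \<oplus> y \<in> Y"
      "\<And>x a. x \<in> Y \<Longrightarrow> a \<in> carrier R \<Longrightarrow> x \<otimes> a \<in> Y"
  shows "module_congruence R (right_ideal_module Y) (class_code R Z g)"
proof -
  let ?M = "right_ideal_module Y" and ?\<phi> = "class_code R Z g"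
  interpret M: right_module R ?M by (rule right_ideal_module[OF Y])
  have eq: "?\<phi> x = ?\<phi> y \<longleftrightarrow> x \<ominus> y \<in> Z" if "x \<in> Y" "y \<in> Y" for x y
    using that Y(1) by (intro class_code_eq_iff[OF g Z(1-3)]) auto
  note Yc = subsetD[OF Y(1)]
  show ?thesis
  proof
    fix x x' y y' assume "x \<in> carrier ?M" "x' \<in> carrier ?M" "y \<in> carrier ?M" "y' \<in> carrier ?M"
      "?\<phi> x = ?\<phi> x'" "?\<phi> y = ?\<phi> y'"
    then have m: "x \<in> Y" "x' \<in> Y" "y \<in> Y" "y' \<in> Y" and d: "x \<ominus> x' \<in> Z" "y \<ominus> y' \<in> Z"
      by (simp_all add: eq)
    have alg: "(p \<oplus> q) \<ominus> (r \<oplus> s) = (p \<ominus> r) \<ominus> (\<zero> \<ominus> (q \<ominus> s))"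
      if "p \<in> carrier R" "q \<in> carrier R" "r \<in> carrier R" "s \<in> carrier R" for p q r s
      using that zero_closed by algebra
    have "(x \<oplus> y) \<ominus> (x' \<oplus> y') \<in> Z"
      unfolding alg[OF Yc[OF m(1)] Yc[OF m(3)] Yc[OF m(2)] Yc[OF m(4)]]
      using Z(3)[OF d(1) Z(3)[OF Z(1) d(2)]] .
    then show "?\<phi> (x \<oplus>\<^bsub>?M\<^esub> y) = ?\<phi> (x' \<oplus>\<^bsub>?M\<^esub> y')"
      using m Y(3) by (simp add: eq)
  next
    fix a x x' assume "a \<in> carrier R" "x \<in> carrier ?M" "x' \<in> carrier ?M" "?\<phi> x = ?\<phi> x'"
    then have m: "x \<in> Y" "x' \<in> Y" "a \<in> carrier R" and d: "x \<ominus> x' \<in> Z" by (simp_all add: eq)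
    have "x \<otimes> a \<ominus> x' \<otimes> a = (x \<ominus> x') \<otimes> a"
      using Yc[OF m(1)] Yc[OF m(2)] m(3) by (simp add: a_minus_def l_distr l_minus)
    then show "?\<phi> (a \<odot>\<^bsub>?M\<^esub> x) = ?\<phi> (a \<odot>\<^bsub>?M\<^esub> x')"
      using m Z(4)[OF d m(3)] Y(4) by (simp add: eq)
  qed
qed

text \<open>The simple module \<open>e A / Z\<close>, where \<open>Z\<close> is the largest proper submodule of \<open>e A\<close>, has
  endomorphism ring \<open>e A e / rad (e A e)\<close>.\<close>

lemma (in fin_dim_algebra) splitting_field_local_split:
  fixes U :: "'u itself"
  assumes split: "splitting_field U F A" and univ: "adequate_universe U (carrier A)"
    and e: "primitive_idempotent e" and b: "b \<in> corner e"
  shows "\<exists>c\<in>carrier F. b \<ominus>\<^bsub>A\<^esub> c \<bullet> e \<in> corner_nonunits e"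
proof -
  note eD = primitive_idempotentD[OF e] and R = principal_rightD
  define N where "N = corner_nonunits e"
  define Y where "Y = principal_right e"
  \<comment> \<open>An element \<open>y\<close> of \<open>e A\<close> generates \<open>e A\<close>
    iff some \<open>y a e\<close> is a unit of the corner; \<open>Z\<close> consists of the elements
    that do not generate.\<close>
  define Z where "Z = {y \<in> Y. \<forall>a\<in>carrier A. y \<cdot> a \<cdot> e \<in> N}"
  obtain g :: "'c \<Rightarrow> 'u" where g: "inj_on g (carrier A)"
    using univ by (auto simp: adequate_universe_def)
  define \<phi> where "\<phi> = class_code A Z g"
  have Yc: "y \<in> carrier A" if "y \<in> Y" for y using that R(1) by (simp add: Y_def)
  have Ysub: "subspace F Y A" unfolding Y_def by (rule subspace_principal_right[OF eD(2)])
  have Nc: "n \<in> carrier A" if "n \<in> N" for n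
    using that corner_nonunits_carrier[OF e] by (simp add: N_def)
  have Nadd: "n \<oplus>\<^bsub>A\<^esub> n' \<in> N" if "n \<in> N" "n' \<in> N" for n n'
    using that corner_nonunits_add[OF e] by (simp add: N_def)
  have Nleft: "c \<cdot> n \<in> N" if "n \<in> N" "c \<in> corner e" for n c
    using that corner_nonunits_mult_left[OF e] by (simp add: N_def)
  have Nminus: "n \<ominus>\<^bsub>A\<^esub> n' \<in> N" if "n \<in> N" "n' \<in> N" for n n'
  proof -
    have n': "n' \<in> corner e" using that corner_nonunits_corner[OF e] by (simp add: N_def)
    have "\<ominus>\<^bsub>A\<^esub> e \<in> corner e"
      using eD by (simp add: corner_def r_minus l_minus)
    then have "(\<ominus>\<^bsub>A\<^esub> e) \<cdot> n' \<in> N" using Nleft that by blast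
    moreover have "(\<ominus>\<^bsub>A\<^esub> e) \<cdot> n' = \<ominus>\<^bsub>A\<^esub> n'"
      using eD(2) cornerD[OF n'] by (simp add: l_minus)
    ultimately show ?thesis using Nadd that(1) by (simp add: a_minus_def)
  qed
  have eN: "e \<notin> N" unfolding N_def by (rule idempotent_not_nonunit[OF e])
  have N0: "\<zero>\<^bsub>A\<^esub> \<in> N"
  proof -
    have "\<zero>\<^bsub>A\<^esub> [^]\<^bsub>A\<^esub> (1::nat) = \<zero>\<^bsub>A\<^esub>" by simp
    then show ?thesis unfolding N_def corner_nonunits_iff_nilpotent[OF e] using eD(2)
      by (auto simp: corner_def intro!: exI[of _ "1::nat"])
  qed
  have Z_minus: "x \<ominus>\<^bsub>A\<^esub> y \<in> Z" if "x \<in> Z" "y \<in> Z" for x y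
  proof -
    have xy: "x \<in> Y" "y \<in> Y" using that by (auto simp: Z_def)
    have "(x \<ominus>\<^bsub>A\<^esub> y) \<cdot> a \<cdot> e = x \<cdot> a \<cdot> e \<ominus>\<^bsub>A\<^esub> y \<cdot> a \<cdot> e"
      if "a \<in> carrier A" for a
      using that Yc[OF xy(1)] Yc[OF xy(2)] eD(2) by (simp add: a_minus_def l_distr l_minus)
    then show ?thesis using that Nminus subspace_minus[OF Ysub xy] by (simp add: Z_def)
  qed
  have Z0: "\<zero>\<^bsub>A\<^esub> \<in> Z" using N0 subspaceD(2)[OF Ysub] eD(2) by (simp add: Z_def)
  have Zc: "Z \<subseteq> carrier A" using Yc by (auto simp: Z_def)
  have \<phi>_eq: "\<phi> x = \<phi> y \<longleftrightarrow> x \<ominus>\<^bsub>A\<^esub> y \<in> Z" if "x \<in> Y" "y \<in> Y" for x y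
    unfolding \<phi>_def using that Yc
    by (intro class_code_eq_iff[OF g Z0 Zc Z_minus])
  have Z_right: "z \<cdot> a \<in> Z" if z: "z \<in> Z" and a: "a \<in> carrier A" for z a
  proof -
    have zY: "z \<in> Y" using z by (simp add: Z_def)
    have "z \<cdot> a \<cdot> a' \<cdot> e \<in> N" if a': "a' \<in> carrier A" for a'
    proof -
      have "z \<cdot> (a \<cdot> a') \<cdot> e \<in> N" using z a a' by (simp add: Z_def)
      then show ?thesis using Yc[OF zY] a a' by (simp add: m_assoc)
    qed
    then show ?thesis using principal_right_mult[OF eD(2) _ a] zY by (simp add: Z_def Y_def)
  qed
  \<comment> \<open>This lets left multiplication by an element of the corner descend to the
    quotient.\<close>
  have Z_left: "c \<cdot> z \<in> Z" if z: "z \<in> Z" and c: "c \<in> corner e" for z c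
  proof -
    have zY: "z \<in> Y" using z by (simp add: Z_def)
    note cc = cornerD[OF c]
    have "c \<cdot> z \<cdot> a \<cdot> e = c \<cdot> (z \<cdot> a \<cdot> e)" if "a \<in> carrier A" for a
      using that Yc[OF zY] cc(1) eD(2) by (simp add: m_assoc)
    moreover have "c \<cdot> z \<in> Y"
      using principal_right_mult[OF eD(2), of c z] c Yc[OF zY]
      by (simp add: Y_def corner_principal)
    ultimately show ?thesis using z Nleft[OF _ c] by (simp add: Z_def)
  qed
  have Y_right: "y \<cdot> a \<in> Y" if "y \<in> Y" "a \<in> carrier A" for y a
    using that principal_right_mult[OF eD(2)] by (simp add: Y_def)
  have eY: "e \<in> Y" using eD by (simp add: Y_def principal_right_def)
  interpret YM: right_module A "right_ideal_module Y"
    using subspaceD(1-3)[OF Ysub] Y_right by (intro right_ideal_module)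
  interpret Q: module_congruence A "right_ideal_module Y" \<phi>
    unfolding \<phi>_def using subspaceD(1-3)[OF Ysub] Y_right
    by (intro class_code_congruence[OF g Z0 Zc Z_minus Z_right])
  define S where "S = transport \<phi> (right_ideal_module Y)"
  have S_carrier: "carrier S = \<phi> ` Y" and S_zero: "\<zero>\<^bsub>S\<^esub> = \<phi> \<zero>\<^bsub>A\<^esub>"
    by (auto simp: S_def Q.transport_carrier Q.transport_zero)
  have S_add: "\<phi> x \<oplus>\<^bsub>S\<^esub> \<phi> y = \<phi> (x \<oplus>\<^bsub>A\<^esub> y)" if "x \<in> Y" "y \<in> Y" for x y
    using that Q.transport_add[of x y] by (simp add: S_def)
  have S_act: "a \<odot>\<^bsub>S\<^esub> \<phi> x = \<phi> (x \<cdot> a)" if "x \<in> Y" "a \<in> carrier A" for x a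
    using that Q.transport_act[of a x] by (simp add: S_def)
  have S_module: "right_module A S" unfolding S_def by (rule Q.transport_module)
  have \<phi>_zero: "\<phi> y = \<zero>\<^bsub>S\<^esub> \<longleftrightarrow> y \<in> Z" if "y \<in> Y" for y
    using \<phi>_eq[OF that subspaceD(2)[OF Ysub]] Yc[OF that]
    by (simp add: S_zero a_minus_def M.minus_equality[of "\<zero>\<^bsub>A\<^esub>" "\<zero>\<^bsub>A\<^esub>"])
  have "simple_right_module A S"
    unfolding simple_right_module_def
  proof (intro conjI allI impI S_module)
    have "e \<cdot> \<one>\<^bsub>A\<^esub> \<cdot> e \<notin> N" using eN eD by simp
    then have "e \<notin> Z" unfolding Z_def by blast
    then show "carrier S \<noteq> {\<zero>\<^bsub>S\<^esub>}" using \<phi>_zero[OF eY] eY S_carrier by blast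
    fix P assume P: "right_submodule A P S"
    have P_sub: "P \<subseteq> carrier S" and P_zero: "\<zero>\<^bsub>S\<^esub> \<in> P"
      and P_act: "\<And>a p. a \<in> carrier A \<Longrightarrow> p \<in> P \<Longrightarrow> a \<odot>\<^bsub>S\<^esub> p \<in> P"
      using P by (auto simp: right_submodule_def)
    show "P = {\<zero>\<^bsub>S\<^esub>} \<or> P = carrier S"
    proof (rule disjCI)
      assume "P \<noteq> carrier S"
      have "p = \<zero>\<^bsub>S\<^esub>" if "p \<in> P" for p
      proof (rule ccontr)
        assume "p \<noteq> \<zero>\<^bsub>S\<^esub>"
        obtain y where y: "y \<in> Y" "p = \<phi> y"
          using subsetD[OF P_sub \<open>p \<in> P\<close>] unfolding S_carrier by auto
        then have "y \<notin> Z" using \<phi>_zero[OF y(1)] \<open>p \<noteq> \<zero>\<^bsub>S\<^esub>\<close> by simp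
        then obtain a where a: "a \<in> carrier A" "y \<cdot> a \<cdot> e \<notin> N" using y by (auto simp: Z_def)
        have "y \<cdot> a \<cdot> e \<in> corner e"
          using y a eD by (intro principal_sandwich_corner)
            (auto simp: Y_def principal_left_def)
        \<comment> \<open>Thus \<open>e\<close> lies in \<open>y A\<close>, and every
          \<open>x = e x\<close> of \<open>e A\<close> is a multiple of \<open>y\<close>.\<close>
        then obtain c where c: "c \<in> corner e" "y \<cdot> a \<cdot> e \<cdot> c = e"
          using a(2) unfolding N_def corner_nonunits_def by blast
        note cc = cornerD(1)[OF c(1)]
        have "\<phi> x \<in> P" if x: "x \<in> Y" for x
        proof -
          have "y \<cdot> (a \<cdot> e \<cdot> c \<cdot> x) = (y \<cdot> a \<cdot> e \<cdot> c) \<cdot> x"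
            using Yc[OF x] Yc[OF y(1)] a(1) cc eD(2) by (simp add: m_assoc)
          also have "\<dots> = x" using c(2) x R(2) by (simp add: Y_def)
          finally have "(a \<cdot> e \<cdot> c \<cdot> x) \<odot>\<^bsub>S\<^esub> p = \<phi> x"
            unfolding y(2) using Yc[OF x] y(1) a(1) cc eD(2) by (subst S_act) auto
          moreover have "a \<cdot> e \<cdot> c \<cdot> x \<in> carrier A" using Yc[OF x] a(1) cc eD(2) by simp
          ultimately show ?thesis using P_act[OF _ \<open>p \<in> P\<close>] by metis
        qed
        then have "carrier S \<subseteq> P" unfolding S_carrier by (rule image_subsetI)
        then show False using \<open>P \<noteq> carrier S\<close> P_sub by simp
      qed
      then show "P = {\<zero>\<^bsub>S\<^esub>}" using P_zero by blast
    qed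
  qed
  then have bij: "bij_betw (\<lambda>c. hom_scale A S S c (hom_id S)) (carrier F) (right_hom A S S)"
    using split by (simp add: splitting_field_def)
  note bc = cornerD[OF b]
  \<comment> \<open>Left multiplication by \<open>b\<close> on the quotient. By the splitting
    hypothesis it is a scalar \<open>c\<close>, and evaluating at the class of \<open>e\<close>
    compares \<open>b\<close> with \<open>c e\<close> modulo \<open>Z\<close>.\<close>
  define f where "f = (\<lambda>p\<in>carrier S. \<phi> (b \<cdot> inv_into Y \<phi> p))"
  have bY: "b \<cdot> y \<in> Y" if "y \<in> Y" for y
    using principal_right_mult[OF eD(2), of b y] b Yc[OF that]
    by (simp add: Y_def corner_principal)
  have f: "f (\<phi> y) = \<phi> (b \<cdot> y)" if y: "y \<in> Y" for y
  proof -
    let ?y = "inv_into Y \<phi> (\<phi> y)"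
    have y': "?y \<in> Y" "\<phi> ?y = \<phi> y" using y by (auto intro: inv_into_into f_inv_into_f)
    then have "b \<cdot> (?y \<ominus>\<^bsub>A\<^esub> y) \<in> Z" using Z_left[OF _ b] \<phi>_eq[OF y'(1) y] by simp
    moreover have "b \<cdot> (?y \<ominus>\<^bsub>A\<^esub> y) = b \<cdot> ?y \<ominus>\<^bsub>A\<^esub> b \<cdot> y"
      using bc(1) Yc[OF y] Yc[OF y'(1)] by (simp add: a_minus_def r_distr r_minus)
    ultimately have "\<phi> (b \<cdot> ?y) = \<phi> (b \<cdot> y)" using \<phi>_eq[OF bY[OF y'(1)] bY[OF y]] by simp
    then show ?thesis using y by (simp add: f_def S_carrier)
  qed
  have "f \<in> right_hom A S S"
  proof (rule right_homI)
    show "f \<in> extensional (carrier S)" by (simp add: f_def)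
    fix p assume "p \<in> carrier S"
    then obtain x where x: "x \<in> Y" "p = \<phi> x" by (auto simp: S_carrier)
    then show "f p \<in> carrier S" using f bY by (simp add: S_carrier)
    {
      fix a assume a: "a \<in> carrier A"
      show "f (a \<odot>\<^bsub>S\<^esub> p) = a \<odot>\<^bsub>S\<^esub> f p"
        using x a f bY Y_right Yc bc(1) by (simp add: S_act m_assoc)
    }
    fix q assume "q \<in> carrier S"
    then obtain y where y: "y \<in> Y" "q = \<phi> y" by (auto simp: S_carrier)
    show "f (p \<oplus>\<^bsub>S\<^esub> q) = f p \<oplus>\<^bsub>S\<^esub> f q"
      using x y f bY subspaceD(3)[OF Ysub] Yc bc(1) by (simp add: S_add r_distr)
  qed
  then obtain c where c: "c \<in> carrier F" "f = hom_scale A S S c (hom_id S)"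
    using bij unfolding bij_betw_def by blast
  have ce: "c \<bullet> e \<in> Y" using subspaceD(4)[OF Ysub c(1) eY] .
  have "f (\<phi> e) = (c \<bullet> \<one>\<^bsub>A\<^esub>) \<odot>\<^bsub>S\<^esub> \<phi> e"
    using c eY by (simp add: hom_scale_def hom_id_def S_carrier)
  also have "\<dots> = \<phi> (c \<bullet> e)" using c eY eD(2) by (simp add: S_act smult_mult_right)
  finally have "\<phi> b = \<phi> (c \<bullet> e)" using f[OF eY] bc(3) by simp
  moreover have "b \<in> Y" using b by (simp add: Y_def corner_principal)
  ultimately have "b \<ominus>\<^bsub>A\<^esub> c \<bullet> e \<in> Z" using \<phi>_eq ce by blast
  then have "(b \<ominus>\<^bsub>A\<^esub> c \<bullet> e) \<cdot> \<one>\<^bsub>A\<^esub> \<cdot> e \<in> N" unfolding Z_def by blast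
  moreover have "(b \<ominus>\<^bsub>A\<^esub> c \<bullet> e) \<cdot> \<one>\<^bsub>A\<^esub> \<cdot> e = b \<ominus>\<^bsub>A\<^esub> c \<bullet> e"
    using c(1) eD(2,3) bc(1,3)
    by (simp add: a_minus_def l_distr l_minus smult_mult_left)
  ultimately show ?thesis using c(1) by (auto simp: N_def)
qed


section \<open>The equivalence given by a full idempotent\<close>

text \<open>An infinite set is in bijection with its square, and such a pairing function is
  iterated. For length zero any function will do.\<close>

lemma fixed_length_list_code:
  assumes "infinite (UNIV :: 'u set)"
  shows "\<exists>code :: 'u list \<Rightarrow> 'u. inj_on code {xs. length xs = n}"
proof -
  obtain p :: "'u \<times> 'u \<Rightarrow> 'u" where "bij_betw p (UNIV \<times> UNIV) UNIV"
    using card_of_Times_same_infinite[OF assms, folded card_of_ordIso] by blast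
  then have p: "inj p" by (simp add: bij_betw_def)
  show ?thesis
  proof (induction n)
    case 0
    show ?case by (simp add: inj_on_def)
  next
    case (Suc n)
    then obtain code :: "'u list \<Rightarrow> 'u" where code: "inj_on code {xs. length xs = n}" by blast
    have "inj_on (\<lambda>xs. p (hd xs, code (tl xs))) {xs. length xs = Suc n}"
    proof (rule inj_onI)
      fix xs ys :: "'u list"
      assume "xs \<in> {xs. length xs = Suc n}" "ys \<in> {xs. length xs = Suc n}"
        and eq: "p (hd xs, code (tl xs)) = p (hd ys, code (tl ys))"
      then obtain a as b bs where "xs = a # as" "ys = b # bs" "length as = n" "length bs = n"
        by (auto simp: length_Suc_conv)
      then show "xs = ys" using eq p by (auto simp: inj_eq inj_on_eq_iff[OF code])
    qed
    then show ?case by blast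
  qed
qed

lemma bij_right_iso:
  assumes "right_module R M" "right_module R N" and f: "f \<in> right_hom R M N"
    and bij: "bij_betw f (carrier M) (carrier N)"
  shows "right_iso R M N f"
proof -
  interpret M: right_module R M by fact
  interpret N: right_module R N by fact
  define g where "g = (\<lambda>y\<in>carrier N. inv_into (carrier M) f y)"
  have gf: "g (f x) = x" if "x \<in> carrier M" for x
    using bij that right_homD(2)[OF f that] by (simp add: g_def bij_betw_def)
  have fg: "f (g y) = y" "g y \<in> carrier M" if "y \<in> carrier N" for y
    using bij that by (auto simp: g_def bij_betw_def f_inv_into_f inv_into_into)
  have "g \<in> right_hom R N M"
  proof (rule right_homI)
    show "g \<in> extensional (carrier N)" by (simp add: g_def)
    fix y assume y: "y \<in> carrier N"
    then show "g y \<in> carrier M" by (rule fg)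
    {
      fix z assume z: "z \<in> carrier N"
      have "g (y \<oplus>\<^bsub>N\<^esub> z) = g (f (g y \<oplus>\<^bsub>M\<^esub> g z))" using y z fg right_homD(3)[OF f] by simp
      then show "g (y \<oplus>\<^bsub>N\<^esub> z) = g y \<oplus>\<^bsub>M\<^esub> g z" using y z fg gf by simp
    }
    fix r assume r: "r \<in> carrier R"
    have "g (r \<odot>\<^bsub>N\<^esub> y) = g (f (r \<odot>\<^bsub>M\<^esub> g y))" using y r fg right_homD(4)[OF f] by simp
    then show "g (r \<odot>\<^bsub>N\<^esub> y) = r \<odot>\<^bsub>M\<^esub> g y" using y r fg gf M.act_closed by simp
  qed
  moreover have "compose (carrier M) g f = hom_id M" "compose (carrier N) f g = hom_id N"
    using gf fg by (auto simp: compose_def hom_id_def)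
  ultimately show ?thesis using f unfolding right_iso_def by blast
qed

section \<open>The field as an algebra, and the functors \<open>M e\<close> and
  \<open>Hom_F(A e, V)\<close>\<close>

lemma self_algebra_simps [simp]:
  "carrier (self_algebra F) = carrier F" "mult (self_algebra F) = mult F" "one (self_algebra F) = one F"
  "zero (self_algebra F) = zero F" "add (self_algebra F) = add F" "smult (self_algebra F) = mult F"
  by (simp_all add: self_algebra_def)

lemma (in ring) self_algebra_ring: "ring (self_algebra R)"
proof (rule ringI)
  show "abelian_group (self_algebra R)"
  proof (rule abelian_groupI)
    fix x assume "x \<in> carrier (self_algebra R)"
    then show "\<exists>y\<in>carrier (self_algebra R). y \<oplus>\<^bsub>self_algebra R\<^esub> x = \<zero>\<^bsub>self_algebra R\<^esub>"
      by (intro bexI[of _ "\<ominus> x"]) (auto simp: l_neg)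
  qed (auto simp: a_assoc a_comm a_lcomm)
  show "monoid (self_algebra R)" by (rule monoidI) (auto simp: m_assoc)
qed (auto simp: l_distr r_distr)

text \<open>A full split idempotent with chosen witnesses. The function \<open>code\<close> places
  \<open>n\<close>-tuples over the universe inside the universe, and with them
  \<open>Hom_F(A e, V)\<close>.\<close>

locale split_system = corner_character +
  fixes n :: nat and x y :: "nat \<Rightarrow> 'c" and code :: "'u list \<Rightarrow> 'u"
  assumes \<pi>_e: "b \<in> corner e \<Longrightarrow> \<pi> b \<bullet> e = b"
    and x_mem: "i < n \<Longrightarrow> x i \<in> principal_left e"
    and y_mem: "i < n \<Longrightarrow> y i \<in> principal_right e"
    and one_sum: "(\<Oplus>\<^bsub>A\<^esub>i\<in>{..<n}. x i \<cdot> y i) = \<one>\<^bsub>A\<^esub>"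
    and code: "inj_on code {us. length us = n}"
begin

abbreviation "Ae \<equiv> principal_left e"

abbreviation "FA \<equiv> self_algebra F"

lemma FA_ring: "ring FA"
  by (rule R.self_algebra_ring)

lemma x_carrier: "i < n \<Longrightarrow> x i \<in> carrier A" and y_carrier: "i < n \<Longrightarrow> y i \<in> carrier A"
  using principal_leftD(1)[OF x_mem] principal_rightD(1)[OF y_mem] by auto

lemma Ae_subspace: "subspace F Ae A"
  by (rule subspace_principal_left[OF e_carrier])

lemma Ae_carrier: "v \<in> Ae \<Longrightarrow> v \<in> carrier A"
  by (rule principal_leftD(1))

lemma Ae_left: "a \<in> carrier A \<Longrightarrow> v \<in> Ae \<Longrightarrow> a \<cdot> v \<in> Ae"
  using principal_left_mult[OF e_carrier] by simp

lemma y_Ae_corner: "i < n \<Longrightarrow> v \<in> Ae \<Longrightarrow> y i \<cdot> v \<in> corner e"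
  using y_mem by (simp add: principal_mult_corner e_carrier)

text \<open>In \<open>v = \<Sum> x_i (y_i v)\<close> the factors \<open>y_i v\<close> are multiples
  of \<open>e\<close>. So the \<open>x_i\<close> span \<open>A e\<close> over \<open>F\<close>, with
  coefficients \<open>\<pi> (y_i v)\<close>.\<close>

lemma Ae_expand:
  assumes v: "v \<in> Ae"
  shows "v = (\<Oplus>\<^bsub>A\<^esub>i\<in>{..<n}. \<pi> (y i \<cdot> v) \<bullet> x i)"
proof -
  have "v = (\<Oplus>\<^bsub>A\<^esub>i\<in>{..<n}. x i \<cdot> y i) \<cdot> v" using one_sum Ae_carrier[OF v] by simp
  also have "\<dots> = (\<Oplus>\<^bsub>A\<^esub>i\<in>{..<n}. (x i \<cdot> y i) \<cdot> v)"
    using x_carrier y_carrier Ae_carrier[OF v] by (intro finsum_ldistr) auto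
  also have "\<dots> = (\<Oplus>\<^bsub>A\<^esub>i\<in>{..<n}. \<pi> (y i \<cdot> v) \<bullet> x i)"
  proof (intro M.finsum_cong' refl)
    fix i assume "i \<in> {..<n}"
    then have i: "i < n" by simp
    note c = y_Ae_corner[OF i v] x_carrier[OF i] y_carrier[OF i] Ae_carrier[OF v]
    have "(x i \<cdot> y i) \<cdot> v = x i \<cdot> (\<pi> (y i \<cdot> v) \<bullet> e)"
      using c \<pi>_e[OF c(1)] by (simp add: m_assoc)
    also have "\<dots> = \<pi> (y i \<cdot> v) \<bullet> x i"
      using c \<pi>_closed[OF c(1)] e_carrier principal_leftD(2)[OF x_mem[OF i]]
      by (simp add: smult_mult_right)
    finally show "(x i \<cdot> y i) \<cdot> v = \<pi> (y i \<cdot> v) \<bullet> x i" .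
  qed (use x_carrier y_Ae_corner[OF _ v] \<pi>_closed in auto)
  finally show ?thesis .
qed

text \<open>This is \<open>M e\<close>, a concrete form of \<open>Hom_A(e A, M)\<close>. A scalar
  acts through its image in \<open>A\<close>, as in \<open>hom_scale\<close>.\<close>

definition fixed_part :: "('c, 'u) module \<Rightarrow> ('a, 'u) module" where
  "fixed_part M = \<lparr>carrier = {m \<in> carrier M. e \<odot>\<^bsub>M\<^esub> m = m}, mult = mult M, one = one M,
    zero = zero M, add = add M, smult = (\<lambda>c m. (c \<bullet> \<one>\<^bsub>A\<^esub>) \<odot>\<^bsub>M\<^esub> m)\<rparr>"

lemma fixed_part_simps [simp]:
  "carrier (fixed_part M) = {m \<in> carrier M. e \<odot>\<^bsub>M\<^esub> m = m}" "zero (fixed_part M) = zero M"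
  "add (fixed_part M) = add M" "c \<odot>\<^bsub>fixed_part M\<^esub> m = (c \<bullet> \<one>\<^bsub>A\<^esub>) \<odot>\<^bsub>M\<^esub> m"
  by (simp_all add: fixed_part_def)

lemma fixed_part_mem:
  assumes "right_module A M" "v \<in> Ae" "m \<in> carrier M"
  shows "v \<odot>\<^bsub>M\<^esub> m \<in> carrier (fixed_part M)"
proof -
  interpret M: right_module A M by fact
  have "e \<odot>\<^bsub>M\<^esub> (v \<odot>\<^bsub>M\<^esub> m) = (v \<cdot> e) \<odot>\<^bsub>M\<^esub> m"
    using assms Ae_carrier e_carrier by (simp add: M.act_assoc)
  then show ?thesis using assms Ae_carrier principal_leftD(2) M.act_closed by simp
qed

lemma fixed_part_module:
  assumes "right_module A M"
  shows "right_module FA (fixed_part M)"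
proof -
  interpret M: right_module A M by fact
  have scal: "e \<odot>\<^bsub>M\<^esub> ((c \<bullet> \<one>\<^bsub>A\<^esub>) \<odot>\<^bsub>M\<^esub> m) = (c \<bullet> \<one>\<^bsub>A\<^esub>) \<odot>\<^bsub>M\<^esub> (e \<odot>\<^bsub>M\<^esub> m)"
    if "c \<in> carrier F" "m \<in> carrier M" for c m
    using that e_carrier by (simp add: smult_one_mult flip: M.act_assoc)
  have comm: "c \<bullet> (d \<bullet> \<one>\<^bsub>A\<^esub>) = d \<bullet> (c \<bullet> \<one>\<^bsub>A\<^esub>)"
    if "c \<in> carrier F" "d \<in> carrier F" for c d
    using that by (simp add: R.m_comm flip: smult_assoc1)
  show ?thesis
  proof (rule right_moduleI[OF FA_ring])
    show "abelian_group (fixed_part M)"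
    proof (rule abelian_groupI)
      fix m assume "m \<in> carrier (fixed_part M)"
      then have m: "m \<in> carrier M" "e \<odot>\<^bsub>M\<^esub> m = m" by auto
      have "(\<ominus>\<^bsub>A\<^esub> \<one>\<^bsub>A\<^esub>) \<odot>\<^bsub>M\<^esub> m \<oplus>\<^bsub>M\<^esub> m = \<zero>\<^bsub>M\<^esub>"
        using m by (simp add: M.uminus_act M.act_one M.M.l_neg)
      moreover have "e \<odot>\<^bsub>M\<^esub> ((\<ominus>\<^bsub>A\<^esub> \<one>\<^bsub>A\<^esub>) \<odot>\<^bsub>M\<^esub> m) = (\<ominus>\<^bsub>A\<^esub> \<one>\<^bsub>A\<^esub>) \<odot>\<^bsub>M\<^esub> (e \<odot>\<^bsub>M\<^esub> m)"
        using m(1) e_carrier by (simp add: l_minus r_minus flip: M.act_assoc)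
      ultimately show "\<exists>k\<in>carrier (fixed_part M). k \<oplus>\<^bsub>fixed_part M\<^esub> m = \<zero>\<^bsub>fixed_part M\<^esub>"
        using m by (intro bexI[of _ "(\<ominus>\<^bsub>A\<^esub> \<one>\<^bsub>A\<^esub>) \<odot>\<^bsub>M\<^esub> m"]) (auto simp: M.act_closed)
    qed (use e_carrier in \<open>auto simp: M.M.a_assoc M.M.a_comm M.M.a_lcomm M.act_zero M.act_add_distr\<close>)
  qed (auto simp: scal M.act_closed M.act_add_distr M.act_one smult_l_distr M.act_scalar_distr
      smult_one_mult smult_assoc1 comm simp flip: M.act_assoc)
qed

definition fixed_part_hom ::
    "('c, 'u) module \<Rightarrow> ('c, 'u) module \<Rightarrow> ('u \<Rightarrow> 'u) \<Rightarrow> 'u \<Rightarrow> 'u" where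
  "fixed_part_hom M N f = restrict f (carrier (fixed_part M))"

lemma fixed_part_hom_mem:
  assumes "right_module A M" "right_module A N" "f \<in> right_hom A M N"
  shows "fixed_part_hom M N f \<in> right_hom FA (fixed_part M) (fixed_part N)"
proof -
  interpret TM: right_module FA "fixed_part M" by (rule fixed_part_module) fact
  note h = right_homD[OF assms(3)]
  show ?thesis
  proof (rule right_homI)
    fix m assume m: "m \<in> carrier (fixed_part M)"
    then have "e \<odot>\<^bsub>N\<^esub> f m = f m" using h(4)[of e m] e_carrier by simp
    then show "fixed_part_hom M N f m \<in> carrier (fixed_part N)"
      using m h(2) by (simp add: fixed_part_hom_def)
    show "fixed_part_hom M N f (c \<odot>\<^bsub>fixed_part M\<^esub> m) = c \<odot>\<^bsub>fixed_part N\<^esub> fixed_part_hom M N f m"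
      if "c \<in> carrier FA" for c
      using TM.act_closed[OF that m] m h(4) that by (simp add: fixed_part_hom_def)
    show "fixed_part_hom M N f (m \<oplus>\<^bsub>fixed_part M\<^esub> m') =
        fixed_part_hom M N f m \<oplus>\<^bsub>fixed_part N\<^esub> fixed_part_hom M N f m'"
      if "m' \<in> carrier (fixed_part M)" for m'
      using TM.M.a_closed[OF m that] m that h(3) by (simp add: fixed_part_hom_def)
  qed (simp add: fixed_part_hom_def)
qed

lemma fixed_part_functor: "linear_functor F A FA fixed_part fixed_part_hom"
proof (rule linear_functor.intro)
  fix M :: "('c, 'u) module"
  assume M: "right_module A M"
  show "right_module FA (fixed_part M)" by (rule fixed_part_module[OF M])
  show "fixed_part_hom M M (hom_id M) = hom_id (fixed_part M)"
    by (auto simp: fixed_part_hom_def hom_id_def)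
next
  fix M N :: "('c, 'u) module" and f
  assume "right_module A M" "right_module A N" "f \<in> right_hom A M N"
  then show "fixed_part_hom M N f \<in> right_hom FA (fixed_part M) (fixed_part N)"
    by (rule fixed_part_hom_mem)
next
  fix M N P :: "('c, 'u) module" and f g
  assume f: "f \<in> right_hom A M N"
  have "e \<odot>\<^bsub>N\<^esub> f m = f m" if "m \<in> carrier (fixed_part M)" for m
    using that right_homD(4)[OF f, of e m] e_carrier by simp
  then show "fixed_part_hom M P (compose (carrier M) g f) =
      compose (carrier (fixed_part M)) (fixed_part_hom N P g) (fixed_part_hom M N f)"
    using right_homD(2)[OF f] by (auto simp: fixed_part_hom_def compose_def)
next
  fix M N :: "('c, 'u) module" and f g
  show "fixed_part_hom M N (hom_add M N f g) =
      hom_add (fixed_part M) (fixed_part N) (fixed_part_hom M N f) (fixed_part_hom M N g)"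
    by (auto simp: fixed_part_hom_def hom_add_def)
next
  fix M N :: "('c, 'u) module" and f c
  assume "c \<in> carrier F"
  then show "fixed_part_hom M N (hom_scale A M N c f) =
      hom_scale FA (fixed_part M) (fixed_part N) c (fixed_part_hom M N f)"
    by (auto simp: fixed_part_hom_def hom_scale_def)
qed

text \<open>\<open>Hom_F(A e, V)\<close>: left multiplication of \<open>A\<close> on
  \<open>A e\<close> makes it a right module by \<open>(\<phi> a) v = \<phi> (a v)\<close>.
  Extensionality makes linear maps equal as soon as they agree on \<open>A e\<close>.\<close>

definition hom_space :: "('a, 'u) module \<Rightarrow> ('c, 'c \<Rightarrow> 'u) module" where
  "hom_space V =
    \<lparr>carrier = {\<phi> \<in> extensional Ae. (\<forall>v\<in>Ae. \<phi> v \<in> carrier V) \<and>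
       (\<forall>v\<in>Ae. \<forall>w\<in>Ae. \<phi> (v \<oplus>\<^bsub>A\<^esub> w) = \<phi> v \<oplus>\<^bsub>V\<^esub> \<phi> w) \<and>
       (\<forall>c\<in>carrier F. \<forall>v\<in>Ae. \<phi> (c \<bullet> v) = c \<odot>\<^bsub>V\<^esub> \<phi> v)},
     mult = (\<lambda>_ _. undefined), one = undefined, zero = (\<lambda>v\<in>Ae. \<zero>\<^bsub>V\<^esub>),
     add = (\<lambda>\<phi> \<psi>. \<lambda>v\<in>Ae. \<phi> v \<oplus>\<^bsub>V\<^esub> \<psi> v), smult = (\<lambda>a \<phi>. \<lambda>v\<in>Ae. \<phi> (a \<cdot> v))\<rparr>"

lemma hom_space_simps [simp]:
  "zero (hom_space V) = (\<lambda>v\<in>Ae. \<zero>\<^bsub>V\<^esub>)" "add (hom_space V) \<phi> \<psi> = (\<lambda>v\<in>Ae. \<phi> v \<oplus>\<^bsub>V\<^esub> \<psi> v)"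
  "a \<odot>\<^bsub>hom_space V\<^esub> \<phi> = (\<lambda>v\<in>Ae. \<phi> (a \<cdot> v))"
  by (simp_all add: hom_space_def)

lemma hom_spaceI:
  assumes "\<phi> \<in> extensional Ae" "\<And>v. v \<in> Ae \<Longrightarrow> \<phi> v \<in> carrier V"
    and "\<And>v w. v \<in> Ae \<Longrightarrow> w \<in> Ae \<Longrightarrow> \<phi> (v \<oplus>\<^bsub>A\<^esub> w) = \<phi> v \<oplus>\<^bsub>V\<^esub> \<phi> w"
    and "\<And>c v. c \<in> carrier F \<Longrightarrow> v \<in> Ae \<Longrightarrow> \<phi> (c \<bullet> v) = c \<odot>\<^bsub>V\<^esub> \<phi> v"
  shows "\<phi> \<in> carrier (hom_space V)"
  using assms by (simp add: hom_space_def)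

lemma hom_spaceD:
  assumes "\<phi> \<in> carrier (hom_space V)"
  shows "\<phi> \<in> extensional Ae" "\<And>v. v \<in> Ae \<Longrightarrow> \<phi> v \<in> carrier V"
    and "\<And>v w. v \<in> Ae \<Longrightarrow> w \<in> Ae \<Longrightarrow> \<phi> (v \<oplus>\<^bsub>A\<^esub> w) = \<phi> v \<oplus>\<^bsub>V\<^esub> \<phi> w"
    and "\<And>c v. c \<in> carrier F \<Longrightarrow> v \<in> Ae \<Longrightarrow> \<phi> (c \<bullet> v) = c \<odot>\<^bsub>V\<^esub> \<phi> v"
  using assms by (auto simp: hom_space_def)

lemma hom_space_module:
  assumes "right_module FA V"
  shows "right_module A (hom_space V)"
proof -
  interpret V: right_module FA V by fact
  note Ae_add = subspaceD(3)[OF Ae_subspace] and Ae_smult = subspaceD(4)[OF Ae_subspace]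
  have scal_add: "c \<odot>\<^bsub>V\<^esub> (u \<oplus>\<^bsub>V\<^esub> u') = c \<odot>\<^bsub>V\<^esub> u \<oplus>\<^bsub>V\<^esub> c \<odot>\<^bsub>V\<^esub> u'"
    if "c \<in> carrier F" "u \<in> carrier V" "u' \<in> carrier V" for c u u'
    using that V.act_add_distr by simp
  have interchange: "(p \<oplus>\<^bsub>V\<^esub> q) \<oplus>\<^bsub>V\<^esub> (r \<oplus>\<^bsub>V\<^esub> s) = (p \<oplus>\<^bsub>V\<^esub> r) \<oplus>\<^bsub>V\<^esub> (q \<oplus>\<^bsub>V\<^esub> s)"
    if "p \<in> carrier V" "q \<in> carrier V" "r \<in> carrier V" "s \<in> carrier V" for p q r s
    using that by (simp add: V.M.a_assoc V.M.a_comm V.M.a_lcomm)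
  have add: "\<phi> \<oplus>\<^bsub>hom_space V\<^esub> \<psi> \<in> carrier (hom_space V)"
    if "\<phi> \<in> carrier (hom_space V)" "\<psi> \<in> carrier (hom_space V)" for \<phi> \<psi>
    using hom_spaceD[OF that(1)] hom_spaceD[OF that(2)] Ae_add Ae_smult
    by (intro hom_spaceI) (auto simp: interchange scal_add)
  have zero: "\<zero>\<^bsub>hom_space V\<^esub> \<in> carrier (hom_space V)"
    using Ae_add Ae_smult V.act_zero by (intro hom_spaceI) auto
  have neg: "(\<lambda>v\<in>Ae. (\<ominus> \<one>) \<odot>\<^bsub>V\<^esub> \<phi> v) \<in> carrier (hom_space V)" if "\<phi> \<in> carrier (hom_space V)" for \<phi>
  proof (rule hom_spaceI)
    note h = hom_spaceD[OF that]
    fix v assume v: "v \<in> Ae"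
    show "(\<lambda>v\<in>Ae. (\<ominus> \<one>) \<odot>\<^bsub>V\<^esub> \<phi> v) v \<in> carrier V" using v h V.act_closed[of "\<ominus> \<one>"] by simp
    show "(\<lambda>v\<in>Ae. (\<ominus> \<one>) \<odot>\<^bsub>V\<^esub> \<phi> v) (v \<oplus>\<^bsub>A\<^esub> w) =
        (\<lambda>v\<in>Ae. (\<ominus> \<one>) \<odot>\<^bsub>V\<^esub> \<phi> v) v \<oplus>\<^bsub>V\<^esub> (\<lambda>v\<in>Ae. (\<ominus> \<one>) \<odot>\<^bsub>V\<^esub> \<phi> v) w" if "w \<in> Ae" for w
      using v that h Ae_add scal_add by simp
    show "(\<lambda>v\<in>Ae. (\<ominus> \<one>) \<odot>\<^bsub>V\<^esub> \<phi> v) (c \<bullet> v) = c \<odot>\<^bsub>V\<^esub> (\<lambda>v\<in>Ae. (\<ominus> \<one>) \<odot>\<^bsub>V\<^esub> \<phi> v) v"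
      if c: "c \<in> carrier F" for c
      using v c h Ae_smult V.act_assoc[of "\<ominus> \<one>" c "\<phi> v"] V.act_assoc[of c "\<ominus> \<one>" "\<phi> v"]
      by (simp add: R.m_comm)
  qed simp
  have act: "a \<odot>\<^bsub>hom_space V\<^esub> \<phi> \<in> carrier (hom_space V)"
    if "a \<in> carrier A" "\<phi> \<in> carrier (hom_space V)" for a \<phi>
    using hom_spaceD[OF that(2)] Ae_left[OF that(1)] that(1) Ae_add Ae_smult Ae_carrier
    by (intro hom_spaceI) (auto simp: r_distr smult_mult_right)
  show ?thesis
  proof (rule right_moduleI)
    show "abelian_group (hom_space V)"
    proof (rule abelian_groupI)
      fix \<phi> assume \<phi>: "\<phi> \<in> carrier (hom_space V)"
      note h = hom_spaceD[OF \<phi>]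
      show "\<zero>\<^bsub>hom_space V\<^esub> \<oplus>\<^bsub>hom_space V\<^esub> \<phi> = \<phi>"
        using h by (auto intro!: extensionalityI[OF _ h(1)])
      have "(\<ominus> \<one>) \<odot>\<^bsub>V\<^esub> u \<oplus>\<^bsub>V\<^esub> u = \<zero>\<^bsub>V\<^esub>" if u: "u \<in> carrier V" for u
        using V.act_scalar_distr[of "\<ominus> \<one>" \<one> u] V.act_one[OF u] V.zero_act[OF u] u
          by (simp add: R.l_neg)
      then show "\<exists>\<psi>\<in>carrier (hom_space V). \<psi> \<oplus>\<^bsub>hom_space V\<^esub> \<phi> = \<zero>\<^bsub>hom_space V\<^esub>"
        using neg[OF \<phi>] h by (intro bexI[of _ "\<lambda>v\<in>Ae. (\<ominus> \<one>) \<odot>\<^bsub>V\<^esub> \<phi> v"]) auto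
    qed (use add zero hom_spaceD(2) in \<open>auto simp: V.M.a_assoc V.M.a_comm V.M.a_lcomm intro!: restrict_ext\<close>)
    show "\<one>\<^bsub>A\<^esub> \<odot>\<^bsub>hom_space V\<^esub> \<phi> = \<phi>" if "\<phi> \<in> carrier (hom_space V)" for \<phi>
      using hom_spaceD(1)[OF that] Ae_carrier
        by (auto intro!: extensionalityI[OF _ hom_spaceD(1)[OF that]])
    show "ring A" by unfold_locales
  next
    fix a b \<phi> assume ab: "a \<in> carrier A" "b \<in> carrier A" and \<phi>: "\<phi> \<in> carrier (hom_space V)"
    note h = hom_spaceD[OF \<phi>]
    show "(a \<oplus>\<^bsub>A\<^esub> b) \<odot>\<^bsub>hom_space V\<^esub> \<phi> = a \<odot>\<^bsub>hom_space V\<^esub> \<phi> \<oplus>\<^bsub>hom_space V\<^esub> b \<odot>\<^bsub>hom_space V\<^esub> \<phi>"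
      using ab h Ae_left Ae_carrier by (auto simp: l_distr intro!: restrict_ext)
    show "(a \<cdot> b) \<odot>\<^bsub>hom_space V\<^esub> \<phi> = b \<odot>\<^bsub>hom_space V\<^esub> (a \<odot>\<^bsub>hom_space V\<^esub> \<phi>)"
      using ab Ae_left Ae_carrier by (auto simp: m_assoc intro!: restrict_ext)
  qed (use act Ae_left in \<open>auto intro!: restrict_ext\<close>)
qed

text \<open>A linear map on \<open>A e\<close> is determined by its values at the \<open>x\<^sub>i\<close>; coding these values makes
  \<open>Hom\<^sub>F(A e, V)\<close> fit into the universe of \<open>V\<close>.\<close>

definition enc :: "('c \<Rightarrow> 'u) \<Rightarrow> 'u" where
  "enc \<phi> = code (map (\<lambda>i. \<phi> (x i)) [0..<n])"

text \<open>Two maps with the same code agree on a subspace that contains every \<open>x_i\<close>,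
  and by \<open>Ae_expand\<close> this is all of \<open>A e\<close>.\<close>

lemma enc_inj:
  assumes "right_module FA V"
  shows "inj_on enc (carrier (hom_space V))"
proof (rule inj_onI)
  fix \<phi> \<psi> assume \<phi>: "\<phi> \<in> carrier (hom_space V)" and \<psi>: "\<psi> \<in> carrier (hom_space V)"
    and "enc \<phi> = enc \<psi>"
  then have "map (\<lambda>i. \<phi> (x i)) [0..<n] = map (\<lambda>i. \<psi> (x i)) [0..<n]"
    using code by (auto simp: enc_def dest!: inj_onD)
  then have eq: "\<phi> (x i) = \<psi> (x i)" if "i < n" for i using that by (simp add: list_eq_iff_nth_eq)
  note h = hom_spaceD[OF \<phi>] hom_spaceD[OF \<psi>]
  interpret V: right_module FA V by fact
  let ?W = "{v \<in> Ae. \<phi> v = \<psi> v}"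
  have "subspace F ?W A"
  proof (rule subspaceI)
    have "\<phi> (\<zero> \<bullet> \<zero>\<^bsub>A\<^esub>) = \<zero> \<odot>\<^bsub>V\<^esub> \<phi> \<zero>\<^bsub>A\<^esub>" "\<psi> (\<zero> \<bullet> \<zero>\<^bsub>A\<^esub>) = \<zero> \<odot>\<^bsub>V\<^esub> \<psi> \<zero>\<^bsub>A\<^esub>"
      using subspaceD(2)[OF Ae_subspace] by (auto simp only: h(4) h(8) R.zero_closed)
    then show "\<zero>\<^bsub>A\<^esub> \<in> ?W" using h(2,6) subspaceD(2)[OF Ae_subspace] V.zero_act by simp
  qed (use h subspaceD[OF Ae_subspace] in auto)
  moreover have "\<pi> (y i \<cdot> v) \<bullet> x i \<in> ?W" if "i < n" "v \<in> Ae" for i v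
  proof -
    have "x i \<in> ?W" using x_mem eq that by simp
    then show ?thesis
      using subspaceD(4)[OF \<open>subspace F ?W A\<close>] \<pi>_closed[OF y_Ae_corner[OF that]] by blast
  qed
  ultimately have "(\<Oplus>\<^bsub>A\<^esub>i\<in>{..<n}. \<pi> (y i \<cdot> v) \<bullet> x i) \<in> ?W" if "v \<in> Ae" for v
    using that by (intro subspace_finsum) auto
  then have "\<phi> v = \<psi> v" if "v \<in> Ae" for v using Ae_expand[OF that] that by fastforce
  then show "\<phi> = \<psi>" using extensionalityI[OF h(1) h(5)] by blast
qed

definition induced :: "('a, 'u) module \<Rightarrow> ('c, 'u) module" where
  "induced V = transport enc (hom_space V)"

definition induced_hom :: "('a, 'u) module \<Rightarrow> ('a, 'u) module \<Rightarrow> ('u \<Rightarrow> 'u) \<Rightarrow> 'u \<Rightarrow> 'u" where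
  "induced_hom V W f = (\<lambda>p\<in>carrier (induced V).
    enc (\<lambda>v\<in>Ae. f (inv_into (carrier (hom_space V)) enc p v)))"

end

context split_system
begin

lemma A_abelian_monoid: "abelian_monoid A"
  by (rule M.abelian_monoid_axioms)

context
  fixes V :: "('a, 'u) module" assumes V: "right_module FA V"
begin

interpretation V: right_module FA V by (rule V)

interpretation H: module_congruence A "hom_space V" enc
  by (rule right_module.inj_module_congruence[OF hom_space_module[OF V] enc_inj[OF V]])

lemma induced_module: "right_module A (induced V)"
  unfolding induced_def by (rule H.transport_module)

lemma induced_carrier: "carrier (induced V) = enc ` carrier (hom_space V)"
  unfolding induced_def by (rule H.transport_carrier)

lemma induced_add:
  assumes "\<phi> \<in> carrier (hom_space V)" "\<psi> \<in> carrier (hom_space V)"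
  shows "enc \<phi> \<oplus>\<^bsub>induced V\<^esub> enc \<psi> = enc (\<lambda>v\<in>Ae. \<phi> v \<oplus>\<^bsub>V\<^esub> \<psi> v)"
  using H.transport_add[OF assms] by (simp add: induced_def)

lemma induced_act:
  assumes "a \<in> carrier A" "\<phi> \<in> carrier (hom_space V)"
  shows "a \<odot>\<^bsub>induced V\<^esub> enc \<phi> = enc (\<lambda>v\<in>Ae. \<phi> (a \<cdot> v))"
  using H.transport_act[OF assms] by (simp add: induced_def)

lemma hom_space_act:
  assumes "a \<in> carrier A" "\<phi> \<in> carrier (hom_space V)"
  shows "(\<lambda>v\<in>Ae. \<phi> (a \<cdot> v)) \<in> carrier (hom_space V)"
  using H.act_closed[OF assms] by simp

lemma hom_space_add:
  assumes "\<phi> \<in> carrier (hom_space V)" "\<psi> \<in> carrier (hom_space V)"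
  shows "(\<lambda>v\<in>Ae. \<phi> v \<oplus>\<^bsub>V\<^esub> \<psi> v) \<in> carrier (hom_space V)"
  using H.M.a_closed[OF assms] by simp

lemma dec_enc: "\<phi> \<in> carrier (hom_space V) \<Longrightarrow> inv_into (carrier (hom_space V)) enc (enc \<phi>) = \<phi>"
  by (rule inv_into_f_f[OF enc_inj[OF V]])

lemma enc_eq_iff:
  "\<phi> \<in> carrier (hom_space V) \<Longrightarrow> \<psi> \<in> carrier (hom_space V) \<Longrightarrow> enc \<phi> = enc \<psi> \<longleftrightarrow> \<phi> = \<psi>"
  by (rule inj_on_eq_iff[OF enc_inj[OF V]])

lemma induced_hom_enc:
  "\<phi> \<in> carrier (hom_space V) \<Longrightarrow> induced_hom V W f (enc \<phi>) = enc (\<lambda>v\<in>Ae. f (\<phi> v))"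
  by (simp add: induced_hom_def induced_carrier dec_enc)

lemma induced_hom_extensional: "induced_hom V W f \<in> extensional (carrier (induced V))"
  by (simp add: induced_hom_def)

lemma hom_space_push:
  assumes f: "f \<in> right_hom FA V W" and \<phi>: "\<phi> \<in> carrier (hom_space V)"
  shows "(\<lambda>v\<in>Ae. f (\<phi> v)) \<in> carrier (hom_space W)"
  using hom_spaceD[OF \<phi>] right_homD(2-4)[OF f] subspaceD(3,4)[OF Ae_subspace]
  by (intro hom_spaceI) auto

end

lemma induced_hom_mem:
  assumes V: "right_module FA V" and W: "right_module FA W" and f: "f \<in> right_hom FA V W"
  shows "induced_hom V W f \<in> right_hom A (induced V) (induced W)"
proof (rule right_homI)
  note push = hom_space_push[OF V f]
  show "induced_hom V W f \<in> extensional (carrier (induced V))"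
    by (rule induced_hom_extensional[OF V])
  fix p assume "p \<in> carrier (induced V)"
  then obtain \<phi> where \<phi>: "\<phi> \<in> carrier (hom_space V)" "p = enc \<phi>"
    by (auto simp: induced_carrier[OF V])
  show "induced_hom V W f p \<in> carrier (induced W)"
    using \<phi> push by (simp add: induced_hom_enc[OF V] induced_carrier[OF W])
  {
    fix q assume "q \<in> carrier (induced V)"
    then obtain \<psi> where \<psi>: "\<psi> \<in> carrier (hom_space V)" "q = enc \<psi>"
      by (auto simp: induced_carrier[OF V])
    have "(\<lambda>v\<in>Ae. f ((\<lambda>v\<in>Ae. \<phi> v \<oplus>\<^bsub>V\<^esub> \<psi> v) v)) =
        (\<lambda>v\<in>Ae. (\<lambda>v\<in>Ae. f (\<phi> v)) v \<oplus>\<^bsub>W\<^esub> (\<lambda>v\<in>Ae. f (\<psi> v)) v)"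
      using right_homD(3)[OF f] hom_spaceD(2)[OF \<phi>(1)] hom_spaceD(2)[OF \<psi>(1)]
      by (intro restrict_ext) simp
    then show "induced_hom V W f (p \<oplus>\<^bsub>induced V\<^esub> q) = induced_hom V W f p \<oplus>\<^bsub>induced W\<^esub> induced_hom V W f q"
      unfolding \<phi>(2) \<psi>(2) induced_add[OF V \<phi>(1) \<psi>(1)]
      by (simp only: induced_hom_enc[OF V] \<phi>(1) \<psi>(1) hom_space_add[OF V] induced_add[OF W] push)
  }
  fix a assume a: "a \<in> carrier A"
  have "(\<lambda>v\<in>Ae. f ((\<lambda>v\<in>Ae. \<phi> (a \<cdot> v)) v)) = (\<lambda>v\<in>Ae. (\<lambda>v\<in>Ae. f (\<phi> v)) (a \<cdot> v))"
    using Ae_left[OF a] by (intro restrict_ext) simp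
  then show "induced_hom V W f (a \<odot>\<^bsub>induced V\<^esub> p) = a \<odot>\<^bsub>induced W\<^esub> induced_hom V W f p"
    unfolding \<phi>(2) induced_act[OF V a \<phi>(1)]
    by (simp only: induced_hom_enc[OF V] \<phi>(1) hom_space_act[OF V a] induced_act[OF W a] push)
qed

lemma induced_functor: "linear_functor F FA A induced induced_hom"
proof (rule linear_functor.intro)
  fix V :: "('a, 'u) module"
  assume V: "right_module FA V"
  show "right_module A (induced V)" by (rule induced_module[OF V])
  show "induced_hom V V (hom_id V) = hom_id (induced V)"
  proof (rule extensionalityI[OF induced_hom_extensional[OF V]])
    fix p assume "p \<in> carrier (induced V)"
    then obtain \<phi> where \<phi>: "\<phi> \<in> carrier (hom_space V)" "p = enc \<phi>"
      by (auto simp: induced_carrier[OF V])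
    note h = hom_spaceD[OF \<phi>(1)]
    have "(\<lambda>v\<in>Ae. hom_id V (\<phi> v)) = \<phi>"
      using h(1,2) by (auto simp: hom_id_def intro!: extensionalityI[OF _ h(1)])
    then show "induced_hom V V (hom_id V) p = hom_id (induced V) p"
      using \<phi> by (simp add: induced_hom_enc[OF V] hom_id_def induced_carrier[OF V])
  qed (simp add: hom_id_def)
next
  fix V W :: "('a, 'u) module" and f
  assume "right_module FA V" "right_module FA W" "f \<in> right_hom FA V W"
  then show "induced_hom V W f \<in> right_hom A (induced V) (induced W)" by (rule induced_hom_mem)
next
  fix V W X :: "('a, 'u) module" and f g
  assume V: "right_module FA V" and W: "right_module FA W" and X: "right_module FA X"
    and f: "f \<in> right_hom FA V W" and g: "g \<in> right_hom FA W X"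
  show "induced_hom V X (compose (carrier V) g f) =
      compose (carrier (induced V)) (induced_hom W X g) (induced_hom V W f)"
  proof (rule extensionalityI[OF induced_hom_extensional[OF V]])
    fix p assume p: "p \<in> carrier (induced V)"
    then obtain \<phi> where \<phi>: "\<phi> \<in> carrier (hom_space V)" "p = enc \<phi>"
      by (auto simp: induced_carrier[OF V])
    have "(\<lambda>v\<in>Ae. compose (carrier V) g f (\<phi> v)) = (\<lambda>v\<in>Ae. g ((\<lambda>v\<in>Ae. f (\<phi> v)) v))"
      using hom_spaceD(2)[OF \<phi>(1)] by (intro restrict_ext) (simp add: compose_def)
    then show "induced_hom V X (compose (carrier V) g f) p =
        compose (carrier (induced V)) (induced_hom W X g) (induced_hom V W f) p"
      using \<phi> p hom_space_push[OF V f \<phi>(1)]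
      by (simp add: induced_hom_enc[OF V] induced_hom_enc[OF W] compose_def)
  qed (simp add: compose_def)
next
  fix V W :: "('a, 'u) module" and f g
  assume V: "right_module FA V" and W: "right_module FA W"
    and f: "f \<in> right_hom FA V W" and g: "g \<in> right_hom FA V W"
  show "induced_hom V W (hom_add V W f g) =
      hom_add (induced V) (induced W) (induced_hom V W f) (induced_hom V W g)"
  proof (rule extensionalityI[OF induced_hom_extensional[OF V]])
    fix p assume p: "p \<in> carrier (induced V)"
    then obtain \<phi> where \<phi>: "\<phi> \<in> carrier (hom_space V)" "p = enc \<phi>"
      by (auto simp: induced_carrier[OF V])
    have "(\<lambda>v\<in>Ae. hom_add V W f g (\<phi> v)) =
        (\<lambda>v\<in>Ae. (\<lambda>v\<in>Ae. f (\<phi> v)) v \<oplus>\<^bsub>W\<^esub> (\<lambda>v\<in>Ae. g (\<phi> v)) v)"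
      using hom_spaceD(2)[OF \<phi>(1)] by (intro restrict_ext) (simp add: hom_add_def)
    then have "induced_hom V W (hom_add V W f g) p = induced_hom V W f p \<oplus>\<^bsub>induced W\<^esub> induced_hom V W g p"
      unfolding \<phi>(2) by (simp only: induced_hom_enc[OF V \<phi>(1)] induced_add[OF W]
          hom_space_push[OF V f \<phi>(1)] hom_space_push[OF V g \<phi>(1)])
    then show "induced_hom V W (hom_add V W f g) p =
        hom_add (induced V) (induced W) (induced_hom V W f) (induced_hom V W g) p"
      using p by (simp add: hom_add_def)
  qed (simp add: hom_add_def)
next
  fix V W :: "('a, 'u) module" and f c
  assume V: "right_module FA V" and W: "right_module FA W" and c: "c \<in> carrier F"
    and f: "f \<in> right_hom FA V W"
  show "induced_hom V W (hom_scale FA V W c f) = hom_scale A (induced V) (induced W) c (induced_hom V W f)"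
  proof (rule extensionalityI[OF induced_hom_extensional[OF V]])
    fix p assume p: "p \<in> carrier (induced V)"
    then obtain \<phi> where \<phi>: "\<phi> \<in> carrier (hom_space V)" "p = enc \<phi>"
      by (auto simp: induced_carrier[OF V])
    have c1: "c \<bullet> \<one>\<^bsub>A\<^esub> \<in> carrier A" using c by simp
    note push = hom_space_push[OF V f \<phi>(1)]
    \<comment> \<open>The scalar acts on values on the left and on arguments on the right; linearity
      of the composite map identifies the two.\<close>
    have "(\<lambda>v\<in>Ae. hom_scale FA V W c f (\<phi> v)) = (\<lambda>v\<in>Ae. (\<lambda>v\<in>Ae. f (\<phi> v)) ((c \<bullet> \<one>\<^bsub>A\<^esub>) \<cdot> v))"
    proof (rule restrict_ext)
      fix v assume v: "v \<in> Ae"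
      have "(c \<bullet> \<one>\<^bsub>A\<^esub>) \<cdot> v = c \<bullet> v" using c Ae_carrier[OF v] by (simp add: smult_one_mult)
      then show "hom_scale FA V W c f (\<phi> v) = (\<lambda>v\<in>Ae. f (\<phi> v)) ((c \<bullet> \<one>\<^bsub>A\<^esub>) \<cdot> v)"
        using hom_spaceD(4)[OF push c v] v hom_spaceD(2)[OF \<phi>(1) v] c by (simp add: hom_scale_def)
    qed
    then have "induced_hom V W (hom_scale FA V W c f) p = (c \<bullet> \<one>\<^bsub>A\<^esub>) \<odot>\<^bsub>induced W\<^esub> induced_hom V W f p"
      unfolding \<phi>(2) by (simp only: induced_hom_enc[OF V \<phi>(1)] induced_act[OF W c1 push])
    then show "induced_hom V W (hom_scale FA V W c f) p =
        hom_scale A (induced V) (induced W) c (induced_hom V W f) p"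
      using p by (simp add: hom_scale_def)
  qed (simp add: hom_scale_def)
qed

section \<open>Unit and counit of the equivalence\<close>

definition unit :: "('c, 'u) module \<Rightarrow> 'u \<Rightarrow> 'u" where
  "unit M = (\<lambda>m\<in>carrier M. enc (\<lambda>v\<in>Ae. v \<odot>\<^bsub>M\<^esub> m))"

context
  fixes M :: "('c, 'u) module" assumes M: "right_module A M"
begin

interpretation M: right_module A M by (rule M)

text \<open>In right-hand notation this is \<open>v \<mapsto> m v\<close>, and \<open>m v\<close> is
  fixed by \<open>e\<close> because \<open>v e = v\<close>.\<close>

lemma orbit_mem:
  assumes m: "m \<in> carrier M"
  shows "(\<lambda>v\<in>Ae. v \<odot>\<^bsub>M\<^esub> m) \<in> carrier (hom_space (fixed_part M))"
proof (rule hom_spaceI)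
  fix v assume v: "v \<in> Ae"
  show "(\<lambda>v\<in>Ae. v \<odot>\<^bsub>M\<^esub> m) v \<in> carrier (fixed_part M)" using fixed_part_mem[OF M v m] v by simp
  show "(\<lambda>v\<in>Ae. v \<odot>\<^bsub>M\<^esub> m) (v \<oplus>\<^bsub>A\<^esub> w) =
      (\<lambda>v\<in>Ae. v \<odot>\<^bsub>M\<^esub> m) v \<oplus>\<^bsub>fixed_part M\<^esub> (\<lambda>v\<in>Ae. v \<odot>\<^bsub>M\<^esub> m) w" if w: "w \<in> Ae" for w
    using v w m subspaceD(3)[OF Ae_subspace] Ae_carrier by (simp add: M.act_scalar_distr)
  show "(\<lambda>v\<in>Ae. v \<odot>\<^bsub>M\<^esub> m) (c \<bullet> v) = c \<odot>\<^bsub>fixed_part M\<^esub> (\<lambda>v\<in>Ae. v \<odot>\<^bsub>M\<^esub> m) v"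
    if c: "c \<in> carrier F" for c
  proof -
    have "c \<bullet> v = v \<cdot> (c \<bullet> \<one>\<^bsub>A\<^esub>)" using c Ae_carrier[OF v] by (simp add: smult_one_mult)
    then show ?thesis using v c m subspaceD(4)[OF Ae_subspace c v] Ae_carrier[OF v]
      by (simp add: M.act_assoc)
  qed
qed simp

lemma act_finsum:
  assumes "r \<in> carrier A" "\<And>i. i \<in> I \<Longrightarrow> g i \<in> carrier M"
  shows "r \<odot>\<^bsub>M\<^esub> (\<Oplus>\<^bsub>M\<^esub>i\<in>I. g i) = (\<Oplus>\<^bsub>M\<^esub>i\<in>I. r \<odot>\<^bsub>M\<^esub> g i)"
  using assms by (intro finsum_additive_map M.M.abelian_monoid_axioms)
    (auto simp: M.act_closed M.act_zero M.act_add_distr)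

lemma finsum_act:
  assumes "m \<in> carrier M" "\<And>i. i \<in> I \<Longrightarrow> g i \<in> carrier A"
  shows "(\<Oplus>\<^bsub>A\<^esub>i\<in>I. g i) \<odot>\<^bsub>M\<^esub> m = (\<Oplus>\<^bsub>M\<^esub>i\<in>I. g i \<odot>\<^bsub>M\<^esub> m)"
  using assms
    by (intro finsum_additive_map[where f = "\<lambda>r. r \<odot>\<^bsub>M\<^esub> m"] M.M.abelian_monoid_axioms A_abelian_monoid)
    (auto simp: M.act_closed M.zero_act M.act_scalar_distr)

lemma unit_hom: "unit M \<in> right_hom A M (induced (fixed_part M))"
proof (rule right_homI)
  note V = fixed_part_module[OF M]
  show "unit M \<in> extensional (carrier M)" by (simp add: unit_def)
  fix m assume m: "m \<in> carrier M"
  show "unit M m \<in> carrier (induced (fixed_part M))"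
    using m orbit_mem by (simp add: unit_def induced_carrier[OF V])
  {
    fix m' assume m': "m' \<in> carrier M"
    have "(\<lambda>v\<in>Ae. v \<odot>\<^bsub>M\<^esub> (m \<oplus>\<^bsub>M\<^esub> m')) =
        (\<lambda>v\<in>Ae. (\<lambda>v\<in>Ae. v \<odot>\<^bsub>M\<^esub> m) v \<oplus>\<^bsub>fixed_part M\<^esub> (\<lambda>v\<in>Ae. v \<odot>\<^bsub>M\<^esub> m') v)"
      using m m' Ae_carrier by (intro restrict_ext) (simp add: M.act_add_distr)
    then show "unit M (m \<oplus>\<^bsub>M\<^esub> m') = unit M m \<oplus>\<^bsub>induced (fixed_part M)\<^esub> unit M m'"
      using m m' by (simp add: unit_def induced_add[OF V orbit_mem orbit_mem])
  }
  fix a assume a: "a \<in> carrier A"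
  have "(\<lambda>v\<in>Ae. v \<odot>\<^bsub>M\<^esub> (a \<odot>\<^bsub>M\<^esub> m)) = (\<lambda>v\<in>Ae. (\<lambda>v\<in>Ae. v \<odot>\<^bsub>M\<^esub> m) (a \<cdot> v))"
    using m a Ae_carrier Ae_left[OF a] by (intro restrict_ext) (simp add: M.act_assoc)
  then show "unit M (a \<odot>\<^bsub>M\<^esub> m) = a \<odot>\<^bsub>induced (fixed_part M)\<^esub> unit M m"
    using m a by (simp add: unit_def induced_act[OF V a orbit_mem] M.act_closed)
qed

text \<open>In right-hand notation \<open>m = m 1 = \<Sum> (m x_i) y_i\<close>, which recovers
  \<open>m\<close> from its orbit map on \<open>A e\<close>.\<close>

lemma orbit_reconstruct:
  assumes m: "m \<in> carrier M"
  shows "m = (\<Oplus>\<^bsub>M\<^esub>i\<in>{..<n}. y i \<odot>\<^bsub>M\<^esub> (x i \<odot>\<^bsub>M\<^esub> m))"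
proof -
  have "m = (\<Oplus>\<^bsub>A\<^esub>i\<in>{..<n}. x i \<cdot> y i) \<odot>\<^bsub>M\<^esub> m" using one_sum m M.act_one by simp
  also have "\<dots> = (\<Oplus>\<^bsub>M\<^esub>i\<in>{..<n}. (x i \<cdot> y i) \<odot>\<^bsub>M\<^esub> m)"
    using m x_carrier y_carrier by (intro finsum_act) auto
  also have "\<dots> = (\<Oplus>\<^bsub>M\<^esub>i\<in>{..<n}. y i \<odot>\<^bsub>M\<^esub> (x i \<odot>\<^bsub>M\<^esub> m))"
    using m x_carrier y_carrier
      by (intro M.M.finsum_cong' refl) (auto simp: M.act_assoc M.act_closed)
  finally show ?thesis .
qed

lemma unit_iso: "right_iso A M (induced (fixed_part M)) (unit M)"
proof (rule bij_right_iso[OF M induced_module[OF fixed_part_module[OF M]] unit_hom])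
  note V = fixed_part_module[OF M]
  show "bij_betw (unit M) (carrier M) (carrier (induced (fixed_part M)))"
  proof (rule bij_betwI')
    fix m m' assume m: "m \<in> carrier M" "m' \<in> carrier M"
    show "unit M m = unit M m' \<longleftrightarrow> m = m'"
    proof
      assume "unit M m = unit M m'"
      then have "(\<lambda>v\<in>Ae. v \<odot>\<^bsub>M\<^esub> m) = (\<lambda>v\<in>Ae. v \<odot>\<^bsub>M\<^esub> m')"
        using m enc_eq_iff[OF V orbit_mem orbit_mem] by (simp add: unit_def)
      then have eq: "v \<odot>\<^bsub>M\<^esub> m = v \<odot>\<^bsub>M\<^esub> m'" if "v \<in> Ae" for v using that by (metis restrict_apply')
      have "m = (\<Oplus>\<^bsub>M\<^esub>i\<in>{..<n}. y i \<odot>\<^bsub>M\<^esub> (x i \<odot>\<^bsub>M\<^esub> m))" by (rule orbit_reconstruct[OF m(1)])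
      also have "\<dots> = (\<Oplus>\<^bsub>M\<^esub>i\<in>{..<n}. y i \<odot>\<^bsub>M\<^esub> (x i \<odot>\<^bsub>M\<^esub> m'))"
        using eq x_mem m x_carrier y_carrier
          by (intro M.M.finsum_cong' refl) (auto simp: M.act_closed)
      also have "\<dots> = m'" by (rule orbit_reconstruct[OF m(2), symmetric])
      finally show "m = m'" .
    qed simp
  next
    fix m assume "m \<in> carrier M"
    then show "unit M m \<in> carrier (induced (fixed_part M))"
      using right_homD(2)[OF unit_hom] by blast
  next
    fix p assume "p \<in> carrier (induced (fixed_part M))"
    then obtain \<phi> where \<phi>: "\<phi> \<in> carrier (hom_space (fixed_part M))" "p = enc \<phi>"
      by (auto simp: induced_carrier[OF V])
    note h = hom_spaceD[OF \<phi>(1)]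
    have \<phi>x: "\<phi> (x i) \<in> carrier M" "e \<odot>\<^bsub>M\<^esub> \<phi> (x i) = \<phi> (x i)" if "i < n" for i
      using h(2)[OF x_mem[OF that]] by auto
    \<comment> \<open>\<open>orbit_reconstruct\<close> dictates the preimage:
      \<open>\<Sum> \<phi>(x_i) y_i\<close>.\<close>
    define m where "m = (\<Oplus>\<^bsub>M\<^esub>i\<in>{..<n}. y i \<odot>\<^bsub>M\<^esub> \<phi> (x i))"
    have m: "m \<in> carrier M" unfolding m_def using \<phi>x y_carrier
      by (intro M.M.finsum_closed) (auto simp: M.act_closed)
    have "v \<odot>\<^bsub>M\<^esub> m = \<phi> v" if v: "v \<in> Ae" for v
    proof -
      have "v \<odot>\<^bsub>M\<^esub> m = (\<Oplus>\<^bsub>M\<^esub>i\<in>{..<n}. v \<odot>\<^bsub>M\<^esub> (y i \<odot>\<^bsub>M\<^esub> \<phi> (x i)))"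
        unfolding m_def
          using \<phi>x y_carrier Ae_carrier[OF v] by (intro act_finsum) (auto simp: M.act_closed)
      also have "\<dots> = (\<Oplus>\<^bsub>M\<^esub>i\<in>{..<n}. \<phi> (\<pi> (y i \<cdot> v) \<bullet> x i))"
      proof (intro M.M.finsum_cong' refl)
        fix i assume "i \<in> {..<n}"
        then have i: "i < n" by simp
        note c = y_Ae_corner[OF i v] and k = \<pi>_closed[OF y_Ae_corner[OF i v]]
        have "v \<odot>\<^bsub>M\<^esub> (y i \<odot>\<^bsub>M\<^esub> \<phi> (x i)) = (y i \<cdot> v) \<odot>\<^bsub>M\<^esub> \<phi> (x i)"
          using \<phi>x[OF i] y_carrier[OF i] Ae_carrier[OF v] by (simp add: M.act_assoc)
        \<comment> \<open>\<open>y_i v\<close> is a multiple of \<open>e\<close>, and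
          \<open>\<phi>(x_i)\<close> is fixed by \<open>e\<close>; so \<open>y_i v\<close> acts on
          it as the scalar \<open>\<pi> (y_i v)\<close>, which linearity moves inside
          \<open>\<phi>\<close>.\<close>
        also have "y i \<cdot> v = e \<cdot> (\<pi> (y i \<cdot> v) \<bullet> \<one>\<^bsub>A\<^esub>)"
          using k e_carrier \<pi>_e[OF c] by (simp add: smult_one_mult)
        also have "\<dots> \<odot>\<^bsub>M\<^esub> \<phi> (x i) = (\<pi> (y i \<cdot> v) \<bullet> \<one>\<^bsub>A\<^esub>) \<odot>\<^bsub>M\<^esub> \<phi> (x i)"
          using k e_carrier \<phi>x[OF i] by (simp add: M.act_assoc)
        also have "\<dots> = \<phi> (\<pi> (y i \<cdot> v) \<bullet> x i)" using h(4)[OF k x_mem[OF i]] by simp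
        finally show "v \<odot>\<^bsub>M\<^esub> (y i \<odot>\<^bsub>M\<^esub> \<phi> (x i)) = \<phi> (\<pi> (y i \<cdot> v) \<bullet> x i)" .
      next
        have "\<pi> (y i \<cdot> v) \<bullet> x i \<in> Ae" if "i < n" for i
          using subspaceD(4)[OF Ae_subspace \<pi>_closed[OF y_Ae_corner[OF that v]] x_mem[OF that]] .
        then show "(\<lambda>i. \<phi> (\<pi> (y i \<cdot> v) \<bullet> x i)) \<in> {..<n} \<rightarrow> carrier M" using h(2) by auto
      qed
      also have "\<dots> = \<phi> (\<Oplus>\<^bsub>A\<^esub>i\<in>{..<n}. \<pi> (y i \<cdot> v) \<bullet> x i)"
      proof (rule finsum_additive_on[where W = Ae, symmetric])
        have "\<phi> (\<zero> \<bullet> \<zero>\<^bsub>A\<^esub>) = \<zero> \<odot>\<^bsub>fixed_part M\<^esub> \<phi> \<zero>\<^bsub>A\<^esub>"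
          by (rule h(4)) (use subspaceD(2)[OF Ae_subspace] in auto)
        then show "\<phi> \<zero>\<^bsub>A\<^esub> = \<zero>\<^bsub>M\<^esub>"
          using h(2)[OF subspaceD(2)[OF Ae_subspace]] by (simp add: M.zero_act)
        show "\<pi> (y i \<cdot> v) \<bullet> x i \<in> Ae" if "i \<in> {..<n}" for i
          using subspaceD(4)[OF Ae_subspace \<pi>_closed[OF y_Ae_corner[OF _ v]] x_mem] that by blast
      qed (use h subspaceD[OF Ae_subspace] A_abelian_monoid M.M.abelian_monoid_axioms in auto)
      also have "\<dots> = \<phi> v" using Ae_expand[OF v] by simp
      finally show ?thesis .
    qed
    then have "(\<lambda>v\<in>Ae. v \<odot>\<^bsub>M\<^esub> m) = \<phi>" by (auto intro!: extensionalityI[OF _ h(1)])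
    then show "\<exists>m\<in>carrier M. p = unit M m"
      using m \<phi>(2) by (intro bexI[of _ m]) (auto simp: unit_def)
  qed
qed

end

lemma unit_natural_iso:
  "natural_iso A A (\<lambda>M. M) (\<lambda>M N f. f) (\<lambda>M. induced (fixed_part M))
    (\<lambda>M N f. induced_hom (fixed_part M) (fixed_part N) (fixed_part_hom M N f)) unit"
  unfolding natural_iso_def
proof (intro conjI allI impI; (elim conjE)?)
  fix M :: "('c, 'u) module" assume "right_module A M"
  then show "right_iso A M (induced (fixed_part M)) (unit M)" by (rule unit_iso)
next
  fix M N :: "('c, 'u) module" and f
  assume M: "right_module A M" and N: "right_module A N" and f: "f \<in> right_hom A M N"
  have "unit N (f m) = induced_hom (fixed_part M) (fixed_part N) (fixed_part_hom M N f) (unit M m)"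
    if m: "m \<in> carrier M" for m
  proof -
    have "(\<lambda>v\<in>Ae. v \<odot>\<^bsub>N\<^esub> f m) = (\<lambda>v\<in>Ae. fixed_part_hom M N f ((\<lambda>v\<in>Ae. v \<odot>\<^bsub>M\<^esub> m) v))"
      using right_homD(4)[OF f] m Ae_carrier fixed_part_mem[OF M _ m]
      by (intro restrict_ext) (simp add: fixed_part_hom_def)
    then show ?thesis
      using m right_homD(2)[OF f m] induced_hom_enc[OF fixed_part_module[OF M] orbit_mem[OF M m]]
      by (simp add: unit_def)
  qed
  then show "compose (carrier M) (unit N) f =
      compose (carrier M) (induced_hom (fixed_part M) (fixed_part N) (fixed_part_hom M N f)) (unit M)"
    by (auto simp: compose_def)
qed

text \<open>Evaluation of the decoded map at \<open>e\<close>; on maps fixed by \<open>e\<close> no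
  information is lost.\<close>

definition counit :: "('a, 'u) module \<Rightarrow> 'u \<Rightarrow> 'u" where
  "counit V = (\<lambda>p\<in>carrier (fixed_part (induced V)). inv_into (carrier (hom_space V)) enc p e)"

lemma fixed_part_induced_cases:
  assumes V: "right_module FA V" and p: "p \<in> carrier (fixed_part (induced V))"
  obtains \<phi> where "\<phi> \<in> carrier (hom_space V)" "p = enc \<phi>" "\<And>v. v \<in> Ae \<Longrightarrow> \<phi> (e \<cdot> v) = \<phi> v"
proof -
  obtain \<phi> where \<phi>: "\<phi> \<in> carrier (hom_space V)" "p = enc \<phi>"
    using p by (auto simp: induced_carrier[OF V])
  have "enc (\<lambda>v\<in>Ae. \<phi> (e \<cdot> v)) = enc \<phi>" using p \<phi> induced_act[OF V e_carrier \<phi>(1)] by simp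
  then have "(\<lambda>v\<in>Ae. \<phi> (e \<cdot> v)) = \<phi>"
    using enc_eq_iff[OF V hom_space_act[OF V e_carrier \<phi>(1)] \<phi>(1)] by simp
  then have "\<phi> (e \<cdot> v) = \<phi> v" if "v \<in> Ae" for v using that by (metis restrict_apply')
  then show thesis using that \<phi> by blast
qed

lemma counit_enc:
  assumes V: "right_module FA V"
    and "enc \<phi> \<in> carrier (fixed_part (induced V))" "\<phi> \<in> carrier (hom_space V)"
  shows "counit V (enc \<phi>) = \<phi> e"
  using assms by (simp add: counit_def dec_enc[OF V])

lemma counit_hom:
  assumes V: "right_module FA V"
  shows "counit V \<in> right_hom FA (fixed_part (induced V)) V"
proof (rule right_homI)
  note TV = fixed_part_module[OF induced_module[OF V]]
  interpret TV: right_module FA "fixed_part (induced V)" by (rule TV)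
  show "counit V \<in> extensional (carrier (fixed_part (induced V)))" by (simp add: counit_def)
  fix p assume p: "p \<in> carrier (fixed_part (induced V))"
  obtain \<phi> where \<phi>: "\<phi> \<in> carrier (hom_space V)" "p = enc \<phi>"
    using fixed_part_induced_cases[OF V p] by metis
  note h = hom_spaceD[OF \<phi>(1)]
  have cp: "counit V p = \<phi> e" using counit_enc[OF V] p \<phi> by simp
  show "counit V p \<in> carrier V" using cp h(2)[OF e_principal(2)] by simp
  {
    fix q assume q: "q \<in> carrier (fixed_part (induced V))"
    obtain \<psi> where \<psi>: "\<psi> \<in> carrier (hom_space V)" "q = enc \<psi>"
      using fixed_part_induced_cases[OF V q] by metis
    have "p \<oplus>\<^bsub>fixed_part (induced V)\<^esub> q = enc (\<lambda>v\<in>Ae. \<phi> v \<oplus>\<^bsub>V\<^esub> \<psi> v)"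
      using \<phi> \<psi> by (simp add: induced_add[OF V])
    then show "counit V (p \<oplus>\<^bsub>fixed_part (induced V)\<^esub> q) = counit V p \<oplus>\<^bsub>V\<^esub> counit V q"
      using TV.M.a_closed[OF p q] counit_enc[OF V _ hom_space_add[OF V \<phi>(1) \<psi>(1)]] cp
        counit_enc[OF V _ \<psi>(1)] q \<psi>(2) e_principal(2) by simp
  }
  fix c assume c: "c \<in> carrier FA"
  have c1: "c \<bullet> \<one>\<^bsub>A\<^esub> \<in> carrier A" using c by simp
  have "c \<odot>\<^bsub>fixed_part (induced V)\<^esub> p = enc (\<lambda>v\<in>Ae. \<phi> ((c \<bullet> \<one>\<^bsub>A\<^esub>) \<cdot> v))"
    using \<phi> by (simp add: induced_act[OF V c1])
  then have "counit V (c \<odot>\<^bsub>fixed_part (induced V)\<^esub> p) = \<phi> ((c \<bullet> \<one>\<^bsub>A\<^esub>) \<cdot> e)"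
    using TV.act_closed[OF c p] counit_enc[OF V _ hom_space_act[OF V c1 \<phi>(1)]] e_principal(2)
      by simp
  also have "(c \<bullet> \<one>\<^bsub>A\<^esub>) \<cdot> e = c \<bullet> e" using c e_carrier by (simp add: smult_one_mult)
  also have "\<phi> (c \<bullet> e) = c \<odot>\<^bsub>V\<^esub> \<phi> e" using h(4) c e_principal(2) by simp
  finally show "counit V (c \<odot>\<^bsub>fixed_part (induced V)\<^esub> p) = c \<odot>\<^bsub>V\<^esub> counit V p" using cp by simp
qed

lemma e_Ae_corner: "v \<in> Ae \<Longrightarrow> e \<cdot> v \<in> corner e"
  by (rule principal_mult_corner[OF e_carrier e_principal(1)])

text \<open>A map \<open>\<chi>\<close> fixed by \<open>e\<close> satisfies
  \<open>\<chi> v = \<chi> (e v) = \<pi> (e v) \<chi> e\<close>, since \<open>e v\<close> is a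
  multiple of \<open>e\<close>. So its value at \<open>e\<close> determines it.\<close>

lemma counit_iso:
  assumes V: "right_module FA V"
  shows "right_iso FA (fixed_part (induced V)) V (counit V)"
proof (rule bij_right_iso[OF fixed_part_module[OF induced_module[OF V]] V counit_hom[OF V]])
  interpret V: right_module FA V by (rule V)
  show "bij_betw (counit V) (carrier (fixed_part (induced V))) (carrier V)"
  proof (rule bij_betwI')
    fix p q assume p: "p \<in> carrier (fixed_part (induced V))"
      and q: "q \<in> carrier (fixed_part (induced V))"
    obtain \<phi> where \<phi>: "\<phi> \<in> carrier (hom_space V)" "p = enc \<phi>" "\<And>v. v \<in> Ae \<Longrightarrow> \<phi> (e \<cdot> v) = \<phi> v"
      using fixed_part_induced_cases[OF V p] by metis
    obtain \<psi> where \<psi>: "\<psi> \<in> carrier (hom_space V)" "q = enc \<psi>" "\<And>v. v \<in> Ae \<Longrightarrow> \<psi> (e \<cdot> v) = \<psi> v"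
      using fixed_part_induced_cases[OF V q] by metis
    have val: "\<chi> v = \<pi> (e \<cdot> v) \<odot>\<^bsub>V\<^esub> \<chi> e"
      if "\<chi> \<in> carrier (hom_space V)" "\<And>v. v \<in> Ae \<Longrightarrow> \<chi> (e \<cdot> v) = \<chi> v" "v \<in> Ae" for \<chi> v
      using that(2)[OF that(3)] \<pi>_e[OF e_Ae_corner[OF that(3)]]
        hom_spaceD(4)[OF that(1) \<pi>_closed[OF e_Ae_corner[OF that(3)]] e_principal(2)] by simp
    show "counit V p = counit V q \<longleftrightarrow> p = q"
    proof
      assume "counit V p = counit V q"
      then have "\<phi> e = \<psi> e" using counit_enc[OF V] p q \<phi> \<psi> by simp
      then have "\<phi> v = \<psi> v" if "v \<in> Ae" for v using val[OF \<phi>(1,3) that] val[OF \<psi>(1,3) that] by simp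
      then have "\<phi> = \<psi>"
        using extensionalityI[OF hom_spaceD(1)[OF \<phi>(1)] hom_spaceD(1)[OF \<psi>(1)]] by blast
      then show "p = q" using \<phi>(2) \<psi>(2) by simp
    qed simp
  next
    fix p assume "p \<in> carrier (fixed_part (induced V))"
    then show "counit V p \<in> carrier V" using right_homD(2)[OF counit_hom[OF V]] by blast
  next
    fix u assume u: "u \<in> carrier V"
    \<comment> \<open>The formula for fixed maps leaves this as the only candidate with value
      \<open>u\<close> at \<open>e\<close>.\<close>
    define \<phi> where "\<phi> = (\<lambda>v\<in>Ae. \<pi> (e \<cdot> v) \<odot>\<^bsub>V\<^esub> u)"
    have k: "\<pi> (e \<cdot> v) \<in> carrier FA" if "v \<in> Ae" for v
      using \<pi>_closed[OF e_Ae_corner[OF that]] by simp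
    have \<phi>: "\<phi> \<in> carrier (hom_space V)"
    proof (rule hom_spaceI)
      fix v assume v: "v \<in> Ae"
      show "\<phi> v \<in> carrier V" using v u k V.act_closed by (simp add: \<phi>_def)
      show "\<phi> (v \<oplus>\<^bsub>A\<^esub> w) = \<phi> v \<oplus>\<^bsub>V\<^esub> \<phi> w" if w: "w \<in> Ae" for w
        using v w u V.act_scalar_distr[OF k[OF v] k[OF w] u] subspaceD(3)[OF Ae_subspace v w]
          \<pi>_add[OF e_Ae_corner[OF v] e_Ae_corner[OF w]] Ae_carrier e_carrier
        by (simp add: \<phi>_def r_distr)
      show "\<phi> (c \<bullet> v) = c \<odot>\<^bsub>V\<^esub> \<phi> v" if c: "c \<in> carrier F" for c
        using v c u V.act_assoc[OF k[OF v] _ u, of c] subspaceD(4)[OF Ae_subspace c v] k[OF v]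
          \<pi>_smult[OF c e_Ae_corner[OF v]] Ae_carrier e_carrier
        by (simp add: \<phi>_def smult_mult_right R.m_comm)
    qed (simp add: \<phi>_def)
    have "(\<lambda>v\<in>Ae. \<phi> (e \<cdot> v)) = \<phi>"
      unfolding \<phi>_def using Ae_left[OF e_carrier] Ae_carrier cornerD(2)[OF e_Ae_corner]
      by (auto intro!: restrict_ext)
    then have p: "enc \<phi> \<in> carrier (fixed_part (induced V))"
      using \<phi> induced_act[OF V e_carrier \<phi>] by (simp add: induced_carrier[OF V])
    have "\<phi> e = u" using e_principal(2) e_idem \<pi>_one V.act_one[OF u] by (simp add: \<phi>_def)
    then show "\<exists>p\<in>carrier (fixed_part (induced V)). u = counit V p"
      using p counit_enc[OF V p \<phi>] by (intro bexI[of _ "enc \<phi>"]) simp_all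
  qed
qed

lemma counit_natural_iso:
  "natural_iso FA FA (\<lambda>V. fixed_part (induced V))
    (\<lambda>V W f. fixed_part_hom (induced V) (induced W) (induced_hom V W f)) (\<lambda>V. V) (\<lambda>V W f. f) counit"
  unfolding natural_iso_def
proof (intro conjI allI impI; (elim conjE)?)
  fix V :: "('a, 'u) module" assume "right_module FA V"
  then show "right_iso FA (fixed_part (induced V)) V (counit V)" by (rule counit_iso)
next
  fix V W :: "('a, 'u) module" and f
  assume V: "right_module FA V" and W: "right_module FA W" and f: "f \<in> right_hom FA V W"
  note t = fixed_part_hom_mem[OF induced_module[OF V] induced_module[OF W] induced_hom_mem[OF V W f]]
  have "counit W (fixed_part_hom (induced V) (induced W) (induced_hom V W f) p) = f (counit V p)"
    if p: "p \<in> carrier (fixed_part (induced V))" for p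
  proof -
    obtain \<phi> where \<phi>: "\<phi> \<in> carrier (hom_space V)" "p = enc \<phi>"
      using fixed_part_induced_cases[OF V p] by metis
    have "fixed_part_hom (induced V) (induced W) (induced_hom V W f) p = enc (\<lambda>v\<in>Ae. f (\<phi> v))"
      using p \<phi> by (simp add: fixed_part_hom_def induced_hom_enc[OF V])
    then show ?thesis
      using right_homD(2)[OF t p] counit_enc[OF W _ hom_space_push[OF V f \<phi>(1)]]
        counit_enc[OF V _ \<phi>(1)] p \<phi>(2) e_principal(2) by simp
  qed
  then show "compose (carrier (fixed_part (induced V))) (counit W)
      (fixed_part_hom (induced V) (induced W) (induced_hom V W f)) =
      compose (carrier (fixed_part (induced V))) f (counit V)"
    by (auto simp: compose_def)
qed

lemma morita_equivalent_self_algebra: "morita_equivalent TYPE('u) F A FA"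
  unfolding morita_equivalent_def
  using fixed_part_functor induced_functor unit_natural_iso counit_natural_iso by blast

end

lemma (in unital_algebra) full_split_morita_equivalent:
  assumes fs: "full_split_idempotent e" and inf: "infinite (UNIV :: 'u set)"
  shows "morita_equivalent TYPE('u) F A (self_algebra F)"
proof -
  obtain n :: nat and x y where xy: "\<And>i. i < n \<Longrightarrow> x i \<in> principal_left e"
      "\<And>i. i < n \<Longrightarrow> y i \<in> principal_right e"
    and one: "(\<Oplus>\<^bsub>A\<^esub>i\<in>{..<n}. x i \<cdot> y i) = \<one>\<^bsub>A\<^esub>"
    using fs unfolding full_split_idempotent_def by blast
  obtain code :: "'u list \<Rightarrow> 'u" where code: "inj_on code {us. length us = n}"
    using fixed_length_list_code[OF inf] by blast
  interpret corner_character F A e "residue e {\<zero>\<^bsub>A\<^esub>}"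
    by (rule full_split_corner_character(1)[OF fs])
  interpret split_system F A e "residue e {\<zero>\<^bsub>A\<^esub>}" n x y code
    using xy one code full_split_corner_character(2)[OF fs] by unfold_locales auto
  show ?thesis by (rule morita_equivalent_self_algebra)
qed


section \<open>The idempotent given by an equivalence\<close>

lemma right_iso_bij:
  assumes "right_iso R M N f"
  shows "f \<in> right_hom R M N" "inj_on f (carrier M)" "f ` carrier M = carrier N"
proof -
  obtain g where f: "f \<in> right_hom R M N" and g: "g \<in> right_hom R N M"
    and gf: "compose (carrier M) g f = hom_id M" and fg: "compose (carrier N) f g = hom_id N"
    using assms unfolding right_iso_def by blast
  have 1: "g (f x) = x" if "x \<in> carrier M" for x
    using fun_cong[OF gf, of x] that by (simp add: compose_def hom_id_def)
  have 2: "f (g y) = y" if "y \<in> carrier N" for y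
    using fun_cong[OF fg, of y] that by (simp add: compose_def hom_id_def)
  show "f \<in> right_hom R M N" by (rule f)
  show "inj_on f (carrier M)" using 1 by (rule inj_on_inverseI)
  show "f ` carrier M = carrier N"
    using 2 right_homD(2)[OF f] right_homD(2)[OF g]
      by (metis image_eqI image_subsetI subsetI subset_antisym)
qed

lemma right_hom_compose:
  assumes "right_module R M" and f: "f \<in> right_hom R M N" and g: "g \<in> right_hom R N P"
  shows "compose (carrier M) g f \<in> right_hom R M P"
proof -
  interpret M: right_module R M by fact
  show ?thesis
    using right_homD[OF f] right_homD[OF g] M.act_closed
    by (intro right_homI) (auto simp: compose_def)
qed

lemma right_hom_id:
  assumes "right_module R M"
  shows "hom_id M \<in> right_hom R M M"
proof -
  interpret M: right_module R M by fact
  show ?thesis using M.act_closed by (intro right_homI) (auto simp: hom_id_def)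
qed

locale linear_equivalence =
  T: linear_functor F A B T t + S: linear_functor F B A S s
  for F :: "('f, 'm) ring_scheme" and A :: "('f, 'a, 'n) module_scheme"
    and B :: "('f, 'b, 'k) module_scheme"
    and T :: "('a, 'u) module \<Rightarrow> ('b, 'u) module" and t and S and s +
  fixes \<eta> :: "('a, 'u) module \<Rightarrow> 'u \<Rightarrow> 'u" and \<epsilon> :: "('b, 'u) module \<Rightarrow> 'u \<Rightarrow> 'u"
  assumes unit: "natural_iso A A (\<lambda>M. M) (\<lambda>M N f. f) (\<lambda>M. S (T M)) (\<lambda>M N f. s (T M) (T N) (t M N f)) \<eta>"
    and counit: "natural_iso B B (\<lambda>M. T (S M)) (\<lambda>M N f. t (S M) (S N) (s M N f)) (\<lambda>M. M) (\<lambda>M N f. f) \<epsilon>"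
begin

lemma unit_right_iso: "right_module A M \<Longrightarrow> right_iso A M (S (T M)) (\<eta> M)"
  using unit by (simp add: natural_iso_def)

lemma counit_right_iso: "right_module B V \<Longrightarrow> right_iso B (T (S V)) V (\<epsilon> V)"
  using counit by (simp add: natural_iso_def)

lemma unit_natural:
  assumes "right_module A M" "right_module A N" "f \<in> right_hom A M N" and m: "m \<in> carrier M"
  shows "\<eta> N (f m) = s (T M) (T N) (t M N f) (\<eta> M m)"
proof -
  have "compose (carrier M) (\<eta> N) f = compose (carrier M) (s (T M) (T N) (t M N f)) (\<eta> M)"
    using unit assms by (simp add: natural_iso_def)
  from fun_cong[OF this, of m] show ?thesis using m by (simp add: compose_def)
qed

lemma counit_natural:
  assumes "right_module B V" "right_module B W" "f \<in> right_hom B V W" and p: "p \<in> carrier (T (S V))"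
  shows "\<epsilon> W (t (S V) (S W) (s V W f) p) = f (\<epsilon> V p)"
proof -
  have "compose (carrier (T (S V))) (\<epsilon> W) (t (S V) (S W) (s V W f)) = compose (carrier (T (S V))) f (\<epsilon> V)"
    using counit assms by (simp add: natural_iso_def)
  from fun_cong[OF this, of p] show ?thesis using p by (simp add: compose_def)
qed

text \<open>\<open>\<eta> N\<close> is injective, and naturality expresses
  \<open>\<eta> N (f m)\<close> through \<open>t M N f\<close>.\<close>

lemma faithful:
  assumes M: "right_module A M" and N: "right_module A N" and f: "f \<in> right_hom A M N"
    and g: "g \<in> right_hom A M N" and eq: "t M N f = t M N g"
  shows "f = g"
proof (rule right_hom_eqI[OF f g])
  fix m assume m: "m \<in> carrier M"
  have "\<eta> N (f m) = \<eta> N (g m)" using unit_natural[OF M N f m] unit_natural[OF M N g m] eq by simp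
  then show "f m = g m"
    using right_iso_bij(2)[OF unit_right_iso[OF N]] right_homD(2)[OF f m] right_homD(2)[OF g m]
    by (auto dest: inj_onD)
qed

text \<open>\<open>\<epsilon> V\<close> is surjective, and naturality determines
  \<open>f (\<epsilon> V p)\<close> from \<open>s V W f\<close>.\<close>

lemma inverse_faithful:
  assumes V: "right_module B V" and W: "right_module B W" and f: "f \<in> right_hom B V W"
    and g: "g \<in> right_hom B V W" and eq: "s V W f = s V W g"
  shows "f = g"
proof (rule right_hom_eqI[OF f g])
  fix v assume "v \<in> carrier V"
  then obtain p where p: "p \<in> carrier (T (S V))" "v = \<epsilon> V p"
    using right_iso_bij(3)[OF counit_right_iso[OF V]] by blast
  show "f v = g v" using counit_natural[OF V W f p(1)] counit_natural[OF V W g p(1)] eq p(2) by simp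
qed

text \<open>The candidate is \<open>g = \<eta>_N^(-1) s(h) \<eta>_M\<close>. Naturality gives
  \<open>s(t(g)) = s(h)\<close>, and faithfulness of the inverse functor removes
  \<open>s\<close>.\<close>

lemma full:
  assumes M: "right_module A M" and N: "right_module A N" and h: "h \<in> right_hom B (T M) (T N)"
  shows "\<exists>g\<in>right_hom A M N. t M N g = h"
proof -
  note TM = T.on_objects[OF M] and TN = T.on_objects[OF N]
  note STM = S.on_objects[OF TM] and STN = S.on_objects[OF TN]
  note sh = S.on_homs[OF TM TN h]
  note \<eta>M = right_iso_bij[OF unit_right_iso[OF M]]
  obtain k where k: "k \<in> right_hom A (S (T N)) N"
    and k2: "compose (carrier (S (T N))) (\<eta> N) k = hom_id (S (T N))"
    using unit_right_iso[OF N] unfolding right_iso_def by blast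
  have \<eta>k: "\<eta> N (k q) = q" if "q \<in> carrier (S (T N))" for q
    using fun_cong[OF k2, of q] that by (simp add: compose_def hom_id_def)
  define g where "g = compose (carrier M) k (compose (carrier M) (s (T M) (T N) h) (\<eta> M))"
  have g: "g \<in> right_hom A M N"
    unfolding g_def by (rule right_hom_compose[OF M right_hom_compose[OF M \<eta>M(1) sh] k])
  have "s (T M) (T N) (t M N g) = s (T M) (T N) h"
  proof (rule right_hom_eqI[OF S.on_homs[OF TM TN T.on_homs[OF M N g]] sh])
    fix q assume "q \<in> carrier (S (T M))"
    then obtain m where m: "m \<in> carrier M" "q = \<eta> M m" using \<eta>M(3) by blast
    have "s (T M) (T N) (t M N g) q = \<eta> N (g m)" using unit_natural[OF M N g m(1)] m(2) by simp
    also have "\<dots> = s (T M) (T N) h q"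
      using m \<eta>k right_homD(2)[OF sh] right_homD(2)[OF \<eta>M(1) m(1)] by (simp add: g_def compose_def)
    finally show "s (T M) (T N) (t M N g) q = s (T M) (T N) h q" .
  qed
  then have "t M N g = h" using inverse_faithful[OF TM TN T.on_homs[OF M N g] h] by simp
  then show ?thesis using g by blast
qed

end

section \<open>The module that corresponds to the field\<close>

context unital_algebra
begin

lemma self_algebra_module: "right_module (self_algebra F) (self_algebra F)"
proof (rule right_moduleI)
  show F: "ring (self_algebra F)" by (rule R.self_algebra_ring)
  then show "abelian_group (self_algebra F)" by (rule ring.is_abelian_group)
qed (auto simp: R.l_distr R.r_distr R.m_assoc R.m_comm R.m_lcomm)

lemma scalar_hom:
  assumes M: "right_module A M" and c: "c \<in> carrier F"
  shows "hom_scale A M M c (hom_id M) \<in> right_hom A M M"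
proof -
  interpret M: right_module A M by fact
  have c1: "c \<bullet> \<one>\<^bsub>A\<^esub> \<in> carrier A" using c by simp
  show ?thesis
    using c c1 M.act_closed
    by (intro right_homI) (auto simp: hom_scale_def hom_id_def M.act_add_distr smult_one_mult simp flip: M.act_assoc)
qed

end

text \<open>The injections \<open>gF\<close> and \<open>gA\<close> place copies of the regular
  modules of \<open>F\<close> and \<open>A\<close>, and quotients of the latter, in the universe on
  which the functors operate.\<close>

locale morita_to_field = unital_algebra F A + linear_equivalence F A "self_algebra F" T t S s \<eta> \<epsilon>
  for F :: "('f, 'm) ring_scheme" (structure) and A :: "('f, 'a, 'n) module_scheme" (structure)
    and T :: "('a, 'u) module \<Rightarrow> ('f, 'u) module" and t S s \<eta> \<epsilon> +
  fixes gF :: "'f \<Rightarrow> 'u" and gA :: "'a \<Rightarrow> 'u"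
  assumes gF: "inj_on gF (carrier F)" and gA: "inj_on gA (carrier A)"
begin

abbreviation "FA \<equiv> self_algebra F"

text \<open>A map is zero iff it equals \<open>0\<close> times itself; the functor preserves scalar
  multiples and is faithful.\<close>

lemma t_zero_iff:
  assumes M: "right_module A M" and N: "right_module A N" and f: "f \<in> right_hom A M N"
  shows "(\<forall>p\<in>carrier (T M). t M N f p = \<zero>\<^bsub>T N\<^esub>) \<longleftrightarrow> (\<forall>m\<in>carrier M. f m = \<zero>\<^bsub>N\<^esub>)"
proof -
  note TM = T.on_objects[OF M] and TN = T.on_objects[OF N] and tf = T.on_homs[OF M N f]
  interpret N: right_module A N by fact
  interpret TN: right_module FA "T N" by fact
  have z: "hom_scale A M N \<zero> f = (\<lambda>m\<in>carrier M. \<zero>\<^bsub>N\<^esub>)"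
    using right_homD(2)[OF f] by (auto simp: hom_scale_def N.zero_act)
  have tz: "hom_scale FA (T M) (T N) \<zero> (t M N f) = (\<lambda>p\<in>carrier (T M). \<zero>\<^bsub>T N\<^esub>)"
    using right_homD(2)[OF tf] TN.zero_act by (auto simp: hom_scale_def)
  have z_hom: "hom_scale A M N \<zero> f \<in> right_hom A M N"
  proof -
    interpret M: right_module A M by fact
    show ?thesis unfolding z using M.act_closed by (intro right_homI) (auto simp: N.act_zero)
  qed
  have "(\<forall>m\<in>carrier M. f m = \<zero>\<^bsub>N\<^esub>) \<longleftrightarrow> f = hom_scale A M N \<zero> f"
    unfolding z
      using right_homD(1)[OF f] by (auto intro!: extensionalityI[OF right_homD(1)[OF f]] dest: fun_cong)
  also have "\<dots> \<longleftrightarrow> t M N f = t M N (hom_scale A M N \<zero> f)"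
    using faithful[OF M N f z_hom] by auto
  also have "t M N (hom_scale A M N \<zero> f) = (\<lambda>p\<in>carrier (T M). \<zero>\<^bsub>T N\<^esub>)"
    using T.preserves_scale[OF M N _ f, of \<zero>] tz by simp
  also have "t M N f = (\<lambda>p\<in>carrier (T M). \<zero>\<^bsub>T N\<^esub>) \<longleftrightarrow> (\<forall>p\<in>carrier (T M). t M N f p = \<zero>\<^bsub>T N\<^esub>)"
    by (auto intro!: extensionalityI[OF right_homD(1)[OF tf]])
  finally show ?thesis by simp
qed

text \<open>The module corresponding to \<open>F\<close> under the equivalence; \<open>coordinate\<close> identifies its image
  \<open>T generator\<close> with \<open>F\<close>.\<close>

definition generator :: "('a, 'u) module" where
  "generator = S (transport gF FA)"

definition coordinate :: "'u \<Rightarrow> 'f" where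
  "coordinate p = inv_into (carrier F) gF (\<epsilon> (transport gF FA) p)"

interpretation FU: module_congruence FA FA gF
  by (rule right_module.inj_module_congruence[OF self_algebra_module]) (simp add: gF)

lemma generator_module: "right_module A generator"
  unfolding generator_def by (rule S.on_objects[OF FU.transport_module])

lemma T_generator_module: "right_module FA (T generator)"
  by (rule T.on_objects[OF generator_module])

lemma coordinate_closed: "p \<in> carrier (T generator) \<Longrightarrow> coordinate p \<in> carrier F"
  and coordinate_add: "\<lbrakk>p \<in> carrier (T generator); q \<in> carrier (T generator)\<rbrakk> \<Longrightarrow>
    coordinate (p \<oplus>\<^bsub>T generator\<^esub> q) = coordinate p \<oplus> coordinate q"
  and coordinate_act: "\<lbrakk>c \<in> carrier F; p \<in> carrier (T generator)\<rbrakk> \<Longrightarrow>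
    coordinate (c \<odot>\<^bsub>T generator\<^esub> p) = c \<otimes> coordinate p"
  and coordinate_inj: "inj_on coordinate (carrier (T generator))"
  and coordinate_surj: "coordinate ` carrier (T generator) = carrier F"
proof -
  let ?Fu = "transport gF FA"
  note iso = right_iso_bij[OF counit_right_iso[OF FU.transport_module], folded generator_def]
  have dec: "inv_into (carrier F) gF (gF c) = c" if "c \<in> carrier F" for c
    using that by (rule inv_into_f_f[OF gF])
  have cases: "\<exists>c\<in>carrier F. \<epsilon> ?Fu p = gF c" if "p \<in> carrier (T generator)" for p
    using right_homD(2)[OF iso(1) that] FU.transport_carrier by auto
  have val: "coordinate p \<in> carrier F" "\<epsilon> ?Fu p = gF (coordinate p)" if "p \<in> carrier (T generator)"
    for p
    using cases[OF that] dec by (auto simp: coordinate_def)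
  show "coordinate p \<in> carrier F" if "p \<in> carrier (T generator)" for p using val that by simp
  show "coordinate (p \<oplus>\<^bsub>T generator\<^esub> q) = coordinate p \<oplus> coordinate q"
    if p: "p \<in> carrier (T generator)" and q: "q \<in> carrier (T generator)" for p q
  proof -
    have "\<epsilon> ?Fu (p \<oplus>\<^bsub>T generator\<^esub> q) = gF (coordinate p \<oplus> coordinate q)"
      using right_homD(3)[OF iso(1) p q] val[OF p] val[OF q] FU.transport_add by simp
    then show ?thesis
      using dec val[OF p] val[OF q] by (simp add: coordinate_def[of "p \<oplus>\<^bsub>T generator\<^esub> q"])
  qed
  show "coordinate (c \<odot>\<^bsub>T generator\<^esub> p) = c \<otimes> coordinate p"
    if c: "c \<in> carrier F" and p: "p \<in> carrier (T generator)" for c p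
  proof -
    have "\<epsilon> ?Fu (c \<odot>\<^bsub>T generator\<^esub> p) = gF (c \<otimes> coordinate p)"
      using right_homD(4)[OF iso(1) _ p, of c] c val[OF p] FU.transport_act by simp
    then show ?thesis using dec val[OF p] c by (simp add: coordinate_def[of "c \<odot>\<^bsub>T generator\<^esub> p"])
  qed
  show "inj_on coordinate (carrier (T generator))"
    using val(2) iso(2) by (metis inj_on_def)
  have "c \<in> coordinate ` carrier (T generator)" if c: "c \<in> carrier F" for c
  proof -
    have "gF c \<in> \<epsilon> ?Fu ` carrier (T generator)" using c iso(3) FU.transport_carrier by auto
    then obtain p where "p \<in> carrier (T generator)" "gF c = \<epsilon> ?Fu p" by blast
    then show ?thesis using dec[OF c] by (intro image_eqI[of _ _ p]) (auto simp: coordinate_def)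
  qed
  then show "coordinate ` carrier (T generator) = carrier F" using val by blast
qed

lemma unit_vector_exists: "\<exists>w\<in>carrier (T generator). coordinate w = \<one>"
  using coordinate_surj R.one_closed by (metis imageE)

lemma coordinate_zero: "coordinate \<zero>\<^bsub>T generator\<^esub> = \<zero>"
proof -
  interpret G: right_module FA "T generator" by (rule T_generator_module)
  have "coordinate (\<zero> \<odot>\<^bsub>T generator\<^esub> \<zero>\<^bsub>T generator\<^esub>) = \<zero> \<otimes> coordinate \<zero>\<^bsub>T generator\<^esub>"
    by (rule coordinate_act) auto
  then show ?thesis using G.act_zero[of \<zero>] coordinate_closed[of "\<zero>\<^bsub>T generator\<^esub>"] by simp
qed

text \<open>An endomorphism of the one-dimensional \<open>T generator\<close> is multiplication by
  its value at the unit vector; faithfulness carries this scalar back.\<close>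

lemma generator_end:
  assumes h: "h \<in> right_hom A generator generator"
  shows "\<exists>c\<in>carrier F. \<forall>p\<in>carrier generator. h p = (c \<bullet> \<one>\<^bsub>A\<^esub>) \<odot>\<^bsub>generator\<^esub> p"
proof -
  let ?P = generator and ?th = "t generator generator h"
  note P = generator_module
  interpret G: right_module FA "T ?P" by (rule T_generator_module)
  note th = right_homD[OF T.on_homs[OF P P h]]
  obtain w where w: "w \<in> carrier (T ?P)" "coordinate w = \<one>" using unit_vector_exists by blast
  define c where "c = coordinate (?th w)"
  have c: "c \<in> carrier F" unfolding c_def using coordinate_closed th(2) w by blast
  have th_eq: "?th q = c \<odot>\<^bsub>T ?P\<^esub> q" if q: "q \<in> carrier (T ?P)" for q
  proof -
    have k: "coordinate q \<in> carrier F" using coordinate_closed q by blast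
    have "coordinate (coordinate q \<odot>\<^bsub>T ?P\<^esub> w) = coordinate q"
      using coordinate_act[OF k w(1)] w(2) k by simp
    then have "q = coordinate q \<odot>\<^bsub>T ?P\<^esub> w"
      using inj_onD[OF coordinate_inj] q G.act_closed[of "coordinate q" w] k w(1) by simp
    then have "?th q = coordinate q \<odot>\<^bsub>T ?P\<^esub> ?th w" using th(4)[of "coordinate q" w] k w(1) by simp
    then have "coordinate (?th q) = coordinate q \<otimes> c"
      using coordinate_act[OF k th(2)[OF w(1)]] by (simp add: c_def)
    also have "\<dots> = coordinate (c \<odot>\<^bsub>T ?P\<^esub> q)"
      using coordinate_act[OF c q] c k by (simp add: R.m_comm)
    finally show ?thesis
      using inj_onD[OF coordinate_inj] th(2)[OF q] G.act_closed[of c q] c q by simp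
  qed
  have "t ?P ?P (hom_scale A ?P ?P c (hom_id ?P)) = hom_scale FA (T ?P) (T ?P) c (hom_id (T ?P))"
    using T.preserves_scale[OF P P c right_hom_id[OF P]] T.preserves_id[OF P] by simp
  also have "\<dots> = ?th"
    using th_eq c by (intro extensionalityI[OF _ th(1)]) (auto simp: hom_scale_def hom_id_def)
  finally have "h = hom_scale A ?P ?P c (hom_id ?P)"
    using faithful[OF P P h scalar_hom[OF P c]] by simp
  then show ?thesis using c by (auto simp: hom_scale_def hom_id_def)
qed

text \<open>The linear map \<open>F \<rightarrow> T M\<close> that sends \<open>1\<close> to
  \<open>w\<close>, with \<open>T generator\<close> in place of \<open>F\<close>.\<close>

lemma coordinate_hom:
  assumes M: "right_module A M" and w: "w \<in> carrier (T M)"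
  shows "(\<lambda>q\<in>carrier (T generator). coordinate q \<odot>\<^bsub>T M\<^esub> w) \<in> right_hom FA (T generator) (T M)"
proof -
  interpret TM: right_module FA "T M" by (rule T.on_objects[OF M])
  interpret G: right_module FA "T generator" by (rule T_generator_module)
  have scal: "(c \<otimes> d) \<odot>\<^bsub>T M\<^esub> w = c \<odot>\<^bsub>T M\<^esub> (d \<odot>\<^bsub>T M\<^esub> w)" if "c \<in> carrier F" "d \<in> carrier F" for c d
    using TM.act_assoc[of d c w] that w by (simp add: R.m_comm)
  show ?thesis
    using w TM.act_closed TM.act_scalar_distr G.act_closed coordinate_closed scal
    by (intro right_homI) (auto simp: coordinate_add coordinate_act)
qed

text \<open>The identity of \<open>M\<close> is not zero, so \<open>T M\<close> contains some
  \<open>w \<noteq> 0\<close>. Fullness lifts the linear map with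
  \<open>1 \<mapsto> w\<close>.\<close>

lemma generator_hom_exists:
  fixes M :: "('a, 'u) module"
  assumes M: "right_module A M" and m: "m \<in> carrier M" "m \<noteq> \<zero>\<^bsub>M\<^esub>"
  shows "\<exists>h\<in>right_hom A generator M. \<exists>p\<in>carrier generator. h p \<noteq> \<zero>\<^bsub>M\<^esub>"
proof -
  note TM = T.on_objects[OF M]
  interpret TM: right_module FA "T M" by (rule TM)
  have "\<not> (\<forall>m\<in>carrier M. hom_id M m = \<zero>\<^bsub>M\<^esub>)" using m by (auto simp: hom_id_def)
  then obtain w where w: "w \<in> carrier (T M)" "w \<noteq> \<zero>\<^bsub>T M\<^esub>"
    using t_zero_iff[OF M M right_hom_id[OF M]] T.preserves_id[OF M] by (auto simp: hom_id_def)
  obtain h where h: "h \<in> right_hom A generator M"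
    and th: "t generator M h = (\<lambda>q\<in>carrier (T generator). coordinate q \<odot>\<^bsub>T M\<^esub> w)"
    using full[OF generator_module M coordinate_hom[OF M w(1)]] by blast
  obtain u where u: "u \<in> carrier (T generator)" "coordinate u = \<one>" using unit_vector_exists by blast
  have "t generator M h u = w" using u TM.act_one[OF w(1)] by (simp add: th)
  then have "\<not> (\<forall>p\<in>carrier generator. h p = \<zero>\<^bsub>M\<^esub>)"
    using t_zero_iff[OF generator_module M h] u w(2) by auto
  then show ?thesis using h by blast
qed

text \<open>On the side of vector spaces a nonzero functional has a section: rescale a vector on
  which it does not vanish to value \<open>1\<close>. Fullness lifts the section, and faithfulness
  lifts the equation.\<close>

lemma generator_hom_splits:
  fixes M :: "('a, 'u) module"
  assumes M: "right_module A M" and f: "f \<in> right_hom A M generator"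
    and m: "m \<in> carrier M" "f m \<noteq> \<zero>\<^bsub>generator\<^esub>"
  shows "\<exists>r\<in>right_hom A generator M. \<forall>p\<in>carrier generator. f (r p) = p"
proof -
  let ?P = generator
  note P = generator_module and tf = right_homD[OF T.on_homs[OF M generator_module f]]
  interpret TM: right_module FA "T M" by (rule T.on_objects[OF M])
  interpret G: right_module FA "T ?P" by (rule T_generator_module)
  obtain u where u: "u \<in> carrier (T M)" "t M ?P f u \<noteq> \<zero>\<^bsub>T ?P\<^esub>"
    using t_zero_iff[OF M P f] m by auto
  define a where "a = coordinate (t M ?P f u)"
  have a: "a \<in> carrier F" unfolding a_def using coordinate_closed tf(2) u(1) by blast
  have "a \<noteq> \<zero>"
    using inj_onD[OF coordinate_inj _ tf(2)[OF u(1)] G.M.zero_closed] coordinate_zero u(2)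
      by (auto simp: a_def)
  then have a_inv: "inv a \<in> carrier F" "inv a \<otimes> a = \<one>" using a by (auto simp: field_Units)
  define w where "w = inv a \<odot>\<^bsub>T M\<^esub> u"
  have w: "w \<in> carrier (T M)" unfolding w_def using TM.act_closed[of "inv a" u] a_inv u by simp
  have "t M ?P f w = inv a \<odot>\<^bsub>T ?P\<^esub> t M ?P f u" unfolding w_def
    using tf(4)[of "inv a" u] a_inv u by simp
  then have fw: "coordinate (t M ?P f w) = \<one>"
    using coordinate_act[OF a_inv(1) tf(2)[OF u(1)]] a_inv by (simp add: a_def)
  obtain r where r: "r \<in> right_hom A ?P M"
    and tr: "t ?P M r = (\<lambda>q\<in>carrier (T ?P). coordinate q \<odot>\<^bsub>T M\<^esub> w)"
    using full[OF P M coordinate_hom[OF M w]] by blast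
  have "t ?P ?P (compose (carrier ?P) f r) = compose (carrier (T ?P)) (t M ?P f) (t ?P M r)"
    by (rule T.preserves_comp[OF P M P r f])
  also have "\<dots> = hom_id (T ?P)"
  proof -
    have "t M ?P f (coordinate q \<odot>\<^bsub>T M\<^esub> w) = q" if q: "q \<in> carrier (T ?P)" for q
    proof -
      have k: "coordinate q \<in> carrier F" using coordinate_closed q by blast
      have "t M ?P f (coordinate q \<odot>\<^bsub>T M\<^esub> w) = coordinate q \<odot>\<^bsub>T ?P\<^esub> t M ?P f w"
        using tf(4)[of "coordinate q" w] k w by simp
      moreover have "coordinate (coordinate q \<odot>\<^bsub>T ?P\<^esub> t M ?P f w) = coordinate q"
        using coordinate_act[OF k tf(2)[OF w]] fw k by simp
      ultimately show ?thesis
        using inj_onD[OF coordinate_inj _ _ q] G.act_closed[of "coordinate q" "t M ?P f w"] k tf(2)[OF w] by simp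
    qed
    then show ?thesis by (auto simp: compose_def hom_id_def tr)
  qed
  also have "\<dots> = t ?P ?P (hom_id ?P)" by (rule T.preserves_id[OF P, symmetric])
  finally have eq: "compose (carrier ?P) f r = hom_id ?P"
    using faithful[OF P P right_hom_compose[OF P r f] right_hom_id[OF P]] by simp
  have "f (r p) = p" if "p \<in> carrier ?P" for p
    using fun_cong[OF eq, of p] that by (simp add: compose_def hom_id_def)
  then show ?thesis using r by blast
qed

lemma generator_nonzero: "\<exists>p\<in>carrier generator. p \<noteq> \<zero>\<^bsub>generator\<^esub>"
proof (rule ccontr)
  assume "\<not> ?thesis"
  then have "\<forall>p\<in>carrier generator. hom_id generator p = \<zero>\<^bsub>generator\<^esub>" by (auto simp: hom_id_def)
  then have z: "\<forall>q\<in>carrier (T generator). q = \<zero>\<^bsub>T generator\<^esub>"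
    using t_zero_iff[OF generator_module generator_module right_hom_id[OF generator_module]]
      T.preserves_id[OF generator_module] by (auto simp: hom_id_def)
  obtain u where "u \<in> carrier (T generator)" "coordinate u = \<one>" using unit_vector_exists by blast
  then show False using z coordinate_zero by auto
qed

text \<open>For an idempotent \<open>e\<close> this is \<open>A e A\<close>, written as the sums
  that \<open>full_split_idempotent\<close> requires to reach \<open>1\<close>.\<close>

definition trace_ideal :: "'a \<Rightarrow> 'a set" where
  "trace_ideal e = {a. \<exists>n::nat. \<exists>x y.
    (\<forall>i<n. x i \<in> principal_left e \<and> y i \<in> principal_right e) \<and>
    (\<Oplus>\<^bsub>A\<^esub>i\<in>{..<n}. x i \<cdot> y i) = a}"

lemma trace_ideal_add_product:
  assumes a: "a \<in> trace_ideal e" and u: "u \<in> principal_left e" and v: "v \<in> principal_right e"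
  shows "u \<cdot> v \<oplus>\<^bsub>A\<^esub> a \<in> trace_ideal e"
proof -
  obtain n :: nat and x y where xy: "\<And>i. i < n \<Longrightarrow> x i \<in> principal_left e"
      "\<And>i. i < n \<Longrightarrow> y i \<in> principal_right e"
    and sum: "(\<Oplus>\<^bsub>A\<^esub>i\<in>{..<n}. x i \<cdot> y i) = a" using a unfolding trace_ideal_def by blast
  have c: "x i \<in> carrier A" "y i \<in> carrier A" if "i < n" for i
    using principal_leftD(1)[OF xy(1)[OF that]] principal_rightD(1)[OF xy(2)[OF that]] .
  have uv: "u \<in> carrier A" "v \<in> carrier A"
    using principal_leftD(1)[OF u] principal_rightD(1)[OF v] .
  let ?x = "x(n := u)" and ?y = "y(n := v)"
  have "(\<Oplus>\<^bsub>A\<^esub>i\<in>{..<Suc n}. ?x i \<cdot> ?y i) = u \<cdot> v \<oplus>\<^bsub>A\<^esub> (\<Oplus>\<^bsub>A\<^esub>i\<in>{..<n}. ?x i \<cdot> ?y i)"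
    using c uv by (subst M.finsum_lessThan_Suc) (auto simp: less_Suc_eq)
  also have "(\<Oplus>\<^bsub>A\<^esub>i\<in>{..<n}. ?x i \<cdot> ?y i) = a"
    unfolding sum[symmetric] using c by (intro M.finsum_cong' refl) auto
  finally have "(\<Oplus>\<^bsub>A\<^esub>i\<in>{..<Suc n}. ?x i \<cdot> ?y i) = u \<cdot> v \<oplus>\<^bsub>A\<^esub> a" .
  moreover have "\<forall>i<Suc n. ?x i \<in> principal_left e \<and> ?y i \<in> principal_right e"
    using xy u v by (auto simp: less_Suc_eq)
  ultimately show ?thesis unfolding trace_ideal_def by blast
qed

lemma trace_ideal_zero: "\<zero>\<^bsub>A\<^esub> \<in> trace_ideal e"
  unfolding trace_ideal_def by (auto intro!: exI[of _ "0::nat"])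

lemma trace_ideal_carrier: "trace_ideal e \<subseteq> carrier A"
proof
  fix a assume "a \<in> trace_ideal e"
  then obtain n :: nat and x y where xy: "\<And>i. i < n \<Longrightarrow> x i \<in> principal_left e"
      "\<And>i. i < n \<Longrightarrow> y i \<in> principal_right e"
    and sum: "(\<Oplus>\<^bsub>A\<^esub>i\<in>{..<n}. x i \<cdot> y i) = a" unfolding trace_ideal_def by blast
  then show "a \<in> carrier A" unfolding sum[symmetric]
    using principal_leftD(1)[OF xy(1)] principal_rightD(1)[OF xy(2)]
    by (intro M.finsum_closed) auto
qed

text \<open>The products in \<open>a\<close> are prepended to the sum for \<open>b\<close> one at a
  time, which avoids concatenating two index ranges.\<close>

lemma trace_ideal_add:
  assumes a: "a \<in> trace_ideal e" and b: "b \<in> trace_ideal e"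
  shows "a \<oplus>\<^bsub>A\<^esub> b \<in> trace_ideal e"
proof -
  have bc: "b \<in> carrier A" using b trace_ideal_carrier by blast
  obtain n :: nat and x y where xy: "\<And>i. i < n \<Longrightarrow> x i \<in> principal_left e"
      "\<And>i. i < n \<Longrightarrow> y i \<in> principal_right e"
    and sum: "(\<Oplus>\<^bsub>A\<^esub>i\<in>{..<n}. x i \<cdot> y i) = a" using a unfolding trace_ideal_def by blast
  have c: "x i \<in> carrier A" "y i \<in> carrier A" if "i < n" for i
    using principal_leftD(1)[OF xy(1)[OF that]] principal_rightD(1)[OF xy(2)[OF that]] .
  have "(\<Oplus>\<^bsub>A\<^esub>i\<in>{..<k}. x i \<cdot> y i) \<oplus>\<^bsub>A\<^esub> b \<in> trace_ideal e" if "k \<le> n" for k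
    using that
  proof (induction k)
    case 0
    then show ?case using b bc by simp
  next
    case (Suc k)
    then have k: "k < n" by simp
    have s: "(\<Oplus>\<^bsub>A\<^esub>i\<in>{..<k}. x i \<cdot> y i) \<in> carrier A" using c k by (intro M.finsum_closed) auto
    have "(\<Oplus>\<^bsub>A\<^esub>i\<in>{..<Suc k}. x i \<cdot> y i) \<oplus>\<^bsub>A\<^esub> b =
        x k \<cdot> y k \<oplus>\<^bsub>A\<^esub> ((\<Oplus>\<^bsub>A\<^esub>i\<in>{..<k}. x i \<cdot> y i) \<oplus>\<^bsub>A\<^esub> b)"
      using c k s bc by (subst M.finsum_lessThan_Suc) (auto simp: M.a_assoc)
    then show ?case using trace_ideal_add_product[OF _ xy(1)[OF k] xy(2)[OF k]] Suc by simp
  qed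
  from this[of n] show ?thesis by (simp add: sum)
qed

lemma trace_ideal_mult:
  assumes e: "e \<in> carrier A" and a: "a \<in> trace_ideal e" and r: "r \<in> carrier A"
  shows "r \<cdot> a \<in> trace_ideal e" "a \<cdot> r \<in> trace_ideal e"
proof -
  obtain n :: nat and x y where xy: "\<And>i. i < n \<Longrightarrow> x i \<in> principal_left e"
      "\<And>i. i < n \<Longrightarrow> y i \<in> principal_right e"
    and sum: "(\<Oplus>\<^bsub>A\<^esub>i\<in>{..<n}. x i \<cdot> y i) = a" using a unfolding trace_ideal_def by blast
  have c: "x i \<in> carrier A" "y i \<in> carrier A" if "i < n" for i
    using principal_leftD(1)[OF xy(1)[OF that]] principal_rightD(1)[OF xy(2)[OF that]] .
  have "r \<cdot> a = (\<Oplus>\<^bsub>A\<^esub>i\<in>{..<n}. r \<cdot> (x i \<cdot> y i))"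
    unfolding sum[symmetric] using c r by (intro finsum_rdistr) auto
  also have "\<dots> = (\<Oplus>\<^bsub>A\<^esub>i\<in>{..<n}. (r \<cdot> x i) \<cdot> y i)"
    using c r by (intro M.finsum_cong' refl) (auto simp: m_assoc)
  finally show "r \<cdot> a \<in> trace_ideal e"
    unfolding trace_ideal_def using xy principal_left_mult[OF e _ r]
    by (intro CollectI exI[of _ n] exI[of _ "\<lambda>i. r \<cdot> x i"] exI[of _ y]) auto
  have "a \<cdot> r = (\<Oplus>\<^bsub>A\<^esub>i\<in>{..<n}. (x i \<cdot> y i) \<cdot> r)"
    unfolding sum[symmetric] using c r by (intro finsum_ldistr) auto
  also have "\<dots> = (\<Oplus>\<^bsub>A\<^esub>i\<in>{..<n}. x i \<cdot> (y i \<cdot> r))"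
    using c r by (intro M.finsum_cong' refl) (auto simp: m_assoc)
  finally show "a \<cdot> r \<in> trace_ideal e"
    unfolding trace_ideal_def using xy principal_right_mult[OF e _ r]
    by (intro CollectI exI[of _ n] exI[of _ x] exI[of _ "\<lambda>i. y i \<cdot> r"]) auto
qed

lemma trace_ideal_minus:
  assumes e: "e \<in> carrier A" and a: "a \<in> trace_ideal e" and b: "b \<in> trace_ideal e"
  shows "a \<ominus>\<^bsub>A\<^esub> b \<in> trace_ideal e"
proof -
  have "b \<in> carrier A" using b trace_ideal_carrier by blast
  then have "(\<ominus>\<^bsub>A\<^esub> \<one>\<^bsub>A\<^esub>) \<cdot> b = \<ominus>\<^bsub>A\<^esub> b" by (simp add: l_minus)
  then show ?thesis using trace_ideal_add[OF a trace_ideal_mult(1)[OF e b, of "\<ominus>\<^bsub>A\<^esub> \<one>\<^bsub>A\<^esub>"]]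
    by (simp add: a_minus_def)
qed

lemma full_split_idempotent_exists: "\<exists>e. full_split_idempotent e"
proof -
  let ?P = generator
  note P = generator_module
  interpret P: right_module A ?P by (rule P)
  let ?AA = "right_ideal_module (carrier A)"
  interpret AA: right_module A ?AA by (intro right_ideal_module) auto
  interpret Q: module_congruence A ?AA gA
    by (rule AA.inj_module_congruence) (simp add: gA)
  let ?Q = "transport gA ?AA"
  note Qm = Q.transport_module
  have dec: "inv_into (carrier A) gA (gA a) = a" if "a \<in> carrier A" for a
    using that by (rule inv_into_f_f[OF gA])
  have Qc: "carrier ?Q = gA ` carrier A" using Q.transport_carrier by simp
  obtain p0 where p0: "p0 \<in> carrier ?P" "p0 \<noteq> \<zero>\<^bsub>?P\<^esub>" using generator_nonzero by blast
  \<comment> \<open>The map \<open>a \<mapsto> p0 a\<close> from the copy of \<open>A\<close> to the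
    generator \<open>P\<close>. It is nonzero at \<open>1\<close>, so it splits.\<close>
  define f where "f = (\<lambda>q\<in>carrier ?Q. inv_into (carrier A) gA q \<odot>\<^bsub>?P\<^esub> p0)"
  have f_val: "f (gA a) = a \<odot>\<^bsub>?P\<^esub> p0" if "a \<in> carrier A" for a
    using that dec by (simp add: f_def Qc)
  have f: "f \<in> right_hom A ?Q ?P"
  proof (rule right_homI)
    show "f \<in> extensional (carrier ?Q)" by (simp add: f_def)
    fix q assume "q \<in> carrier ?Q"
    then obtain a where a: "a \<in> carrier A" "q = gA a" by (auto simp: Qc)
    show "f q \<in> carrier ?P" using a p0 f_val P.act_closed by simp
    {
      fix q' assume "q' \<in> carrier ?Q"
      then obtain a' where a': "a' \<in> carrier A" "q' = gA a'" by (auto simp: Qc)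
      show "f (q \<oplus>\<^bsub>?Q\<^esub> q') = f q \<oplus>\<^bsub>?P\<^esub> f q'"
        using a a' p0 f_val P.act_scalar_distr Q.transport_add[of a a'] by simp
    }
    fix r assume r: "r \<in> carrier A"
    show "f (r \<odot>\<^bsub>?Q\<^esub> q) = r \<odot>\<^bsub>?P\<^esub> f q"
      using a r p0 f_val P.act_assoc Q.transport_act[of r a] by simp
  qed
  have "gA \<one>\<^bsub>A\<^esub> \<in> carrier ?Q" "f (gA \<one>\<^bsub>A\<^esub>) \<noteq> \<zero>\<^bsub>?P\<^esub>" using f_val p0 P.act_one by (auto simp: Qc)
  from generator_hom_splits[OF Qm f this] obtain r where r: "r \<in> right_hom A ?P ?Q"
    and fr: "\<And>p. p \<in> carrier ?P \<Longrightarrow> f (r p) = p" by blast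
  \<comment> \<open>The section, decoded into \<open>A\<close>: an \<open>A\<close>-linear embedding
    with \<open>p0 \<gamma>(p) = p\<close>. Its image is \<open>e A\<close> for
    \<open>e = \<gamma>(p0)\<close>, and
    \<open>e e = \<gamma>(p0 e) = \<gamma>(p0) = e\<close>.\<close>
  define \<gamma> where "\<gamma> p = inv_into (carrier A) gA (r p)" for p
  have \<gamma>: "\<gamma> p \<in> carrier A" "r p = gA (\<gamma> p)" if "p \<in> carrier ?P" for p
    using right_homD(2)[OF r that] dec by (auto simp: \<gamma>_def Qc)
  have \<gamma>_act: "\<gamma> (a \<odot>\<^bsub>?P\<^esub> p) = \<gamma> p \<cdot> a" if "a \<in> carrier A" "p \<in> carrier ?P" for a p
  proof -
    have "r (a \<odot>\<^bsub>?P\<^esub> p) = a \<odot>\<^bsub>?Q\<^esub> gA (\<gamma> p)" using right_homD(4)[OF r that] \<gamma>(2)[OF that(2)] by simp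
    also have "\<dots> = gA (\<gamma> p \<cdot> a)" using Q.transport_act[of a "\<gamma> p"] that \<gamma>(1) by simp
    finally show ?thesis using dec \<gamma>(1) that by (simp add: \<gamma>_def[of "a \<odot>\<^bsub>?P\<^esub> p"])
  qed
  have \<gamma>_add: "\<gamma> (p \<oplus>\<^bsub>?P\<^esub> q) = \<gamma> p \<oplus>\<^bsub>A\<^esub> \<gamma> q" if "p \<in> carrier ?P" "q \<in> carrier ?P" for p q
  proof -
    have "r (p \<oplus>\<^bsub>?P\<^esub> q) = gA (\<gamma> p) \<oplus>\<^bsub>?Q\<^esub> gA (\<gamma> q)"
      using right_homD(3)[OF r that] \<gamma>(2)[OF that(1)] \<gamma>(2)[OF that(2)] by simp
    also have "\<dots> = gA (\<gamma> p \<oplus>\<^bsub>A\<^esub> \<gamma> q)" using Q.transport_add[of "\<gamma> p" "\<gamma> q"] that \<gamma>(1) by simp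
    finally show ?thesis using dec \<gamma>(1) that by (simp add: \<gamma>_def[of "p \<oplus>\<^bsub>?P\<^esub> q"])
  qed
  have \<gamma>_p0: "\<gamma> p \<odot>\<^bsub>?P\<^esub> p0 = p" if "p \<in> carrier ?P" for p
    using fr[OF that] f_val[OF \<gamma>(1)[OF that]] \<gamma>(2)[OF that] by simp
  define e where "e = \<gamma> p0"
  have e: "e \<in> carrier A" "e \<odot>\<^bsub>?P\<^esub> p0 = p0" using \<gamma>(1) \<gamma>_p0 p0 by (auto simp: e_def)
  have ee: "e \<cdot> e = e" using \<gamma>_act[OF e(1) p0(1)] e(2) by (simp add: e_def)
  have e_nz: "e \<noteq> \<zero>\<^bsub>A\<^esub>" using e(2) P.zero_act[OF p0(1)] p0(2) by auto
  have scalar: "\<exists>c\<in>carrier F. b = c \<bullet> e" if b: "b \<in> corner e" for b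
  proof -
    note bD = cornerD[OF b]
    \<comment> \<open>Left multiplication by \<open>b\<close> on \<open>e A\<close>, carried over to
      \<open>P\<close>. It is a scalar \<open>c\<close> there; evaluating at \<open>p0\<close> and
      applying \<open>\<gamma>\<close> turns this into \<open>b = c e\<close>.\<close>
    define h where "h = (\<lambda>q\<in>carrier ?P. (b \<cdot> \<gamma> q) \<odot>\<^bsub>?P\<^esub> p0)"
    have "h \<in> right_hom A ?P ?P"
      using p0(1) bD(1) \<gamma>(1) P.act_closed
      by (intro right_homI) (auto simp: h_def \<gamma>_add \<gamma>_act r_distr P.act_scalar_distr
          simp flip: P.act_assoc m_assoc)
    from generator_end[OF this] obtain c where c: "c \<in> carrier F"
      and hc: "\<And>p. p \<in> carrier ?P \<Longrightarrow> h p = (c \<bullet> \<one>\<^bsub>A\<^esub>) \<odot>\<^bsub>?P\<^esub> p" by blast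
    have "b \<odot>\<^bsub>?P\<^esub> p0 = (c \<bullet> \<one>\<^bsub>A\<^esub>) \<odot>\<^bsub>?P\<^esub> p0"
      using hc[OF p0(1)] p0(1) bD(3) by (simp add: h_def e_def)
    then have "\<gamma> (b \<odot>\<^bsub>?P\<^esub> p0) = \<gamma> ((c \<bullet> \<one>\<^bsub>A\<^esub>) \<odot>\<^bsub>?P\<^esub> p0)" by simp
    then have "e \<cdot> b = e \<cdot> (c \<bullet> \<one>\<^bsub>A\<^esub>)" using \<gamma>_act p0(1) bD(1) c by (simp add: e_def)
    then show ?thesis using bD(2) c e(1) smult_one_mult(2)[OF c e(1)] by auto
  qed
  \<comment> \<open>Otherwise \<open>A / A e A\<close> is nonzero and receives a nonzero map from
    \<open>P\<close>. But every such map kills \<open>p0 = p0 e\<close>, because the quotient is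
    annihilated by \<open>e\<close>, and \<open>p0\<close> generates \<open>P\<close>.\<close>
  have "\<one>\<^bsub>A\<^esub> \<in> trace_ideal e"
  proof (rule ccontr)
    assume no: "\<one>\<^bsub>A\<^esub> \<notin> trace_ideal e"
    let ?\<phi> = "class_code A (trace_ideal e) gA"
    interpret C: module_congruence A ?AA ?\<phi>
      using trace_ideal_mult(2)[OF e(1)] trace_ideal_minus[OF e(1)]
      by (intro class_code_congruence[OF gA trace_ideal_zero trace_ideal_carrier]) auto
    let ?M = "transport ?\<phi> ?AA"
    note M = C.transport_module
    have \<phi>_eq: "?\<phi> a = ?\<phi> b \<longleftrightarrow> a \<ominus>\<^bsub>A\<^esub> b \<in> trace_ideal e" if "a \<in> carrier A" "b \<in> carrier A" for a b
      using that trace_ideal_minus[OF e(1)]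
      by (intro class_code_eq_iff[OF gA trace_ideal_zero trace_ideal_carrier]) auto
    have z: "\<zero>\<^bsub>?M\<^esub> = ?\<phi> \<zero>\<^bsub>A\<^esub>" using C.transport_zero by simp
    have m_zero: "a \<ominus>\<^bsub>A\<^esub> \<zero>\<^bsub>A\<^esub> = a" if "a \<in> carrier A" for a
      using that by (simp add: a_minus_def M.minus_equality[of "\<zero>\<^bsub>A\<^esub>" "\<zero>\<^bsub>A\<^esub>"])
    have "?\<phi> \<one>\<^bsub>A\<^esub> \<in> carrier ?M" using C.transport_carrier by simp
    moreover have "?\<phi> \<one>\<^bsub>A\<^esub> \<noteq> \<zero>\<^bsub>?M\<^esub>" using \<phi>_eq[of "\<one>\<^bsub>A\<^esub>" "\<zero>\<^bsub>A\<^esub>"] no by (simp add: z m_zero)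
    ultimately obtain h p where h: "h \<in> right_hom A ?P ?M" and p: "p \<in> carrier ?P" "h p \<noteq> \<zero>\<^bsub>?M\<^esub>"
      using generator_hom_exists[OF M] by blast
    obtain a where a: "a \<in> carrier A" "h p0 = ?\<phi> a"
      using right_homD(2)[OF h p0(1)] C.transport_carrier by auto
    have "h p0 = e \<odot>\<^bsub>?M\<^esub> h p0" using right_homD(4)[OF h e(1) p0(1)] e(2) by simp
    also have "\<dots> = ?\<phi> (a \<cdot> e)" using C.transport_act[of e a] a e(1) by simp
    also have "\<dots> = \<zero>\<^bsub>?M\<^esub>"
    proof -
      have "(a \<cdot> e) \<cdot> e \<oplus>\<^bsub>A\<^esub> \<zero>\<^bsub>A\<^esub> \<in> trace_ideal e"
        using a(1) e(1) ee by (intro trace_ideal_add_product trace_ideal_zero)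
          (auto simp: principal_left_def principal_right_def m_assoc)
      then have "a \<cdot> e \<in> trace_ideal e" using a(1) e(1) ee by (simp add: m_assoc)
      then show ?thesis using \<phi>_eq[of "a \<cdot> e" "\<zero>\<^bsub>A\<^esub>"] a(1) e(1) by (simp add: z m_zero)
    qed
    finally have "h p0 = \<zero>\<^bsub>?M\<^esub>" .
    then have "h p = \<gamma> p \<odot>\<^bsub>?M\<^esub> \<zero>\<^bsub>?M\<^esub>"
      using right_homD(4)[OF h \<gamma>(1)[OF p(1)] p0(1)] \<gamma>_p0[OF p(1)] by simp
    then show False using p(2) right_module.act_zero[OF M \<gamma>(1)[OF p(1)]] by simp
  qed
  then have "full_split_idempotent e"
    unfolding full_split_idempotent_def trace_ideal_def idempotent_def
    using e(1) ee e_nz scalar by blast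
  then show ?thesis by blast
qed

end

theorem theorem1p2:
  fixes F :: "('f, 'm) ring_scheme" and A :: "('f, 'a, 'n) module_scheme"
  assumes "field F"
    and "unital_algebra F A"
    and "vectorspace.fin_dim F A"
    and "adequate_universe TYPE('u) (carrier F)"
    and "adequate_universe TYPE('u) (carrier A)"
    and "splitting_field TYPE('u) F A"
  shows "morita_equivalent TYPE('u) F A (self_algebra F) \<longleftrightarrow> commutator_codim F A = 1"
proof -
  interpret A: unital_algebra F A by fact
  interpret A: fin_dim_algebra F A using assms(3) by unfold_locales
  \<comment> \<open>Here the splitting hypothesis passes from simple modules in the universe to
    elements of primitive corners.\<close>
  interpret A: locally_split_algebra F A
    using A.splitting_field_local_split[OF assms(6,5)] by unfold_locales
  show ?thesis
  proof
    assume "morita_equivalent TYPE('u) F A (self_algebra F)"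
    then obtain T :: "('a, 'u) module \<Rightarrow> ('f, 'u) module" and t S s \<eta> \<epsilon> where
      "linear_functor F A (self_algebra F) T t" "linear_functor F (self_algebra F) A S s"
      "natural_iso A A (\<lambda>M. M) (\<lambda>M N f. f) (\<lambda>M. S (T M)) (\<lambda>M N f. s (T M) (T N) (t M N f)) \<eta>"
      "natural_iso (self_algebra F) (self_algebra F) (\<lambda>M. T (S M)) (\<lambda>M N f. t (S M) (S N) (s M N f))
        (\<lambda>M. M) (\<lambda>M N f. f) \<epsilon>"
      unfolding morita_equivalent_def by blast
    then have equiv: "linear_equivalence F A (self_algebra F) T t S s \<eta> \<epsilon>"
      by (intro linear_equivalence.intro linear_equivalence_axioms.intro)
    obtain gF :: "'f \<Rightarrow> 'u" and gA :: "'a \<Rightarrow> 'u"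
      where g: "inj_on gF (carrier F)" "inj_on gA (carrier A)"
      using assms(4,5) by (auto simp: adequate_universe_def)
    have "morita_to_field F A T t S s \<eta> \<epsilon> gF gA"
      using assms(2) equiv g by (intro morita_to_field.intro morita_to_field_axioms.intro)
    then obtain e where "A.full_split_idempotent e"
      using morita_to_field.full_split_idempotent_exists by blast
    then show "commutator_codim F A = 1" by (rule A.full_split_commutator_codim_1[OF assms(3)])
  next
    assume "commutator_codim F A = 1"
    then obtain e where "A.full_split_idempotent e"
      using A.full_split_idempotent_exists unfolding A.commutator_codim_1_iff[OF assms(3)] by blast
    then show "morita_equivalent TYPE('u) F A (self_algebra F)"
      using A.full_split_morita_equivalent assms(4) by (auto simp: adequate_universe_def)
  qed
qed

end
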